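(* Let $\mathbf H$ be a smooth periodic Hankel operator, with non-flat band functions forming the list $\mathcal E^\#$. Then: (i) Every non-flat band function appears in $\mathcal E^\#$ exactly once; i.e. no two entries of $\mathcal E^\#$ are identically equal. (ii) For any $k_*\in\mathbb R$ and $E_*\neq0$ there are at most two entries $E\in\mathcal E^\#$ with $E(k_* )=E_*$. (iii) If two distinct entries of $\mathcal E^\#$ take the same value at a point $k_*$, then $k_*\in(\omega/2)\mathbb Z$. (iv) Every $E\in\mathcal E^\#$ satisfies $E'(k)\neq0$ for all $k\notin(\omega/2)\mathbb Z$; in particular each is strictly monotone on $(-\omega/2,0)$ and on $(0,\omega/2)$. (v) If $E_1,E_2\in\mathcal E^\#$ and $k_1,k_2\in\mathbb R$ satisfy $E_1(k_1)=E_2(k_2)$, then $k_1\equiv k_2$ or $k_1\equiv -k_2 \pmod\omega$. (vi) For any $E_1,E_2\in\mathcal E^\#$ and any $k_1,k_2\in\mathbb R$, $E_1(k_1)\neq-E_2(k_2)$.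
   Context: Fix $T>0$, $\omega=2\pi/T$. $p$ is a real-valued $T$-periodic function with Fourier coefficients $\widetilde p_\ell=\frac1T\int_0^Te^{-i\ell\omega x}p(x)dx$ satisfying $\sum_\ell|\widetilde p_\ell|(1+\ell^2)^{1/4}<\infty$; $\mathbf H$ is the Hankel operator on $L^2(\mathbb R_+)$ with kernel $h(t)=p(\log t)/t$ (a smooth periodic Hankel operator). For $k\in\mathbb R$, $H(k)$ is the trace class self-adjoint operator on $\ell^2(\mathbb Z)$ with matrix $[H(k)]_{n,m}=B(\frac12-i\omega n-ik,\frac12+i\omega m+ik)\widetilde p_{n-m}$, $B(z_1,z_2)=\Gamma(z_1)\Gamma(z_2)/\Gamma(z_1+z_2)$. Band functions: there is a (unique up to ordering) finite or countable list $\mathcal E$, repetitions allowed, of non-vanishing real analytic real-valued functions on $\mathbb R$ such that for every $k$ the non-zero eigenvalues of $H(k)$, counted with multiplicity, are exactly the values $E(k)$, $E\in\mathcal E$, counted with repetition. A band function is flat if constant and non-flat otherwise; $\mathcal E^\#$ is the sublist of non-flat ones. *)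

theory Defs
  imports "HOL-Analysis.Analysis"
begin

definition omega :: "real \<Rightarrow> real" where
  "omega T = 2 * pi / T"

definition fourier_coeff :: "real \<Rightarrow> (real \<Rightarrow> real) \<Rightarrow> int \<Rightarrow> complex" where
  "fourier_coeff T p l =
     complex_of_real (1 / T) *
     integral {0..T} (\<lambda>x. exp (- \<i> * of_int l * of_real (omega T) * of_real x) * of_real (p x))"

definition Hmat :: "real \<Rightarrow> (real \<Rightarrow> real) \<Rightarrow> real \<Rightarrow> int \<Rightarrow> int \<Rightarrow> complex" where
  "Hmat T p k n m =
     Beta (1/2 - \<i> * of_real (omega T) * of_int n - \<i> * of_real k)
          (1/2 + \<i> * of_real (omega T) * of_int m + \<i> * of_real k)
     * fourier_coeff T p (n - m)"

definition in_eigenspace :: "real \<Rightarrow> (real \<Rightarrow> real) \<Rightarrow> real \<Rightarrow> complex \<Rightarrow> (int \<Rightarrow> complex) \<Rightarrow> bool" where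
  "in_eigenspace T p k lam x \<longleftrightarrow>
     (\<lambda>n. (norm (x n))\<^sup>2) summable_on UNIV \<and>
     (\<forall>n. ((\<lambda>m. Hmat T p k n m * x m) has_sum (lam * x n)) UNIV)"

definition mult_at_least :: "real \<Rightarrow> (real \<Rightarrow> real) \<Rightarrow> real \<Rightarrow> complex \<Rightarrow> nat \<Rightarrow> bool" where
  "mult_at_least T p k lam d \<longleftrightarrow>
     (\<exists>v :: nat \<Rightarrow> int \<Rightarrow> complex.
        (\<forall>i<d. in_eigenspace T p k lam (v i)) \<and>
        (\<forall>c :: nat \<Rightarrow> complex. (\<forall>n. (\<Sum>i<d. c i * v i n) = 0) \<longrightarrow> (\<forall>i<d. c i = 0)))"

definition real_analytic :: "(real \<Rightarrow> real) \<Rightarrow> bool" where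
  "real_analytic f \<longleftrightarrow>
     (\<forall>x. \<exists>r>0. \<exists>a :: nat \<Rightarrow> real.
        \<forall>y. \<bar>y - x\<bar> < r \<longrightarrow> (\<lambda>n. a n * (y - x) ^ n) sums f y)"

text \<open>The family (E i)_{i in I} (I a finite or countable index set, repetitions
  allowed) is a list of band functions of the periodic Hankel operator:
  each E i is real analytic, real valued and nowhere vanishing, and for every k
  the nonzero eigenvalues of H(k), with multiplicity, are exactly the values E i k.\<close>
definition band_functions ::
  "real \<Rightarrow> (real \<Rightarrow> real) \<Rightarrow> nat set \<Rightarrow> (nat \<Rightarrow> real \<Rightarrow> real) \<Rightarrow> bool" where
  "band_functions T p I E \<longleftrightarrow>
     (\<forall>i\<in>I. real_analytic (E i) \<and> (\<forall>k. E i k \<noteq> 0)) \<and>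
     (\<forall>k. \<forall>lam::complex. lam \<noteq> 0 \<longrightarrow>
        finite {i\<in>I. complex_of_real (E i k) = lam} \<and>
        (\<forall>d. mult_at_least T p k lam d \<longleftrightarrow> d \<le> card {i\<in>I. complex_of_real (E i k) = lam}))"

definition flat :: "(real \<Rightarrow> real) \<Rightarrow> bool" where
  "flat f \<longleftrightarrow> (\<exists>c. \<forall>k. f k = c)"

end

theory Submission
  imports Defs "HOL-Complex_Analysis.Complex_Analysis"
begin

text \<open>
  Conjugating the matrix of \<open>H(k)\<close> by \<open>\<Gamma>(1/2 + \<i>\<omega>n + \<i>k)\<close> turns its entries, by the reflection formula, into
  \<open>\<pi> sech(\<pi>(k + \<omega>n)) c(n - m)\<close> with \<open>c(l) = p(l) / \<Gamma>(1 - \<i>\<omega>l)\<close>. A further diagonal conjugation makes it absolutely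
  summable, so \<open>det(I - z H(k))\<close> exists as a von Koch determinant; clearing the denominators \<open>cosh(\<pi>(k + \<omega>n))\<close>
  row by row yields a function \<open>G(k, z)\<close>, entire in both variables, with \<open>G(k + \<i>, z) = G(k, -z)\<close> and
  \<open>G(k + \<omega>, z) = exp(2\<pi>k) G(k, z)\<close>. Hence its even and odd parts in \<open>z\<close> are theta functions of order one in \<open>k\<close>, and
  Liouville's theorem gives \<open>G(k, z) = a(z) Y(k) + b(z) Yo(k)\<close> with \<open>a\<close> even and \<open>b\<close> odd. On the real line
  \<open>\<phi> = Yo / Y\<close> is an infinite product that is positive and strictly increasing in \<open>cos(2\<pi>k/\<omega>)\<close>.
  A non-flat band therefore satisfies \<open>\<phi>(k) = -(a/b)(1/E(k))\<close>, from which everything follows; two equal bands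
  would force a double zero of \<open>G(k, \<cdot>)\<close> and so a critical point of \<open>a/b\<close>.
\<close>

section \<open>Determinants over finite index sets\<close>

text \<open>The passage from operator to determinant goes one way only: an eigenvector makes
  \<open>G\<close> vanish, and two independent ones make it vanish to second order. Both facts come
  from column operations, a column of the truncated matrix being replaced by the image of the
  eigenvector, whose l1 norm is O(|1 - z * lam|). The weight with exponent 1/4 on the coefficients
  of \<open>p\<close> is what absolute summability asks for: 1/|Gamma(1 - i omega l)| grows like
  exp(pi omega |l|/2) / sqrt |l|, the symmetrised sech weights along the l-th diagonal sum to about
  |l| exp(-pi omega |l|/2), and the product is of size sqrt |l|. Flat bands are the obstacle at the
  end. If E is a flat value, 1/E is a common zero of \<open>a\<close> and \<open>b\<close>, so a/b
  can only be studied after cancelling a common power of z - z0, and a double zero found at z0 may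
  be due to that power alone. The crossing argument therefore moves to a nearby point where the
  power does not vanish.\<close>

definition fdet :: "'a set \<Rightarrow> ('a \<Rightarrow> 'a \<Rightarrow> complex) \<Rightarrow> complex" where
  "fdet S M = (\<Sum>p | p permutes S. of_int (sign p) * (\<Prod>j\<in>S. M (p j) j))"

definition set_col :: "('a \<Rightarrow> 'b \<Rightarrow> complex) \<Rightarrow> 'b \<Rightarrow> ('a \<Rightarrow> complex) \<Rightarrow> 'a \<Rightarrow> 'b \<Rightarrow> complex" where
  "set_col M j u = (\<lambda>i l. if l = j then u i else M i l)"

lemma fdet_cong:
  assumes "\<And>i j. i \<in> S \<Longrightarrow> j \<in> S \<Longrightarrow> M i j = N i j"
  shows "fdet S M = fdet S N"
  unfolding fdet_def
  by (intro sum.cong refl arg_cong2[where f="(*)"] prod.cong)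
     (auto intro!: assms simp: permutes_in_image)

lemma norm_fdet_le:
  assumes "finite S"
  shows "norm (fdet S M) \<le> (\<Prod>j\<in>S. \<Sum>i\<in>S. norm (M i j))"
proof -
  let ?P = "{p. p permutes S}"
  \<comment> \<open>A permutation of \<open>S\<close> is the identity outside \<open>S\<close>,
    whereas functions in \<open>PiE\<close> are \<open>undefined\<close> there. Restriction embeds
    the permutations into the maps over which the product of column sums expands.\<close>
  have inj: "inj_on (\<lambda>p. restrict p S) ?P"
  proof (rule inj_onI)
    fix p q assume pq: "p \<in> ?P" "q \<in> ?P" and eq: "restrict p S = restrict q S"
    have "p x = q x" for x
    proof (cases "x \<in> S")
      case True
      then show ?thesis using fun_cong[OF eq, of x] by simp
    qed (use pq in \<open>auto simp: permutes_not_in\<close>)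
    then show "p = q" by auto
  qed
  have "norm (fdet S M) \<le> (\<Sum>p\<in>?P. norm (of_int (sign p) * (\<Prod>j\<in>S. M (p j) j)))"
    unfolding fdet_def by (rule norm_sum)
  also have "\<dots> = (\<Sum>p\<in>?P. \<Prod>j\<in>S. norm (M (p j) j))"
    by (intro sum.cong refl) (simp add: norm_mult prod_norm sign_def)
  also have "\<dots> = (\<Sum>p\<in>?P. \<Prod>j\<in>S. norm (M (restrict p S j) j))"
    by (intro sum.cong refl prod.cong) auto
  also have "\<dots> = (\<Sum>g\<in>(\<lambda>p. restrict p S) ` ?P. \<Prod>j\<in>S. norm (M (g j) j))"
    by (subst sum.reindex[OF inj]) simp
  also have "\<dots> \<le> (\<Sum>g\<in>PiE S (\<lambda>_. S). \<Prod>j\<in>S. norm (M (g j) j))"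
    using assms by (intro sum_mono2 finite_PiE) (auto intro!: prod_nonneg simp: permutes_in_image)
  also have "\<dots> = (\<Prod>j\<in>S. \<Sum>i\<in>S. norm (M i j))"
    using assms by (subst prod_sum_PiE) auto
  finally show ?thesis .
qed

lemma fdet_scale:
  assumes "finite S"
  shows "fdet S (\<lambda>i j. f i * M i j * h j) = prod f S * prod h S * fdet S M"
proof -
  have "(\<Prod>j\<in>S. f (p j) * M (p j) j * h j) = prod f S * prod h S * (\<Prod>j\<in>S. M (p j) j)"
    if "p permutes S" for p
  proof -
    have "(\<Prod>j\<in>S. f (p j)) = prod f S"
      using prod.permute[OF that, of f] by (simp add: o_def)
    then show ?thesis by (simp add: prod.distrib)
  qed
  then show ?thesis
    unfolding fdet_def sum_distrib_left by (intro sum.cong refl) (simp add: mult_ac)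
qed

lemma fdet_reindex:
  assumes "finite S" "inj_on f S"
  shows "fdet (f ` S) M = fdet S (\<lambda>i j. M (f i) (f j))"
proof -
  have bij: "bij_betw f S (f ` S)" using assms by (simp add: bij_betw_def)
  have mp: "map_permutation S f p = (\<lambda>x. if x \<in> f ` S then f (p (inv_into S f x)) else x)" for p
    by (auto simp: map_permutation_def restrict_id_def fun_eq_iff)
  have bb: "bij_betw (map_permutation S f) {p. p permutes S} {p. p permutes (f ` S)}"
    using bij_betw_permutations[OF bij] by (simp add: mp[abs_def])
  have "fdet (f ` S) M
      = (\<Sum>p | p permutes S. of_int (sign (map_permutation S f p)) *
           (\<Prod>j\<in>f ` S. M (map_permutation S f p j) j))"
    unfolding fdet_def by (rule sum.reindex_bij_betw[OF bb, symmetric])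
  also have "\<dots> = fdet S (\<lambda>i j. M (f i) (f j))"
    unfolding fdet_def
  proof (intro sum.cong refl)
    fix p assume "p \<in> {p. p permutes S}"
    then have p: "p permutes S" by simp
    have "(\<Prod>j\<in>f ` S. M (map_permutation S f p j) j) = (\<Prod>j\<in>S. M (f (p j)) (f j))"
      using assms by (subst prod.reindex) (auto simp: mp intro!: prod.cong)
    then show "of_int (sign (map_permutation S f p)) * (\<Prod>j\<in>f ` S. M (map_permutation S f p j) j)
        = of_int (sign p) * (\<Prod>j\<in>S. M (f (p j)) (f j))"
      by (simp add: sign_map_permutation[OF assms(2) p assms(1)])
  qed
  finally show ?thesis .
qed

lemma fdet_identical_columns:
  assumes S: "finite S" "a \<in> S" "b \<in> S" "a \<noteq> b" and eq: "\<And>i. i \<in> S \<Longrightarrow> M i a = M i b"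
  shows "fdet S M = 0"
proof -
  let ?t = "Transposition.transpose a b"
  have t: "?t permutes S" using S by (intro permutes_swap_id)
  have "fdet S M = (\<Sum>p | p permutes S. of_int (sign (p \<circ> ?t)) * (\<Prod>j\<in>S. M ((p \<circ> ?t) j) j))"
    unfolding fdet_def by (rule sum_permutations_compose_right[OF t])
  also have "\<dots> = (\<Sum>p | p permutes S. - (of_int (sign p) * (\<Prod>j\<in>S. M (p j) j)))"
  proof (intro sum.cong refl)
    fix p assume "p \<in> {p. p permutes S}"
    then have p: "p permutes S" by simp
    have sg: "sign (p \<circ> ?t) = - sign p"
      using p t S by (subst sign_compose) (auto simp: permutation_permutes sign_swap_id permutes_imp_permutation)
    have "(\<Prod>j\<in>S. M ((p \<circ> ?t) j) j) = (\<Prod>j\<in>S. M (p (?t j)) (?t j))"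
    proof (rule prod.cong[OF refl])
      fix j assume "j \<in> S"
      have "p a \<in> S" "p b \<in> S" using p S by (auto simp: permutes_in_image)
      then show "M ((p \<circ> ?t) j) j = M (p (?t j)) (?t j)"
        using eq by (auto simp: Transposition.transpose_def)
    qed
    also have "\<dots> = (\<Prod>j\<in>S. M (p j) j)"
      using prod.permute[OF t, of "\<lambda>j. M (p j) j"] by (simp add: o_def)
    finally show "of_int (sign (p \<circ> ?t)) * (\<Prod>j\<in>S. M ((p \<circ> ?t) j) j)
        = - (of_int (sign p) * (\<Prod>j\<in>S. M (p j) j))"
      by (simp add: sg)
  qed
  also have "\<dots> = - fdet S M" by (simp add: fdet_def sum_negf)
  finally show ?thesis by simp
qed

text \<open>Isolating the one factor that involves \<open>u\<close> shows the determinant as a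
  linear form in column \<open>j\<close>; the two linearity rules below are read off from
  it.\<close>

lemma fdet_set_col:
  assumes "finite S" "j \<in> S"
  shows "fdet S (set_col M j u)
    = (\<Sum>p | p permutes S. of_int (sign p) * (\<Prod>l\<in>S - {j}. M (p l) l) * u (p j))"
  unfolding fdet_def
proof (intro sum.cong refl)
  fix p
  have "(\<Prod>l\<in>S. set_col M j u (p l) l) = u (p j) * (\<Prod>l\<in>S - {j}. set_col M j u (p l) l)"
    using assms by (subst prod.remove[of _ j]) (auto simp: set_col_def)
  also have "(\<Prod>l\<in>S - {j}. set_col M j u (p l) l) = (\<Prod>l\<in>S - {j}. M (p l) l)"
    by (intro prod.cong) (auto simp: set_col_def)
  finally show "of_int (sign p) * (\<Prod>l\<in>S. set_col M j u (p l) l)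
      = of_int (sign p) * (\<Prod>l\<in>S - {j}. M (p l) l) * u (p j)" by simp
qed

lemma fdet_set_col_sum:
  assumes "finite S" "j \<in> S"
  shows "fdet S (set_col M j (\<lambda>i. \<Sum>m\<in>R. x m * u m i)) = (\<Sum>m\<in>R. x m * fdet S (set_col M j (u m)))"
  unfolding fdet_set_col[OF assms]
  by (simp add: sum_distrib_left sum_distrib_right sum.swap[of _ _ R] mult_ac)

lemma fdet_set_col_diff:
  assumes "finite S" "j \<in> S"
  shows "fdet S (set_col M j (\<lambda>i. u i - v i)) = fdet S (set_col M j u) - fdet S (set_col M j v)"
  unfolding fdet_set_col[OF assms] by (simp add: algebra_simps sum_subtractf)

text \<open>Every term with \<open>m\<close> different from \<open>j\<close> duplicates a column.
  When \<open>x\<close> is a truncated eigenvector the new column is small, which is how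
  eigenvectors enter the bounds on determinants.\<close>

lemma fdet_column_combination:
  assumes S: "finite S" "j \<in> S"
  shows "fdet S (set_col M j (\<lambda>i. \<Sum>m\<in>S. x m * M i m)) = x j * fdet S M"
proof -
  have "fdet S (set_col M j (\<lambda>i. M i m)) = (if m = j then fdet S M else 0)" if "m \<in> S" for m
  proof (cases "m = j")
    case True
    then show ?thesis by (auto intro!: arg_cong[where f="fdet S"] simp: set_col_def fun_eq_iff)
  next
    case False
    then show ?thesis using S that
      by (auto intro!: fdet_identical_columns[of S j m] simp: set_col_def)
  qed
  then have "(\<Sum>m\<in>S. x m * fdet S (set_col M j (\<lambda>i. M i m))) = (\<Sum>m\<in>S. if m = j then x m * fdet S M else 0)"
    by (intro sum.cong) auto
  then show ?thesis using S by (simp add: fdet_set_col_sum)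
qed

text \<open>Only permutations fixing \<open>s\<close> survive against the unit column. This lets
  determinants over different index sets be compared as determinants of the same size.\<close>

lemma fdet_insert_unit_column:
  assumes S: "finite S" "s \<notin> S"
  shows "fdet (insert s S) (set_col M s (\<lambda>i. if i = s then 1 else 0)) = fdet S M"
proof -
  have "fdet (insert s S) (set_col M s (\<lambda>i. if i = s then 1 else 0))
      = (\<Sum>p | p permutes insert s S. of_int (sign p) * (\<Prod>l\<in>S. M (p l) l) * (if p s = s then 1 else 0))"
    using S by (subst fdet_set_col) auto
  also have "\<dots> = (\<Sum>p | p permutes S. of_int (sign p) * (\<Prod>l\<in>S. M (p l) l))"
  proof (rule sum.mono_neutral_cong_right)
    show "finite {p. p permutes insert s S}" using S by (simp add: finite_permutations)
    show "{p. p permutes S} \<subseteq> {p. p permutes insert s S}"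
      by (auto intro: permutes_subset)
    show "\<forall>p\<in>{p. p permutes insert s S} - {p. p permutes S}.
        of_int (sign p) * (\<Prod>l\<in>S. M (p l) l) * (if p s = s then 1 else 0) = 0"
    proof
      fix p assume p: "p \<in> {p. p permutes insert s S} - {p. p permutes S}"
      then have "p s \<noteq> s"
        using permutes_superset[of p "insert s S" S] by auto
      then show "of_int (sign p) * (\<Prod>l\<in>S. M (p l) l) * (if p s = s then 1 else 0) = 0" by simp
    qed
  qed (use S in \<open>auto simp: permutes_not_in\<close>)
  finally show ?thesis by (simp add: fdet_def)
qed

section \<open>Von Koch determinants\<close>

definition win :: "nat \<Rightarrow> int set" where
  "win N = {- int N..int N}"

definition vkdet :: "(int \<Rightarrow> int \<Rightarrow> complex) \<Rightarrow> complex" where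
  "vkdet M = lim (\<lambda>N. fdet (win N) M)"

text \<open>Closeness to the identity in column sums. Finite partial sums stand in for the infinite
  ones, so that no summability of columns has to be carried along; \<open>\<alpha>\<close> is
  separate from \<open>M\<close> so that one bound can serve a whole family of matrices.\<close>

definition col_bound :: "(int \<Rightarrow> real) \<Rightarrow> (int \<Rightarrow> int \<Rightarrow> complex) \<Rightarrow> bool" where
  "col_bound \<alpha> M \<longleftrightarrow> \<alpha> summable_on UNIV \<and>
     (\<forall>S j. finite S \<longrightarrow> (\<Sum>i\<in>S. norm (M i j - (if i = j then 1 else 0))) \<le> \<alpha> j)"

lemma has_sum_finite_sum:
  fixes f :: "'b \<Rightarrow> 'a \<Rightarrow> 'c :: {topological_comm_monoid_add, t2_space}"
  assumes "finite S" "\<And>n. n \<in> S \<Longrightarrow> (f n has_sum s n) A"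
  shows "((\<lambda>m. \<Sum>n\<in>S. f n m) has_sum (\<Sum>n\<in>S. s n)) A"
  using assms by (induction S) (auto intro!: has_sum_add)

lemma finite_win [simp]: "finite (win N)"
  by (simp add: win_def)

lemma filterlim_win: "filterlim win (finite_subsets_at_top UNIV) sequentially"
proof -
  have "\<forall>\<^sub>F N in sequentially. finite (win N) \<and> X \<subseteq> win N \<and> win N \<subseteq> UNIV" if "finite X" for X
  proof -
    have "\<forall>x\<in>X. x \<in> win N" if "N \<ge> (\<Sum>x\<in>X. nat \<bar>x\<bar>)" for N
    proof
      fix x assume x: "x \<in> X"
      have "nat \<bar>x\<bar> \<le> (\<Sum>x\<in>X. nat \<bar>x\<bar>)"
        using \<open>finite X\<close> x by (intro member_le_sum) auto
      then show "x \<in> win N" using that by (auto simp: win_def)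
    qed
    then show ?thesis unfolding eventually_sequentially by (intro exI[of _ "\<Sum>x\<in>X. nat \<bar>x\<bar>"]) auto
  qed
  then show ?thesis by (auto simp: filterlim_finite_subsets_at_top)
qed

section \<open>Truncation estimates under summable column bounds\<close>

context
  fixes \<alpha> :: "int \<Rightarrow> real" and M :: "int \<Rightarrow> int \<Rightarrow> complex"
  assumes cb: "col_bound \<alpha> M"
begin

lemma col_bound_nonneg: "\<alpha> j \<ge> 0"
  using cb unfolding col_bound_def by (metis finite.emptyI sum.empty)

lemma col_bound_has_sum: "(\<alpha> has_sum infsum \<alpha> UNIV) UNIV"
  using cb unfolding col_bound_def by (auto intro: has_sum_infsum)

lemma col_bound_sum_le: "finite S \<Longrightarrow> sum \<alpha> S \<le> infsum \<alpha> UNIV"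
  using cb col_bound_nonneg unfolding col_bound_def by (intro finite_sum_le_infsum) auto

lemma col_bound_win: "(\<lambda>N. infsum \<alpha> UNIV - sum \<alpha> (win N)) \<longlonglongrightarrow> 0"
proof -
  have "(\<lambda>N. sum \<alpha> (win N)) \<longlonglongrightarrow> infsum \<alpha> UNIV"
    using filterlim_compose[OF _ filterlim_win, of "sum \<alpha>"] col_bound_has_sum
    by (auto simp: has_sum_def)
  from tendsto_diff[OF tendsto_const this, of "infsum \<alpha> UNIV"] show ?thesis by simp
qed

lemma col_bound_colsum:
  assumes "finite S"
  shows "(\<Sum>i\<in>S. norm (M i j)) \<le> 1 + \<alpha> j"
proof -
  have "(\<Sum>i\<in>S. norm (M i j))
      \<le> (\<Sum>i\<in>S. (if i = j then 1 else 0) + norm (M i j - (if i = j then 1 else 0)))"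
    by (intro sum_mono) (use norm_triangle_sub[of "M j j" 1] in auto)
  also have "\<dots> = (\<Sum>i\<in>S. if i = j then 1 else 0) + (\<Sum>i\<in>S. norm (M i j - (if i = j then 1 else 0)))"
    by (rule sum.distrib)
  also have "\<dots> \<le> 1 + \<alpha> j"
    using assms cb by (intro add_mono) (auto simp: col_bound_def)
  finally show ?thesis .
qed

text \<open>Each unmodified column contributes at most \<open>1 + \<alpha> j\<close>, hence at most
  \<open>exp (\<alpha> j)\<close>, and these multiply to a constant independent of \<open>S\<close>.
  Only the columns in \<open>J\<close> have to be estimated individually.\<close>

lemma norm_fdet_special_columns_le:
  assumes S: "finite S" "J \<subseteq> S"
    and J: "\<And>j. j \<in> J \<Longrightarrow> (\<Sum>i\<in>S. norm (M' i j)) \<le> \<beta> j"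
    and M': "\<And>i j. j \<notin> J \<Longrightarrow> M' i j = M i j"
  shows "norm (fdet S M') \<le> prod \<beta> J * exp (infsum \<alpha> UNIV)"
proof -
  have "norm (fdet S M') \<le> (\<Prod>j\<in>S. \<Sum>i\<in>S. norm (M' i j))"
    by (rule norm_fdet_le[OF S(1)])
  also have "\<dots> = (\<Prod>j\<in>J. \<Sum>i\<in>S. norm (M' i j)) * (\<Prod>j\<in>S - J. \<Sum>i\<in>S. norm (M' i j))"
    using S by (metis mult.commute prod.subset_diff)
  also have "\<dots> \<le> prod \<beta> J * exp (infsum \<alpha> UNIV)"
  proof (rule mult_mono)
    show "(\<Prod>j\<in>J. \<Sum>i\<in>S. norm (M' i j)) \<le> prod \<beta> J"
      using J by (intro prod_mono) (auto intro: sum_nonneg)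
    have "(\<Prod>j\<in>S - J. \<Sum>i\<in>S. norm (M' i j)) \<le> (\<Prod>j\<in>S - J. exp (\<alpha> j))"
    proof (rule prod_mono)
      fix j assume "j \<in> S - J"
      then have "(\<Sum>i\<in>S. norm (M' i j)) \<le> 1 + \<alpha> j"
        using col_bound_colsum[OF S(1), of j] M' by simp
      also have "\<dots> \<le> exp (\<alpha> j)" by (rule exp_ge_add_one_self)
      finally show "0 \<le> (\<Sum>i\<in>S. norm (M' i j)) \<and> (\<Sum>i\<in>S. norm (M' i j)) \<le> exp (\<alpha> j)"
        by (auto intro: sum_nonneg)
    qed
    also have "\<dots> = exp (sum \<alpha> (S - J))" using S by (simp add: exp_sum)
    also have "\<dots> \<le> exp (infsum \<alpha> UNIV)" using S by (simp add: col_bound_sum_le)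
    finally show "(\<Prod>j\<in>S - J. \<Sum>i\<in>S. norm (M' i j)) \<le> exp (infsum \<alpha> UNIV)" .
  next
    have "0 \<le> \<beta> j" if "j \<in> J" for j
      using J[OF that] by (meson norm_ge_zero order_trans sum_nonneg)
    then show "0 \<le> prod \<beta> J" by (auto intro: prod_nonneg)
    show "0 \<le> (\<Prod>j\<in>S - J. \<Sum>i\<in>S. norm (M' i j))" by (auto intro!: prod_nonneg sum_nonneg)
  qed
  finally show ?thesis .
qed

text \<open>After padding the smaller determinant with a unit column, linearity in column
  \<open>s\<close> turns the difference into one determinant whose column \<open>s\<close> is that
  of \<open>M\<close> minus the identity.\<close>

lemma norm_fdet_insert_diff_le:
  assumes "finite S" "s \<notin> S"
  shows "norm (fdet (insert s S) M - fdet S M) \<le> \<alpha> s * exp (infsum \<alpha> UNIV)"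
proof -
  have M: "M = set_col M s (\<lambda>i. M i s)" by (auto simp: set_col_def fun_eq_iff)
  have "fdet (insert s S) M - fdet S M
      = fdet (insert s S) (set_col M s (\<lambda>i. M i s))
        - fdet (insert s S) (set_col M s (\<lambda>i. if i = s then 1 else 0))"
    using M fdet_insert_unit_column[OF assms, of M] by simp
  also have "\<dots> = fdet (insert s S) (set_col M s (\<lambda>i. M i s - (if i = s then 1 else 0)))"
    using assms by (subst fdet_set_col_diff) auto
  also have "norm \<dots> \<le> prod \<alpha> {s} * exp (infsum \<alpha> UNIV)"
  proof (rule norm_fdet_special_columns_le)
    fix j assume "j \<in> {s}"
    then show "(\<Sum>i\<in>insert s S. norm (set_col M s (\<lambda>i. M i s - (if i = s then 1 else 0)) i j)) \<le> \<alpha> j"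
      using cb assms(1) unfolding col_bound_def by (simp add: set_col_def del: sum.insert)
  qed (use assms in \<open>auto simp: set_col_def\<close>)
  finally show ?thesis by simp
qed

text \<open>Telescoping over the added indices turns the one-step bound into the tail of
  \<open>\<alpha>\<close>, a rate of convergence that depends on \<open>M\<close> only through
  \<open>\<alpha>\<close>.\<close>

lemma norm_fdet_diff_le:
  assumes "finite S'" "S \<subseteq> S'"
  shows "norm (fdet S' M - fdet S M) \<le> (infsum \<alpha> UNIV - sum \<alpha> S) * exp (infsum \<alpha> UNIV)"
proof -
  have S: "finite S" using assms finite_subset by auto
  have "norm (fdet (S \<union> R) M - fdet S M) \<le> sum \<alpha> R * exp (infsum \<alpha> UNIV)"
    if "finite R" "R \<inter> S = {}" for R
    using that
  proof (induction R)
    case (insert r R)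
    have "norm (fdet (S \<union> insert r R) M - fdet S M)
        \<le> norm (fdet (insert r (S \<union> R)) M - fdet (S \<union> R) M) + norm (fdet (S \<union> R) M - fdet S M)"
      by (simp add: norm_diff_triangle_le[OF order_refl order_refl])
    also have "\<dots> \<le> \<alpha> r * exp (infsum \<alpha> UNIV) + sum \<alpha> R * exp (infsum \<alpha> UNIV)"
      using insert S by (intro add_mono norm_fdet_insert_diff_le insert.IH) auto
    finally show ?case using insert by (simp add: algebra_simps)
  qed auto
  from this[of "S' - S"] assms have "norm (fdet S' M - fdet S M) \<le> sum \<alpha> (S' - S) * exp (infsum \<alpha> UNIV)"
    by (auto simp: Un_absorb1)
  also have "sum \<alpha> (S' - S) \<le> infsum \<alpha> UNIV - sum \<alpha> S"
    using col_bound_sum_le[OF assms(1)] sum.subset_diff[OF assms(2,1), of \<alpha>] by simp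
  finally show ?thesis by simp
qed

lemma vkdet_LIMSEQ: "(\<lambda>N. fdet (win N) M) \<longlonglongrightarrow> vkdet M"
proof -
  let ?e = "\<lambda>N. (infsum \<alpha> UNIV - sum \<alpha> (win N)) * exp (infsum \<alpha> UNIV)"
  have e: "?e \<longlonglongrightarrow> 0" by (rule tendsto_mult_left_zero[OF col_bound_win])
  have "Cauchy (\<lambda>N. fdet (win N) M)"
  proof (rule CauchyI')
    fix \<epsilon> :: real assume "\<epsilon> > 0"
    then obtain N0 where N0: "\<forall>N\<ge>N0. ?e N < \<epsilon>"
      using order_tendstoD(2)[OF e, of \<epsilon>] by (auto simp: eventually_sequentially)
    have "norm (fdet (win m) M - fdet (win n) M) < \<epsilon>" if "m \<ge> N0" "n > m" for m n
    proof -
      have "norm (fdet (win n) M - fdet (win m) M) \<le> ?e m"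
        using that by (intro norm_fdet_diff_le) (auto simp: win_def)
      also have "\<dots> < \<epsilon>" using N0 that by auto
      finally show ?thesis by (simp add: norm_minus_commute)
    qed
    then show "\<exists>M0. \<forall>m\<ge>M0. \<forall>n>m. dist (fdet (win m) M) (fdet (win n) M) < \<epsilon>"
      unfolding dist_norm by blast
  qed
  then show ?thesis by (simp add: vkdet_def Cauchy_convergent_iff convergent_LIMSEQ_iff)
qed

lemma norm_vkdet_diff_le:
  "norm (vkdet M - fdet (win N) M) \<le> (infsum \<alpha> UNIV - sum \<alpha> (win N)) * exp (infsum \<alpha> UNIV)"
proof (rule tendsto_upperbound[of "\<lambda>n. norm (fdet (win n) M - fdet (win N) M)"])
  show "(\<lambda>n. norm (fdet (win n) M - fdet (win N) M)) \<longlonglongrightarrow> norm (vkdet M - fdet (win N) M)"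
    by (intro tendsto_intros vkdet_LIMSEQ)
  show "\<forall>\<^sub>F n in sequentially. norm (fdet (win n) M - fdet (win N) M)
      \<le> (infsum \<alpha> UNIV - sum \<alpha> (win N)) * exp (infsum \<alpha> UNIV)"
    using eventually_ge_at_top[of N]
    by eventually_elim (intro norm_fdet_diff_le, auto simp: win_def)
qed auto

text \<open>Needed because shifting the index by one turns symmetric windows into asymmetric
  ones.\<close>

lemma vkdet_LIMSEQ_supersets:
  assumes "\<And>N. finite (R N)" "\<And>N. win N \<subseteq> R N"
  shows "(\<lambda>N. fdet (R N) M) \<longlonglongrightarrow> vkdet M"
proof -
  let ?e = "\<lambda>N. (infsum \<alpha> UNIV - sum \<alpha> (win N)) * exp (infsum \<alpha> UNIV)"
  have e: "?e \<longlonglongrightarrow> 0" by (rule tendsto_mult_left_zero[OF col_bound_win])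
  have "(\<lambda>N. fdet (R N) M - fdet (win N) M) \<longlonglongrightarrow> 0"
    by (rule Lim_null_comparison[OF _ e]) (intro always_eventually allI norm_fdet_diff_le assms)
  from tendsto_add[OF this vkdet_LIMSEQ] show ?thesis by simp
qed

text \<open>The truncated image misses only columns outside \<open>S\<close>. As the rows are taken
  in \<open>S\<close>, the missing entries are off the diagonal, so their sums are controlled by the
  tail of \<open>\<alpha>\<close>.\<close>

lemma truncated_image_norm_le:
  assumes S: "finite S" and y: "\<And>m. norm (y m) \<le> B"
    and u: "\<And>n. ((\<lambda>m. M n m * y m) has_sum u n) UNIV"
    and Y: "(\<Sum>n\<in>S. norm (u n)) \<le> Y"
  shows "(\<Sum>n\<in>S. norm (\<Sum>m\<in>S. y m * M n m)) \<le> Y + B * (infsum \<alpha> UNIV - sum \<alpha> S)"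
proof -
  define v where "v n = (\<Sum>m\<in>S. y m * M n m)" for n
  have B: "B \<ge> 0" by (rule order_trans[OF norm_ge_zero y[of 0]])
  have fin: "((\<lambda>m. M n m * y m) has_sum v n) S" for n
    using has_sum_finite[OF S, of "\<lambda>m. M n m * y m"] by (simp add: v_def mult.commute)
  have tail: "((\<lambda>m. M n m * y m) has_sum (u n - v n)) (- S)" for n
    using has_sum_Diff[OF u fin, of n] by (simp add: Compl_eq_Diff_UNIV)
  have tail\<alpha>: "(\<alpha> has_sum (infsum \<alpha> UNIV - sum \<alpha> S)) (- S)"
    using has_sum_Diff[OF col_bound_has_sum has_sum_finite[OF S]] by (simp add: Compl_eq_Diff_UNIV)
  have le: "(\<Sum>n\<in>S. norm (M n m * y m)) \<le> B * \<alpha> m" if "m \<in> - S" for m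
  proof -
    have "(\<Sum>n\<in>S. norm (M n m * y m)) = (\<Sum>n\<in>S. norm (M n m - (if n = m then 1 else 0))) * norm (y m)"
      using that by (auto simp: sum_distrib_right norm_mult intro!: sum.cong)
    also have "\<dots> \<le> \<alpha> m * B"
      using cb S y by (intro mult_mono) (auto simp: col_bound_def col_bound_nonneg)
    finally show ?thesis by (simp add: mult.commute)
  qed
  have smB: "(\<lambda>m. B * \<alpha> m) summable_on (- S)"
    using tail\<alpha> by (intro summable_on_cmult_right) (auto simp: summable_on_def)
  have sm: "(\<lambda>m. norm (M n m * y m)) summable_on (- S)" if "n \<in> S" for n
  proof (rule summable_on_comparison_test[OF smB])
    fix m assume m: "m \<in> - S"
    have "norm (M n m * y m) \<le> (\<Sum>n\<in>S. norm (M n m * y m))"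
      using that S by (intro member_le_sum) auto
    with le[OF m] show "norm (M n m * y m) \<le> B * \<alpha> m" by simp
  qed auto
  have "(\<Sum>n\<in>S. norm (u n - v n)) \<le> (\<Sum>n\<in>S. \<Sum>\<^sub>\<infinity>m\<in>-S. norm (M n m * y m))"
  proof (rule sum_mono)
    fix n assume "n \<in> S"
    then show "norm (u n - v n) \<le> (\<Sum>\<^sub>\<infinity>m\<in>-S. norm (M n m * y m))"
      using norm_infsum_bound[OF sm] infsumI[OF tail] by simp
  qed
  also have "\<dots> \<le> (\<Sum>\<^sub>\<infinity>m\<in>-S. B * \<alpha> m)"
    using has_sum_finite_sum[OF S has_sum_infsum[OF sm]] has_sum_infsum[OF smB] le by (rule has_sum_mono)
  also have "\<dots> = B * (infsum \<alpha> UNIV - sum \<alpha> S)"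
    using infsumI[OF has_sum_cmult_right[OF tail\<alpha>, of B]] by simp
  finally have 1: "(\<Sum>n\<in>S. norm (u n - v n)) \<le> B * (infsum \<alpha> UNIV - sum \<alpha> S)" .
  have "(\<Sum>n\<in>S. norm (v n)) \<le> (\<Sum>n\<in>S. norm (u n) + norm (u n - v n))"
    by (intro sum_mono) (metis norm_minus_commute norm_triangle_sub)
  also have "\<dots> \<le> Y + B * (infsum \<alpha> UNIV - sum \<alpha> S)"
    using 1 Y by (simp add: sum.distrib)
  finally show ?thesis by (simp add: v_def)
qed

text \<open>As \<open>y n0 = 1\<close>, column \<open>n0\<close> of each truncation can be replaced
  by the truncated image of \<open>y\<close> without changing the determinant. In the limit the
  truncation error disappears and the l1 bound \<open>Y\<close> of the image remains.\<close>

lemma norm_vkdet_le_one_column: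
  assumes y: "\<And>m. norm (y m) \<le> B" and y0: "y n0 = 1"
    and u: "\<And>n. ((\<lambda>m. M n m * y m) has_sum u n) UNIV"
    and Y: "\<And>S. finite S \<Longrightarrow> (\<Sum>n\<in>S. norm (u n)) \<le> Y"
  shows "norm (vkdet M) \<le> Y * exp (infsum \<alpha> UNIV)"
proof -
  let ?\<beta> = "\<lambda>N. Y + B * (infsum \<alpha> UNIV - sum \<alpha> (win N))"
  have "norm (fdet (win N) M) \<le> ?\<beta> N * exp (infsum \<alpha> UNIV)" if N: "N \<ge> nat \<bar>n0\<bar>" for N
  proof -
    have n0: "n0 \<in> win N" using N by (auto simp: win_def)
    let ?S = "win N"
    have "fdet ?S M = fdet ?S (set_col M n0 (\<lambda>i. \<Sum>m\<in>?S. y m * M i m))"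
      using n0 by (simp add: fdet_column_combination y0)
    also have "norm \<dots> \<le> prod (\<lambda>_. ?\<beta> N) {n0} * exp (infsum \<alpha> UNIV)"
    proof (rule norm_fdet_special_columns_le)
      fix j assume "j \<in> {n0}"
      then show "(\<Sum>i\<in>?S. norm (set_col M n0 (\<lambda>i. \<Sum>m\<in>?S. y m * M i m) i j)) \<le> ?\<beta> N"
        using truncated_image_norm_le[OF finite_win y u Y, of N] by (simp add: set_col_def)
    qed (use n0 in \<open>auto simp: set_col_def\<close>)
    finally show ?thesis by simp
  qed
  then have "\<forall>\<^sub>F N in sequentially. norm (fdet (win N) M) \<le> ?\<beta> N * exp (infsum \<alpha> UNIV)"
    unfolding eventually_sequentially by blast
  moreover have "(\<lambda>N. ?\<beta> N * exp (infsum \<alpha> UNIV)) \<longlonglongrightarrow> (Y + B * 0) * exp (infsum \<alpha> UNIV)"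
    by (intro tendsto_intros col_bound_win)
  ultimately have "norm (vkdet M) \<le> (Y + B * 0) * exp (infsum \<alpha> UNIV)"
    by (intro tendsto_le[OF sequentially_bot _ tendsto_norm[OF vkdet_LIMSEQ]])
  then show ?thesis by simp
qed

lemma norm_vkdet_le_two_columns:
  assumes y: "\<And>m. norm (y m) \<le> B" "y n0 = 1"
    and u: "\<And>n. ((\<lambda>m. M n m * y m) has_sum u n) UNIV"
    and Y: "\<And>S. finite S \<Longrightarrow> (\<Sum>n\<in>S. norm (u n)) \<le> Y"
    and y': "\<And>m. norm (y' m) \<le> B'" "y' n0 = 0" "y' n1 = 1"
    and u': "\<And>n. ((\<lambda>m. M n m * y' m) has_sum u' n) UNIV"
    and Y': "\<And>S. finite S \<Longrightarrow> (\<Sum>n\<in>S. norm (u' n)) \<le> Y'"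
  shows "norm (vkdet M) \<le> Y * Y' * exp (infsum \<alpha> UNIV)"
proof -
  let ?\<beta> = "\<lambda>N. Y + B * (infsum \<alpha> UNIV - sum \<alpha> (win N))"
  let ?\<beta>' = "\<lambda>N. Y' + B' * (infsum \<alpha> UNIV - sum \<alpha> (win N))"
  have n01: "n0 \<noteq> n1" using y' by auto
  have "norm (fdet (win N) M) \<le> ?\<beta> N * ?\<beta>' N * exp (infsum \<alpha> UNIV)"
    if N: "N \<ge> nat \<bar>n0\<bar>" "N \<ge> nat \<bar>n1\<bar>" for N
  proof -
    let ?S = "win N"
    have n0: "n0 \<in> ?S" and n1: "n1 \<in> ?S" using N by (auto simp: win_def)
    define M1 where "M1 = set_col M n0 (\<lambda>i. \<Sum>m\<in>?S. y m * M i m)"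
    \<comment> \<open>Column \<open>n0\<close> has already been overwritten, and the second
      combination must not see it; this is the purpose of \<open>y' n0 = 0\<close>.\<close>
    have M1: "(\<Sum>m\<in>?S. y' m * M1 i m) = (\<Sum>m\<in>?S. y' m * M i m)" for i
      by (intro sum.cong) (auto simp: M1_def set_col_def y')
    have "fdet ?S M = fdet ?S M1"
      using n0 by (simp add: fdet_column_combination y M1_def)
    also have "\<dots> = fdet ?S (set_col M1 n1 (\<lambda>i. \<Sum>m\<in>?S. y' m * M1 i m))"
      using n1 by (simp add: fdet_column_combination y')
    also have "norm \<dots> \<le> prod (\<lambda>j. if j = n0 then ?\<beta> N else ?\<beta>' N) {n0, n1} * exp (infsum \<alpha> UNIV)"
      unfolding M1
    proof (rule norm_fdet_special_columns_le)
      fix j assume j: "j \<in> {n0, n1}"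
      show "(\<Sum>i\<in>?S. norm (set_col M1 n1 (\<lambda>i. \<Sum>m\<in>?S. y' m * M i m) i j))
          \<le> (if j = n0 then ?\<beta> N else ?\<beta>' N)"
      proof (cases "j = n0")
        case True
        then show ?thesis using n01 truncated_image_norm_le[OF finite_win y(1) u Y, of N]
          by (simp add: set_col_def M1_def)
      next
        case False
        then show ?thesis using j truncated_image_norm_le[OF finite_win y'(1) u' Y', of N]
          by (simp add: set_col_def M1_def)
      qed
    qed (use n0 n1 in \<open>auto simp: set_col_def M1_def\<close>)
    finally show ?thesis using n01 by simp
  qed
  then have "\<forall>\<^sub>F N in sequentially. norm (fdet (win N) M) \<le> ?\<beta> N * ?\<beta>' N * exp (infsum \<alpha> UNIV)"
    unfolding eventually_sequentially by (intro exI[of _ "max (nat \<bar>n0\<bar>) (nat \<bar>n1\<bar>)"]) auto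
  moreover have "(\<lambda>N. ?\<beta> N * ?\<beta>' N * exp (infsum \<alpha> UNIV))
      \<longlonglongrightarrow> (Y + B * 0) * (Y' + B' * 0) * exp (infsum \<alpha> UNIV)"
    by (intro tendsto_intros col_bound_win)
  ultimately have "norm (vkdet M) \<le> (Y + B * 0) * (Y' + B' * 0) * exp (infsum \<alpha> UNIV)"
    by (intro tendsto_le[OF sequentially_bot _ tendsto_norm[OF vkdet_LIMSEQ]])
  then show ?thesis by simp
qed

end

text \<open>The truncation error depends on \<open>t\<close> only through \<open>\<alpha>\<close>,
  so a common \<open>\<alpha>\<close> makes the convergence uniform.\<close>

lemma holomorphic_on_vkdet:
  assumes U: "open U" and cb: "\<And>t. t \<in> U \<Longrightarrow> col_bound \<alpha> (M t)"
    and hol: "\<And>i j. (\<lambda>t. M t i j) holomorphic_on U"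
  shows "(\<lambda>t. vkdet (M t)) holomorphic_on U"
proof (rule holomorphic_uniform_sequence[OF U])
  show "(\<lambda>t. fdet (win N) (M t)) holomorphic_on U" for N
    unfolding fdet_def by (intro holomorphic_intros hol)
  fix x assume x: "x \<in> U"
  then obtain d where d: "d > 0" "cball x d \<subseteq> U" using U open_contains_cball by blast
  let ?e = "\<lambda>N. (infsum \<alpha> UNIV - sum \<alpha> (win N)) * exp (infsum \<alpha> UNIV)"
  have e: "?e \<longlonglongrightarrow> 0" by (rule tendsto_mult_left_zero[OF col_bound_win[OF cb[OF x]]])
  have "uniform_limit (cball x d) (\<lambda>N t. fdet (win N) (M t)) (\<lambda>t. vkdet (M t)) sequentially"
  proof (rule uniform_limitI)
    fix \<epsilon> :: real assume "\<epsilon> > 0"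
    then have "\<forall>\<^sub>F N in sequentially. ?e N < \<epsilon>" using order_tendstoD(2)[OF e] by auto
    then show "\<forall>\<^sub>F N in sequentially. \<forall>t\<in>cball x d. dist (fdet (win N) (M t)) (vkdet (M t)) < \<epsilon>"
    proof eventually_elim
      case (elim N)
      show ?case
      proof
        fix t assume "t \<in> cball x d"
        then have "norm (vkdet (M t) - fdet (win N) (M t)) \<le> ?e N"
          using d by (intro norm_vkdet_diff_le cb) auto
        then show "dist (fdet (win N) (M t)) (vkdet (M t)) < \<epsilon>"
          using elim by (simp add: dist_norm norm_minus_commute)
      qed
    qed
  qed
  then show "\<exists>d>0. cball x d \<subseteq> U \<and>
      uniform_limit (cball x d) (\<lambda>N t. fdet (win N) (M t)) (\<lambda>t. vkdet (M t)) sequentially"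
    using d by blast
qed

section \<open>A theta function\<close>

text \<open>The factors in \<open>x\<close> of the Jacobi triple product with nome \<open>q\<close>;
  those in \<open>1 / x\<close> come from a second copy.\<close>

definition qprod :: "real \<Rightarrow> complex \<Rightarrow> complex" where
  "qprod q x = lim (\<lambda>N. \<Prod>n<N. 1 + of_real q ^ (2 * n + 1) * x)"

context
  fixes q :: real
  assumes q: "0 < q" "q < 1"
begin

lemma qprod_uniform_limit:
  "uniform_limit (cball 0 R) (\<lambda>N x. \<Prod>n<N. 1 + of_real q ^ (2 * n + 1) * x) (qprod q) sequentially"
proof -
  have "uniformly_convergent_on (cball 0 R) (\<lambda>N x. \<Prod>n<N. 1 + complex_of_real q ^ (2 * n + 1) * x)"
  proof (rule Infinite_Products.uniformly_convergent_on_prod)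
    show "uniformly_convergent_on (cball 0 R) (\<lambda>N x. \<Sum>n<N. norm (complex_of_real q ^ (2 * n + 1) * x))"
    proof (rule Weierstrass_m_test'[where M = "\<lambda>n. q ^ n * \<bar>R\<bar>"])
      show "summable (\<lambda>n. q ^ n * \<bar>R\<bar>)"
        using q by (intro summable_mult2 summable_geometric) auto
      fix n and x :: complex assume x: "x \<in> cball 0 R"
      have "q ^ (2 * n + 1) \<le> q ^ n" using q by (intro power_decreasing) auto
      then show "norm (norm (complex_of_real q ^ (2 * n + 1) * x)) \<le> q ^ n * \<bar>R\<bar>"
        using x q by (simp add: norm_mult norm_power) (intro mult_mono, auto)
    qed
  qed (auto intro!: continuous_intros)
  then show ?thesis
    by (simp add: uniformly_convergent_uniform_limit_iff qprod_def[abs_def])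
qed

lemma qprod_LIMSEQ: "(\<lambda>N. \<Prod>n<N. 1 + of_real q ^ (2 * n + 1) * x) \<longlonglongrightarrow> qprod q x"
  using tendsto_uniform_limitI[OF qprod_uniform_limit[of "norm x"], of x] by simp

lemma holomorphic_qprod: "qprod q holomorphic_on UNIV"
proof (rule holomorphic_uniform_sequence[OF open_UNIV])
  show "(\<lambda>x. \<Prod>n<N. 1 + of_real q ^ (2 * n + 1) * x) holomorphic_on UNIV" for N
    by (intro holomorphic_intros)
  fix x :: complex
  have "cball x 1 \<subseteq> cball 0 (norm x + 1)"
    by (simp add: cball_subset_cball_iff)
  then show "\<exists>d>0. cball x d \<subseteq> UNIV \<and> uniform_limit (cball x d)
      (\<lambda>N x. \<Prod>n<N. 1 + of_real q ^ (2 * n + 1) * x) (qprod q) sequentially"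
    using uniform_limit_on_subset[OF qprod_uniform_limit] by (intro exI[of _ 1]) auto
qed

lemma holomorphic_on_qprod [holomorphic_intros]:
  "f holomorphic_on A \<Longrightarrow> (\<lambda>z. qprod q (f z)) holomorphic_on A"
  using holomorphic_on_compose_gen[of f A "qprod q" UNIV] holomorphic_qprod by (simp add: o_def)

lemma qprod_rec: "qprod q x = (1 + of_real q * x) * qprod q (of_real q ^ 2 * x)"
proof -
  have "(\<lambda>N. \<Prod>n<Suc N. 1 + of_real q ^ (2 * n + 1) * x) \<longlonglongrightarrow> qprod q x"
    by (rule LIMSEQ_Suc[OF qprod_LIMSEQ])
  moreover have "(\<Prod>n<Suc N. 1 + of_real q ^ (2 * n + 1) * x)
      = (1 + of_real q * x) * (\<Prod>n<N. 1 + of_real q ^ (2 * n + 1) * (of_real q ^ 2 * x))" for N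
    by (subst prod.lessThan_Suc_shift) (simp add: power2_eq_square mult_ac)
  ultimately have "(\<lambda>N. (1 + of_real q * x) * (\<Prod>n<N. 1 + of_real q ^ (2 * n + 1) * (of_real q ^ 2 * x)))
      \<longlonglongrightarrow> qprod q x" by simp
  moreover have "(\<lambda>N. (1 + of_real q * x) * (\<Prod>n<N. 1 + of_real q ^ (2 * n + 1) * (of_real q ^ 2 * x)))
      \<longlonglongrightarrow> (1 + of_real q * x) * qprod q (of_real q ^ 2 * x)"
    by (intro tendsto_intros qprod_LIMSEQ)
  ultimately show ?thesis by (rule LIMSEQ_unique)
qed

lemma qprod_0: "qprod q 0 = 1"
  using LIMSEQ_unique[OF qprod_LIMSEQ[of 0]] by simp

lemma qprod_iterate: "qprod q x = (\<Prod>n<N. 1 + of_real q ^ (2 * n + 1) * x) * qprod q (of_real q ^ (2 * N) * x)"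
proof (induction N)
  case (Suc N)
  then show ?case
    using qprod_rec[of "of_real q ^ (2 * N) * x"] by (simp add: power2_eq_square mult_ac)
qed simp

text \<open>If no factor vanished, pulling out the first \<open>N\<close> of them would make
  \<open>qprod q\<close> vanish at \<open>q^(2N) x\<close> for every \<open>N\<close>, against
  continuity and \<open>qprod q 0 = 1\<close>.\<close>

lemma qprod_eq_0D:
  assumes "qprod q x = 0"
  shows "\<exists>n. of_real q ^ (2 * n + 1) * x = -1"
proof (rule ccontr)
  assume nz: "\<not> ?thesis"
  have "1 + of_real q ^ (2 * n + 1) * x \<noteq> 0" for n
    using nz by (metis add.commute add_eq_0_iff)
  then have "(\<Prod>n<N. 1 + of_real q ^ (2 * n + 1) * x) \<noteq> 0" for N
    by simp
  then have z: "qprod q (of_real q ^ (2 * N) * x) = 0" for N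
    using qprod_iterate[of x N] assms by (metis mult_eq_0_iff)
  have "(\<lambda>N. (of_real (q\<^sup>2) :: complex) ^ N * x) \<longlonglongrightarrow> 0 * x"
    using q by (intro tendsto_intros LIMSEQ_power_zero) (simp add: power_less_one_iff norm_power)
  then have "(\<lambda>N. of_real q ^ (2 * N) * x) \<longlonglongrightarrow> 0"
    by (simp add: power_mult)
  moreover have "isCont (qprod q) 0"
    using holomorphic_on_imp_continuous_on[OF holomorphic_qprod] by (simp add: continuous_on_eq_continuous_at)
  ultimately have "(\<lambda>N. qprod q (of_real q ^ (2 * N) * x)) \<longlonglongrightarrow> qprod q 0"
    using isCont_tendsto_compose by blast
  then show False using LIMSEQ_unique[of "\<lambda>_::nat. 0::complex" "qprod q 0" 0] z by (simp add: qprod_0)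
qed

lemma qprod_nonzero:
  assumes "norm x \<le> 1"
  shows "qprod q x \<noteq> 0"
proof
  assume "qprod q x = 0"
  then obtain n where "of_real q ^ (2 * n + 1) * x = -1" using qprod_eq_0D by blast
  then have "q ^ (2 * n + 1) * norm x = 1"
    using q by (metis abs_of_pos norm_minus_cancel norm_mult norm_of_real norm_one norm_power)
  moreover have "q ^ (2 * n + 1) * norm x \<le> q ^ (2 * n + 1) * 1"
    using assms q by (intro mult_left_mono) auto
  moreover have "q ^ (2 * n + 1) < 1" using q power_strict_decreasing[of 0 "2 * n + 1" q] by simp
  ultimately show False by linarith
qed

lemma cnj_qprod: "cnj (qprod q x) = qprod q (cnj x)"
proof -
  have "(\<lambda>N. cnj (\<Prod>n<N. 1 + of_real q ^ (2 * n + 1) * x)) \<longlonglongrightarrow> cnj (qprod q x)"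
    by (intro tendsto_intros qprod_LIMSEQ)
  moreover have "cnj (\<Prod>n<N. 1 + of_real q ^ (2 * n + 1) * x) = (\<Prod>n<N. 1 + of_real q ^ (2 * n + 1) * cnj x)" for N
    by simp
  ultimately show ?thesis using LIMSEQ_unique[OF qprod_LIMSEQ[of "cnj x"]] by simp
qed

end

abbreviation cpi :: complex where "cpi \<equiv> complex_of_real pi"

section \<open>Quasi-periods and zeros of the theta function \<open>Y\<close>\<close>

locale theta =
  fixes w :: real
  assumes w_pos: "w > 0"
begin

definition q :: real where "q = exp (- pi / w)"

abbreviation cw :: complex where "cw \<equiv> complex_of_real w"

text \<open>Up to a constant this is Jacobi's theta_4 with nome exp(-pi/w), times a Gaussian that
  makes it periodic under \<open>\<i>\<close> and gives the multiplier
  \<open>exp (2 * cpi * k)\<close> under \<open>w\<close>. Of the two Jacobi-dual product forms,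
  this one has both exponentials on the unit circle for real \<open>k\<close>, so that real values
  become products of squared moduli.\<close>

definition Y :: "complex \<Rightarrow> complex" where
  "Y k = exp (cpi * k\<^sup>2 / cw - cpi * k)
     * qprod q (- exp (2 * cpi * \<i> * k / cw)) * qprod q (- exp (- 2 * cpi * \<i> * k / cw))"

text \<open>The half-period shift and the factor in front keep the multiplier under \<open>w\<close>
  and create a sign under \<open>\<i>\<close>, as the part of \<open>G\<close> odd in
  \<open>z\<close> requires.\<close>

definition Yo :: "complex \<Rightarrow> complex" where
  "Yo k = exp (- cpi * k) * Y (k + cw / 2)"

text \<open>The quotient \<open>Yo k / Y k\<close> for real \<open>k\<close>, where the two
  \<open>qprod\<close> factors of each theta function are complex conjugates.\<close>

definition phi :: "real \<Rightarrow> real" where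
  "phi k = exp (- pi * w / 4) * (norm (qprod q (cis (2 * pi * k / w))) / norm (qprod q (- cis (2 * pi * k / w))))\<^sup>2"

lemma q01: "0 < q" "q < 1"
  using w_pos by (auto simp: q_def)

lemma holomorphic_Y: "Y holomorphic_on A"
  unfolding Y_def using w_pos q01 by (intro holomorphic_intros) auto

lemma holomorphic_on_Y [holomorphic_intros]: "f holomorphic_on A \<Longrightarrow> (\<lambda>z. Y (f z)) holomorphic_on A"
  using holomorphic_on_compose_gen[of f A Y UNIV] holomorphic_Y by (simp add: o_def)

lemma Y_plus_w: "Y (k + cw) = exp (2 * cpi * k) * Y k"
proof -
  have 1: "exp (2 * cpi * \<i> * (k + cw) / cw) = exp (2 * cpi * \<i> * k / cw)"
  proof -
    have "2 * cpi * \<i> * (k + cw) / cw = 2 * cpi * \<i> * k / cw + of_real (real_of_int (2 * 1) * pi) * \<i>"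
      using w_pos by (simp add: field_simps)
    then show ?thesis unfolding exp_eq by blast
  qed
  have 2: "exp (- 2 * cpi * \<i> * (k + cw) / cw) = exp (- 2 * cpi * \<i> * k / cw)"
  proof -
    have "- 2 * cpi * \<i> * (k + cw) / cw = - 2 * cpi * \<i> * k / cw + of_real (real_of_int (2 * (-1)) * pi) * \<i>"
      using w_pos by (simp add: field_simps)
    then show ?thesis unfolding exp_eq by blast
  qed
  have 3: "cpi * (k + cw)\<^sup>2 / cw - cpi * (k + cw) = 2 * cpi * k + (cpi * k\<^sup>2 / cw - cpi * k)"
    using w_pos by (simp add: field_simps power2_eq_square)
  show ?thesis unfolding Y_def 1 2 3 exp_add by simp
qed

lemma Y_plus_i: "Y (k + \<i>) = Y k"
proof -
  define x where "x = exp (2 * cpi * \<i> * k / cw)"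
  have x0: "x \<noteq> 0" by (simp add: x_def)
  have xi: "exp (- 2 * cpi * \<i> * k / cw) = 1 / x"
    unfolding x_def by (simp add: exp_minus inverse_eq_divide)
  have qc: "of_real q = exp (- cpi / cw)"
    unfolding q_def by (metis exp_of_real of_real_divide of_real_minus)
  have q0: "complex_of_real q \<noteq> 0" using q01 by simp
  have 1: "exp (2 * cpi * \<i> * (k + \<i>) / cw) = of_real q ^ 2 * x"
  proof -
    have "2 * cpi * \<i> * (k + \<i>) / cw = - cpi / cw + - cpi / cw + 2 * cpi * \<i> * k / cw"
      using w_pos by (simp add: field_simps)
    then show ?thesis unfolding qc x_def power2_eq_square exp_add[symmetric] by (rule arg_cong)
  qed
  have 2: "exp (- 2 * cpi * \<i> * (k + \<i>) / cw) = 1 / (of_real q ^ 2 * x)"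
    unfolding 1[symmetric] by (simp add: exp_minus inverse_eq_divide)
  have 3: "exp (cpi * (k + \<i>)\<^sup>2 / cw - cpi * (k + \<i>)) = - of_real q * x * exp (cpi * k\<^sup>2 / cw - cpi * k)"
  proof -
    have "cpi * (k + \<i>)\<^sup>2 / cw - cpi * (k + \<i>)
        = (- cpi / cw) + 2 * cpi * \<i> * k / cw + (cpi * k\<^sup>2 / cw - cpi * k) - cpi * \<i>"
      using w_pos by (simp add: field_simps power2_eq_square)
    then have "exp (cpi * (k + \<i>)\<^sup>2 / cw - cpi * (k + \<i>))
        = exp (- cpi / cw) * x * exp (cpi * k\<^sup>2 / cw - cpi * k) / exp (cpi * \<i>)"
      by (simp only: exp_add exp_diff x_def)
    then show ?thesis unfolding qc by simp
  qed
  have 4: "qprod q (- x) = (1 - of_real q * x) * qprod q (- (of_real q ^ 2 * x))"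
    using qprod_rec[OF q01, of "- x"] by simp
  have 5: "qprod q (- (1 / (of_real q ^ 2 * x))) = (1 - 1 / (of_real q * x)) * qprod q (- (1 / x))"
    using qprod_rec[OF q01, of "- (1 / (of_real q ^ 2 * x))"] q0 by (simp add: power2_eq_square)
  have 6: "- of_real q * x * (1 - 1 / (of_real q * x)) = 1 - of_real q * x"
    using q0 x0 by (simp add: field_simps)
  have "Y (k + \<i>) = (- of_real q * x * (1 - 1 / (of_real q * x))) * exp (cpi * k\<^sup>2 / cw - cpi * k)
      * qprod q (- (of_real q ^ 2 * x)) * qprod q (- (1 / x))"
    unfolding Y_def 1 2 3 5 by (simp only: mult_ac)
  also have "\<dots> = exp (cpi * k\<^sup>2 / cw - cpi * k) * qprod q (- x) * qprod q (- (1 / x))"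
    unfolding 6 4 by (simp only: mult_ac)
  also have "\<dots> = Y k" unfolding Y_def xi by (simp add: x_def)
  finally show ?thesis .
qed

lemma lattice_invariant:
  assumes "\<And>k. P (k + \<i>) = P k" "\<And>k. P (k + cw) = P k"
  shows "P (k + of_int m * \<i> + of_int n * cw) = P k"
proof -
  have 1: "P (k + of_int m * \<i>) = P k" for k m
  proof (induction m rule: int_induct[where k=0])
    case (step1 i)
    then show ?case using assms(1)[of "k + of_int i * \<i>"] by (simp add: algebra_simps)
  next
    case (step2 i)
    then show ?case using assms(1)[of "k + of_int (i - 1) * \<i>"] by (simp add: algebra_simps)
  qed simp
  have 2: "P (k + of_int n * cw) = P k" for k n
  proof (induction n rule: int_induct[where k=0])
    case (step1 i)
    then show ?case using assms(2)[of "k + of_int i * cw"] by (simp add: algebra_simps)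
  next
    case (step2 i)
    then show ?case using assms(2)[of "k + of_int (i - 1) * cw"] by (simp add: algebra_simps)
  qed simp
  show ?thesis by (simp only: 1 2)
qed

lemma Y_zeroD:
  assumes "Y a = 0"
  shows "\<exists>m n. a = \<i> / 2 + of_int m * \<i> + of_int n * cw"
proof -
  define s where "s = (\<lambda>b. if b then 1 else -1 :: int)"
  have qc: "of_real q = exp (- cpi / cw)"
    unfolding q_def by (metis exp_of_real of_real_divide of_real_minus)
  have "\<exists>b. qprod q (- exp (of_int (s b) * (2 * cpi * \<i> * a / cw))) = 0"
    using assms by (auto simp: Y_def s_def ex_bool_eq)
  then obtain b n where n: "of_real q ^ (2 * n + 1) * exp (of_int (s b) * (2 * cpi * \<i> * a / cw)) = 1"
    using qprod_eq_0D[OF q01] by fastforce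
  have "exp (of_nat (2 * n + 1) * (- cpi / cw) + of_int (s b) * (2 * cpi * \<i> * a / cw)) = exp 0"
    using n unfolding qc exp_of_nat_mult[symmetric] exp_add[symmetric] by simp
  then obtain j :: int where
    "of_nat (2 * n + 1) * (- cpi / cw) + of_int (s b) * (2 * cpi * \<i> * a / cw) = 0 + of_int (2 * j) * cpi * \<i>"
    unfolding exp_eq by auto
  then have "cpi * (- of_nat (2 * n + 1) + 2 * of_int (s b) * \<i> * a - 2 * of_int j * \<i> * cw) = 0"
    using w_pos by (simp add: field_simps)
  then have eq: "2 * of_int (s b) * \<i> * a = of_nat (2 * n + 1) + 2 * of_int j * \<i> * cw"
    by (subst (asm) mult_eq_0_iff) (simp add: algebra_simps)
  have ss: "of_int (s b) * of_int (s b) = (1::complex)" by (simp add: s_def)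
  have "a = - \<i> * of_int (s b) / 2 * (2 * of_int (s b) * \<i> * a)"
    using ss by (simp add: algebra_simps)
  also have "\<dots> = - \<i> * of_int (s b) / 2 * (of_nat (2 * n + 1) + 2 * of_int j * \<i> * cw)"
    unfolding eq ..
  finally have a: "a = - \<i> * of_int (s b) / 2 * (of_nat (2 * n + 1) + 2 * of_int j * \<i> * cw)" .
  show ?thesis
  proof (cases b)
    case True
    then have "a = \<i> / 2 + of_int (- int n - 1) * \<i> + of_int j * cw"
      using a by (simp add: s_def field_simps)
    then show ?thesis by blast
  next
    case False
    then have "a = \<i> / 2 + of_int (int n) * \<i> + of_int (- j) * cw"
      using a by (simp add: s_def field_simps)
    then show ?thesis by blast
  qed
qed

text \<open>The first factor \<open>g\<close> of the second product carries the zero and is peeled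
  off; the remaining cofactor \<open>H\<close> does not vanish there.\<close>

lemma deriv_Y_half_i: "deriv Y (\<i> / 2) \<noteq> 0"
proof -
  have qc: "of_real q = exp (- cpi / cw)"
    unfolding q_def by (metis exp_of_real of_real_divide of_real_minus)
  define H where "H k = exp (cpi * k\<^sup>2 / cw - cpi * k) * qprod q (- exp (2 * cpi * \<i> * k / cw))
     * qprod q (- (of_real q ^ 2 * exp (- 2 * cpi * \<i> * k / cw)))" for k
  define g where "g k = 1 - of_real q * exp (- 2 * cpi * \<i> * k / cw)" for k
  have Y: "Y = (\<lambda>k. g k * H k)"
  proof
    fix k
    show "Y k = g k * H k"
      unfolding Y_def g_def H_def using qprod_rec[OF q01, of "- exp (- 2 * cpi * \<i> * k / cw)"] by simp
  qed
  have hH: "H holomorphic_on UNIV"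
    unfolding H_def using w_pos q01 by (intro holomorphic_intros) auto
  have e1: "exp (- 2 * cpi * \<i> * (\<i> / 2) / cw) = 1 / of_real q"
    unfolding qc by (simp flip: exp_minus add: inverse_eq_divide[symmetric])
  have e2: "exp (2 * cpi * \<i> * (\<i> / 2) / cw) = of_real q"
    unfolding qc by simp
  have q0: "complex_of_real q \<noteq> 0" using q01 by simp
  have g0: "g (\<i> / 2) = 0" unfolding g_def e1 using q0 by simp
  have dg: "(g has_field_derivative (2 * cpi * \<i> / cw)) (at (\<i> / 2))"
  proof -
    have "(g has_field_derivative - of_real q * (exp (- 2 * cpi * \<i> * (\<i> / 2) / cw) * (- 2 * cpi * \<i> / cw))) (at (\<i> / 2))"
      unfolding g_def using w_pos by (auto intro!: derivative_eq_intros)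
    then show ?thesis unfolding e1 using q0 by simp
  qed
  have dH: "(H has_field_derivative deriv H (\<i> / 2)) (at (\<i> / 2))"
    using hH by (simp add: holomorphic_derivI)
  have "(Y has_field_derivative (2 * cpi * \<i> / cw) * H (\<i> / 2) + deriv H (\<i> / 2) * g (\<i> / 2)) (at (\<i> / 2))"
    unfolding Y by (rule DERIV_mult[OF dg dH])
  then have "deriv Y (\<i> / 2) = (2 * cpi * \<i> / cw) * H (\<i> / 2)"
    by (simp add: DERIV_imp_deriv g0)
  moreover have "H (\<i> / 2) \<noteq> 0"
    unfolding H_def e1 e2 using q0 q01 by (simp add: qprod_nonzero[OF q01] power2_eq_square)
  ultimately show ?thesis using w_pos by simp
qed

section \<open>Entire functions with the quasi-periods of \<open>Y\<close> and
  \<open>Yo\<close>\<close>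

lemma deriv_plus_i:
  assumes "U holomorphic_on UNIV" "\<And>k. U (k + \<i>) = s * U k"
  shows "deriv U (k + \<i>) = s * deriv U k"
proof -
  have d: "(U has_field_derivative deriv U x) (at x)" for x
    using assms(1) by (simp add: holomorphic_derivI)
  have "((\<lambda>k. U (k + \<i>)) has_field_derivative deriv U (k + \<i>)) (at k)"
    using d[of "k + \<i>"] by (simp add: DERIV_shift)
  moreover have "((\<lambda>k. U (k + \<i>)) has_field_derivative s * deriv U k) (at k)"
    unfolding assms(2) by (intro DERIV_cmult d)
  ultimately show ?thesis by (rule DERIV_unique)
qed

lemma deriv_plus_w:
  assumes "U holomorphic_on UNIV" "\<And>k. U (k + cw) = s * exp (2 * cpi * k) * U k"
  shows "deriv U (k + cw) = s * exp (2 * cpi * k) * (deriv U k + 2 * cpi * U k)"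
proof -
  have d: "(U has_field_derivative deriv U x) (at x)" for x
    using assms(1) by (simp add: holomorphic_derivI)
  have "((\<lambda>k. U (k + cw)) has_field_derivative deriv U (k + cw)) (at k)"
    using d[of "k + cw"] by (simp add: DERIV_shift)
  moreover have "((\<lambda>k. U (k + cw)) has_field_derivative
      s * exp (2 * cpi * k) * (deriv U k + 2 * cpi * U k)) (at k)"
    unfolding assms(2) by (auto intro!: derivative_eq_intros d simp: algebra_simps)
  ultimately show ?thesis by (rule DERIV_unique)
qed

lemma Y_zero_simple:
  assumes "Y a = 0"
  shows "deriv Y a \<noteq> 0"
proof
  assume d0: "deriv Y a = 0"
  obtain m n where a: "a = \<i> / 2 + of_int m * \<i> + of_int n * cw"
    using Y_zeroD[OF assms] by blast
  let ?P = "\<lambda>k. Y k = 0 \<and> deriv Y k = 0"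
  have "?P (k + \<i>) = ?P k" for k
    using deriv_plus_i[of Y 1] holomorphic_Y by (simp add: Y_plus_i)
  moreover have "?P (k + cw) = ?P k" for k
    using deriv_plus_w[of Y 1] holomorphic_Y by (auto simp: Y_plus_w)
  ultimately have "?P a = ?P (\<i> / 2)" unfolding a by (rule lattice_invariant)
  then show False using assms d0 deriv_Y_half_i by simp
qed

text \<open>\<open>Y\<close> has one simple zero per cell, and \<open>U0\<close> places a zero of
  \<open>U\<close> at each of them, so \<open>U / Y\<close> is entire. Since
  \<open>norm s = 1\<close>, its modulus is doubly periodic, hence bounded, and Liouville's theorem
  applies.\<close>

lemma quasi_periodic_eq_multiple_Y:
  assumes hol: "U holomorphic_on UNIV"
    and Ui: "\<And>k. U (k + \<i>) = U k" and Uw: "\<And>k. U (k + cw) = s * exp (2 * cpi * k) * U k"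
    and s: "norm s = 1" and U0: "U (\<i> / 2) = 0"
  shows "\<exists>c. \<forall>k. U k = c * Y k"
proof -
  have Uz: "U a = 0" if "Y a = 0" for a
  proof -
    obtain m n where a: "a = \<i> / 2 + of_int m * \<i> + of_int n * cw"
      using Y_zeroD[OF \<open>Y a = 0\<close>] by blast
    have "(U a = 0) = (U (\<i> / 2) = 0)"
      unfolding a using s by (intro lattice_invariant[of "\<lambda>k. U k = 0"]) (auto simp: Ui Uw)
    then show ?thesis using U0 by simp
  qed
  \<comment> \<open>At a zero of \<open>Y\<close>, which is simple, the quotient receives its limit,
    the quotient of the derivatives.\<close>
  define f where "f k = (if Y k = 0 then deriv U k / deriv Y k else U k / Y k)" for k
  have hf: "f holomorphic_on UNIV"
  proof -
    have "f field_differentiable at a" for a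
    proof (cases "Y a = 0")
      case False
      have op: "open {k. Y k \<noteq> 0}"
        by (intro open_Collect_neq holomorphic_on_imp_continuous_on[OF holomorphic_Y] continuous_intros)
      have "(\<lambda>k. U k / Y k) holomorphic_on {k. Y k \<noteq> 0}"
        by (intro holomorphic_intros holomorphic_on_subset[OF hol]) auto
      then have "f holomorphic_on {k. Y k \<noteq> 0}"
        by (rule holomorphic_transform) (auto simp: f_def)
      then show ?thesis using op False by (auto simp: holomorphic_on_imp_differentiable_at)
    next
      case True
      define U' where "U' k = (if k = a then deriv U a else (U k - U a) / (k - a))" for k
      define Y' where "Y' k = (if k = a then deriv Y a else (Y k - Y a) / (k - a))" for k
      have hU: "U' holomorphic_on UNIV" unfolding U'_def by (rule pole_lemma_open[OF hol]) simp
      have hY: "Y' holomorphic_on UNIV" unfolding Y'_def by (rule pole_lemma_open[OF holomorphic_Y]) simp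
      have op: "open {k. Y' k \<noteq> 0}"
        by (intro open_Collect_neq holomorphic_on_imp_continuous_on[OF hY] continuous_intros)
      have a: "a \<in> {k. Y' k \<noteq> 0}" using Y_zero_simple[OF True] by (simp add: Y'_def)
      have "(\<lambda>k. U' k / Y' k) holomorphic_on {k. Y' k \<noteq> 0}"
        by (intro holomorphic_intros holomorphic_on_subset[OF hU] holomorphic_on_subset[OF hY]) auto
      moreover have "U' k / Y' k = f k" if "k \<in> {k. Y' k \<noteq> 0}" for k
        using that True Uz[OF True] by (auto simp: f_def U'_def Y'_def)
      ultimately have "f holomorphic_on {k. Y' k \<noteq> 0}" by (rule holomorphic_transform)
      then show ?thesis using op a by (auto simp: holomorphic_on_imp_differentiable_at)
    qed
    then show ?thesis by (simp add: holomorphic_on_def field_differentiable_at_within)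
  qed
  have fi: "norm (f (k + \<i>)) = norm (f k)" for k
    using deriv_plus_i[of Y 1] deriv_plus_i[of U 1] holomorphic_Y hol by (simp add: f_def Y_plus_i Ui)
  have fw: "norm (f (k + cw)) = norm (f k)" for k
    using deriv_plus_w[of Y 1] deriv_plus_w[of U s, OF hol Uw] holomorphic_Y Uz[of k] s
    by (auto simp: f_def Y_plus_w Uw norm_mult norm_divide)
  define K where "K = cbox 0 (Complex w 1)"
  have "compact (f ` K)"
    unfolding K_def by (intro compact_continuous_image holomorphic_on_imp_continuous_on holomorphic_on_subset[OF hf]) auto
  then obtain B where B: "\<And>k. k \<in> K \<Longrightarrow> norm (f k) \<le> B"
    using compact_imp_bounded by (force simp: bounded_iff)
  have "norm (f k) \<le> B" for k
  proof -
    define k0 where "k0 = Complex (Re k - of_int \<lfloor>Re k / w\<rfloor> * w) (frac (Im k))"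
    have "of_int \<lfloor>Re k / w\<rfloor> * w \<le> Re k" "Re k \<le> (of_int \<lfloor>Re k / w\<rfloor> + 1) * w"
      using floor_divide_lower[OF w_pos] floor_divide_upper[OF w_pos] by (auto intro: less_imp_le)
    then have "k0 \<in> K"
      using frac_lt_1[of "Im k"] frac_ge_0[of "Im k"]
      by (auto simp: K_def k0_def in_cbox_complex_iff algebra_simps less_imp_le)
    then have "norm (f k0) \<le> B" by (rule B)
    moreover have "k = k0 + of_int \<lfloor>Im k\<rfloor> * \<i> + of_int \<lfloor>Re k / w\<rfloor> * complex_of_real w"
      by (simp add: complex_eq_iff k0_def frac_def)
    moreover have "(norm (f (k0 + of_int \<lfloor>Im k\<rfloor> * \<i> + of_int \<lfloor>Re k / w\<rfloor> * complex_of_real w)) \<le> B) = (norm (f k0) \<le> B)"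
      by (rule lattice_invariant) (simp_all add: fi fw)
    ultimately show ?thesis by simp
  qed
  then have "bounded (range f)" by (auto simp: bounded_iff)
  then obtain c where c: "\<And>k. f k = c"
    using Liouville_theorem[OF hf] by (auto simp: constant_on_def)
  have "U k = c * Y k" for k
    using c[of k] Uz[of k] by (cases "Y k = 0") (auto simp: f_def)
  then show ?thesis by blast
qed

lemma Y_of_real:
  "Y (of_real k) = of_real (exp (pi * k\<^sup>2 / w - pi * k) * (norm (qprod q (- cis (2 * pi * k / w))))\<^sup>2)"
proof -
  have 1: "exp (2 * cpi * \<i> * complex_of_real k / cw) = cis (2 * pi * k / w)"
    by (simp add: cis_conv_exp mult_ac)
  have 2: "exp (- 2 * cpi * \<i> * complex_of_real k / cw) = cnj (cis (2 * pi * k / w))"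
    by (simp add: cis_cnj cis_conv_exp exp_cnj mult_ac)
  have "qprod q (- cnj (cis (2 * pi * k / w))) = cnj (qprod q (- cis (2 * pi * k / w)))"
    by (simp add: cnj_qprod[OF q01])
  then show ?thesis
    unfolding Y_def 1 2 by (simp add: complex_norm_square[symmetric] mult.assoc flip: exp_of_real)
qed

lemma Y_of_real_nonzero: "Y (of_real k) \<noteq> 0"
  unfolding Y_of_real by (simp add: qprod_nonzero[OF q01])

lemma Yo_of_real: "Yo (of_real k) = of_real (phi k) * Y (of_real k)"
proof -
  have c: "cis (2 * pi * (k + w / 2) / w) = - cis (2 * pi * k / w)"
  proof -
    have "2 * pi * (k + w / 2) / w = 2 * pi * k / w + pi" using w_pos by (simp add: field_simps)
    then show ?thesis by (simp add: cis_mult[symmetric])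
  qed
  have e: "exp (- pi * k) * exp (pi * (k + w / 2)\<^sup>2 / w - pi * (k + w / 2))
      = exp (- pi * w / 4) * exp (pi * k\<^sup>2 / w - pi * k)"
    unfolding exp_add[symmetric] using w_pos by (simp add: field_simps power2_eq_square)
  have "Yo (of_real k) = of_real (exp (- pi * k)) * Y (of_real (k + w / 2))"
    by (simp add: Yo_def flip: exp_of_real)
  also have "\<dots> = of_real (exp (- pi * k) * exp (pi * (k + w / 2)\<^sup>2 / w - pi * (k + w / 2))
      * (norm (qprod q (cis (2 * pi * k / w))))\<^sup>2)"
    unfolding Y_of_real c by (simp add: mult.assoc)
  also have "\<dots> = of_real (phi k) * Y (of_real k)"
    unfolding e Y_of_real phi_def using qprod_nonzero[OF q01, of "- cis (2 * pi * k / w)"]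
    by (simp add: power_divide)
  finally show ?thesis .
qed

text \<open>The zero that \<open>quasi_periodic_eq_multiple_Y\<close> demands is produced by a
  reflection. \<open>V\<close> has the quasi-periods of \<open>U\<close> and equals
  \<open>- U\<close> at \<open>\<i> / 2\<close>, so \<open>U + V\<close> is a multiple of
  \<open>Y\<close>. The difference \<open>U - V\<close> vanishes at 0; translated by
  \<open>\<i> / 2\<close> it acquires the extra multiplier -1 under \<open>w\<close>, which no
  non-zero multiple of \<open>Y\<close> has. Hence \<open>U = V\<close>.\<close>

lemma even_quasi_periodic:
  assumes hol: "U holomorphic_on UNIV"
    and Ui: "\<And>k. U (k + \<i>) = U k" and Uw: "\<And>k. U (k + cw) = exp (2 * cpi * k) * U k"
  shows "\<exists>c. \<forall>k. U k = c * Y k"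
proof -
  define V where "V k = exp (- 2 * cpi * k) * U (- k)" for k
  have hV: "V holomorphic_on UNIV"
    unfolding V_def
    by (intro holomorphic_intros holomorphic_on_compose_gen[of uminus UNIV U UNIV, unfolded o_def] hol) auto
  have Vi: "V (k + \<i>) = V k" for k
  proof -
    have "U (- k) = U (- (k + \<i>))" using Ui[of "- (k + \<i>)"] by simp
    moreover have "exp (- 2 * cpi * (k + \<i>)) = exp (- 2 * cpi * k)"
      unfolding exp_eq by (rule exI[of _ "-1"]) (simp add: algebra_simps)
    ultimately show ?thesis by (simp add: V_def)
  qed
  have Vw: "V (k + cw) = exp (2 * cpi * k) * V k" for k
  proof -
    have "U (- k) = exp (2 * cpi * (- (k + cw))) * U (- (k + cw))"
      using Uw[of "- (k + cw)"] by simp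
    moreover have "- 2 * cpi * (k + cw) = 2 * cpi * (- (k + cw))" by (simp add: algebra_simps)
    ultimately have "V (k + cw) = U (- k)" unfolding V_def by argo
    also have "\<dots> = exp (2 * cpi * k) * V k" by (simp add: V_def flip: exp_add mult.assoc)
    finally show ?thesis .
  qed
  have "\<exists>c. \<forall>k. U k + V k = c * Y k"
  proof (rule quasi_periodic_eq_multiple_Y[where s = 1])
    have "exp (- 2 * cpi * (\<i> / 2)) = -1" by (simp add: exp_minus)
    moreover have "U (- (\<i> / 2)) = U (\<i> / 2)" using Ui[of "- (\<i> / 2)"] by simp
    ultimately show "U (\<i> / 2) + V (\<i> / 2) = 0" unfolding V_def by simp
  qed (use hol hV in \<open>auto intro!: holomorphic_intros simp: Ui Vi Uw Vw algebra_simps\<close>)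
  then obtain c where c: "\<And>k. U k + V k = c * Y k" by blast
  define D where "D k = U (k - \<i> / 2) - V (k - \<i> / 2)" for k
  have Dw: "D (k + cw) = - 1 * exp (2 * cpi * k) * D k" for k
  proof -
    have "exp (2 * cpi * (k - \<i> / 2)) = - exp (2 * cpi * k)"
      by (simp add: algebra_simps exp_diff)
    then show ?thesis using Uw[of "k - \<i> / 2"] Vw[of "k - \<i> / 2"] by (simp add: D_def algebra_simps)
  qed
  have "\<exists>d. \<forall>k. D k = d * Y k"
  proof (rule quasi_periodic_eq_multiple_Y[OF _ _ Dw])
    show "D holomorphic_on UNIV"
      unfolding D_def
      by (intro holomorphic_intros holomorphic_on_compose_gen[of "\<lambda>k. k - \<i> / 2" UNIV U UNIV, unfolded o_def]
            holomorphic_on_compose_gen[of "\<lambda>k. k - \<i> / 2" UNIV V UNIV, unfolded o_def] hol hV) auto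
    show "D (k + \<i>) = D k" for k
      using Ui[of "k - \<i> / 2"] Vi[of "k - \<i> / 2"] by (simp add: D_def algebra_simps)
    show "D (\<i> / 2) = 0" by (simp add: D_def V_def)
  qed simp
  then obtain d where d: "\<And>k. D k = d * Y k" by blast
  have "d * Y (0 + cw) = - (d * Y 0)"
    using Dw[of 0] unfolding d by simp
  then have "d * Y 0 = 0" unfolding Y_plus_w by simp
  then have "d = 0" using Y_of_real_nonzero[of 0] by simp
  then have "U k = V k" for k using d[of "k + \<i> / 2"] by (simp add: D_def)
  then have "U k = c / 2 * Y k" for k using c[of k] by (simp add: field_simps)
  then show ?thesis by blast
qed

text \<open>Undoing the half-period shift in \<open>Yo\<close> turns the sign under
  \<open>\<i>\<close> into true periodicity, which reduces to the even case.\<close>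

lemma odd_quasi_periodic:
  assumes hol: "U holomorphic_on UNIV"
    and Ui: "\<And>k. U (k + \<i>) = - U k" and Uw: "\<And>k. U (k + cw) = exp (2 * cpi * k) * U k"
  shows "\<exists>c. \<forall>k. U k = c * Yo k"
proof -
  define V where "V k = exp (cpi * k) * U (k - cw / 2)" for k
  have "\<exists>c. \<forall>k. V k = c * Y k"
  proof (rule even_quasi_periodic)
    show "V holomorphic_on UNIV"
      unfolding V_def
      by (intro holomorphic_intros holomorphic_on_compose_gen[of "\<lambda>k. k - cw / 2" UNIV U UNIV, unfolded o_def] hol) auto
    show "V (k + \<i>) = V k" for k
      using Ui[of "k - cw / 2"] by (simp add: V_def algebra_simps exp_add)
    show "V (k + cw) = exp (2 * cpi * k) * V k" for k
    proof -
      have "exp (cpi * (k + cw)) * exp (2 * cpi * (k - cw / 2)) = exp (2 * cpi * k) * exp (cpi * k)"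
        unfolding exp_add[symmetric] by (simp add: algebra_simps)
      then show ?thesis using Uw[of "k - cw / 2"] by (simp add: V_def algebra_simps)
    qed
  qed
  then obtain c where c: "\<And>k. V k = c * Y k" by blast
  have "U k = (c * exp (- cpi * cw / 2)) * Yo k" for k
  proof -
    have "U k = exp (- cpi * (k + cw / 2)) * V (k + cw / 2)"
      by (simp add: V_def flip: exp_add mult.assoc)
    also have "\<dots> = (exp (- cpi * (k + cw / 2)) * c) * Y (k + cw / 2)" by (simp add: c)
    also have "exp (- cpi * (k + cw / 2)) = exp (- cpi * cw / 2) * exp (- cpi * k)"
      unfolding exp_add[symmetric] by (intro arg_cong[where f=exp]) (simp add: field_simps)
    finally show ?thesis by (simp add: Yo_def mult_ac)
  qed
  then show ?thesis by blast
qed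

section \<open>Monotonicity of \<open>phi\<close> in the cosine\<close>

lemma norm_one_plus_cis: "(norm (1 + of_real r * cis t))\<^sup>2 = 1 + r\<^sup>2 + 2 * r * cos t"
proof -
  have "(norm (1 + of_real r * cis t))\<^sup>2 = (1 + r * cos t)\<^sup>2 + (r * sin t)\<^sup>2"
    by (simp add: cmod_power2)
  also have "\<dots> = 1 + r\<^sup>2 * ((sin t)\<^sup>2 + (cos t)\<^sup>2) + 2 * r * cos t"
    by algebra
  finally show ?thesis by simp
qed

text \<open>With \<open>c = cos t\<close> this is |1 + r e^(it)|^2 / |1 - r e^(it)|^2, one factor of
  the product for \<open>phi\<close>.\<close>

definition gfac :: "real \<Rightarrow> real \<Rightarrow> real" where
  "gfac r c = (1 + r\<^sup>2 + 2 * r * c) / (1 + r\<^sup>2 - 2 * r * c)"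

lemma gfac_cos:
  "gfac r (cos t) = (norm (1 + of_real r * cis t))\<^sup>2 / (norm (1 + of_real r * (- cis t)))\<^sup>2"
  using norm_one_plus_cis[of r t] norm_one_plus_cis[of "- r" t] by (simp add: gfac_def)

lemma gfac_bounds:
  assumes "0 < r" "r < 1" "-1 \<le> c" "c \<le> 1"
  shows "1 + r\<^sup>2 + 2 * r * c > 0" "1 + r\<^sup>2 - 2 * r * c > 0" "gfac r c > 0"
proof -
  have "(1 - r)\<^sup>2 > 0" using assms by simp
  then have "1 + r\<^sup>2 > 2 * r" by (simp add: power2_eq_square algebra_simps)
  moreover have "2 * r * c \<le> 2 * r * 1" "2 * r * (- c) \<le> 2 * r * 1"
    using assms by (intro mult_left_mono; simp)+
  ultimately show "1 + r\<^sup>2 + 2 * r * c > 0" "1 + r\<^sup>2 - 2 * r * c > 0" by linarith+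
  then show "gfac r c > 0" by (simp add: gfac_def)
qed

lemma gfac_strict_mono:
  assumes "0 < r" "r < 1" "-1 \<le> c" "c < d" "d \<le> 1"
  shows "gfac r c < gfac r d"
  unfolding gfac_def
proof (rule frac_less)
  show "1 + r\<^sup>2 + 2 * r * c < 1 + r\<^sup>2 + 2 * r * d" using assms by simp
  show "1 + r\<^sup>2 - 2 * r * d \<le> 1 + r\<^sup>2 - 2 * r * c" using assms by simp
qed (use assms gfac_bounds[of r c] gfac_bounds[of r d] in auto)

lemma gfac_mono:
  assumes "0 < r" "r < 1" "-1 \<le> c" "c \<le> d" "d \<le> 1"
  shows "gfac r c \<le> gfac r d"
  using gfac_strict_mono[OF assms(1-3) _ assms(5)] assms(4) by (cases "c = d") auto

text \<open>The product for \<open>phi\<close> without its first factor. A limit of products keeps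
  only weak monotonicity, so strictness has to come from one factor held outside.\<close>

definition tail :: "real \<Rightarrow> real" where
  "tail t = (norm (qprod q (of_real q ^ 2 * cis t)) / norm (qprod q (- (of_real q ^ 2 * cis t))))\<^sup>2"

lemma tail_pos: "tail t > 0"
proof -
  have "norm (complex_of_real q ^ 2 * cis t) \<le> 1"
    using q01 by (simp add: norm_mult norm_power power_le_one)
  then show ?thesis using qprod_nonzero[OF q01] by (simp add: tail_def)
qed

lemma tail_LIMSEQ: "(\<lambda>N. \<Prod>n<N. gfac (q ^ (2 * n + 3)) (cos t)) \<longlonglongrightarrow> tail t"
proof -
  let ?x = "of_real q ^ 2 * cis t"
  have nz: "qprod q (- ?x) \<noteq> 0"
    using q01 by (intro qprod_nonzero) (auto simp: norm_mult norm_power power_le_one)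
  have "(\<lambda>N. (norm (\<Prod>n<N. 1 + of_real q ^ (2 * n + 1) * ?x) / norm (\<Prod>n<N. 1 + of_real q ^ (2 * n + 1) * (- ?x)))\<^sup>2)
      \<longlonglongrightarrow> tail t"
    unfolding tail_def using nz by (intro tendsto_intros qprod_LIMSEQ q01) auto
  moreover have "(norm (\<Prod>n<N. 1 + of_real q ^ (2 * n + 1) * ?x) / norm (\<Prod>n<N. 1 + of_real q ^ (2 * n + 1) * (- ?x)))\<^sup>2
      = (\<Prod>n<N. gfac (q ^ (2 * n + 3)) (cos t))" for N
  proof -
    have "(norm (\<Prod>n<N. f n) / norm (\<Prod>n<N. h n))\<^sup>2 = (\<Prod>n<N. (norm (f n))\<^sup>2 / (norm (h n))\<^sup>2)"
      for f h :: "nat \<Rightarrow> complex"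
    proof (induction N)
      case (Suc N)
      show ?case
        unfolding prod.lessThan_Suc norm_mult Suc.IH[symmetric] by (simp add: power_mult_distrib power_divide)
    qed simp
    moreover have "complex_of_real q ^ (2 * n + 1) * ?x = of_real (q ^ (2 * n + 3)) * cis t" for n
      by (simp add: power_add power3_eq_cube power2_eq_square)
    ultimately show ?thesis unfolding gfac_cos mult_minus_right by (simp only:)
  qed
  ultimately show ?thesis by simp
qed

lemma tail_mono:
  assumes "cos s \<le> cos t"
  shows "tail s \<le> tail t"
proof (rule LIMSEQ_le[OF tail_LIMSEQ tail_LIMSEQ], intro exI allI impI prod_mono conjI)
  fix n
  have r: "0 < q ^ (2 * n + 3)" "q ^ (2 * n + 3) < 1"
    using q01 power_strict_decreasing[of 0 "2 * n + 3" q] by auto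
  show "0 \<le> gfac (q ^ (2 * n + 3)) (cos s)" using gfac_bounds(3)[OF r, of "cos s"] by simp
  show "gfac (q ^ (2 * n + 3)) (cos s) \<le> gfac (q ^ (2 * n + 3)) (cos t)"
    using assms r by (intro gfac_mono) auto
qed

lemma phi_eq: "phi k = exp (- pi * w / 4) * (gfac q (cos (2 * pi * k / w)) * tail (2 * pi * k / w))"
proof -
  let ?x = "cis (2 * pi * k / w)"
  have "phi k = exp (- pi * w / 4) * (norm ((1 + of_real q * ?x) * qprod q (of_real q ^ 2 * ?x)) /
      norm ((1 + of_real q * (- ?x)) * qprod q (of_real q ^ 2 * (- ?x))))\<^sup>2"
    unfolding phi_def by (subst (1 2) qprod_rec[OF q01]) (rule refl)
  then show ?thesis by (simp add: gfac_cos tail_def norm_mult power_divide power_mult_distrib)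
qed

lemma phi_pos: "phi k > 0"
  unfolding phi_eq using gfac_bounds(3)[OF q01, of "cos (2 * pi * k / w)"] tail_pos by simp

text \<open>Both factors of \<open>phi\<close> are positive and move in the same direction with the
  cosine, so the variation of the first, times a value of the second, is a lower bound. This one
  estimate yields injectivity up to symmetry as well as the non-vanishing derivative, without
  differentiating an infinite product.\<close>

lemma phi_lower:
  "\<bar>phi s - phi t\<bar> \<ge> exp (- pi * w / 4) * tail (2 * pi * t / w) *
     \<bar>gfac q (cos (2 * pi * s / w)) - gfac q (cos (2 * pi * t / w))\<bar>"
proof -
  define g where "g x = gfac q (cos (2 * pi * x / w))" for x
  define l where "l x = tail (2 * pi * x / w)" for x
  define C where "C = exp (- pi * w / 4)"
  have C: "C > 0" by (simp add: C_def)
  have g: "g x > 0" for x unfolding g_def using gfac_bounds(3)[OF q01] by simp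
  have l: "l x > 0" for x unfolding l_def by (rule tail_pos)
  have eq: "phi s - phi t = C * ((g s - g t) * l t + g s * (l s - l t))"
    unfolding phi_eq g_def l_def C_def by (simp add: algebra_simps)
  have "\<bar>(g s - g t) * l t\<bar> \<le> \<bar>(g s - g t) * l t + g s * (l s - l t)\<bar>"
  proof (cases "cos (2 * pi * t / w) \<le> cos (2 * pi * s / w)")
    case True
    then have "g t \<le> g s" "l t \<le> l s"
      unfolding g_def l_def using q01 by (auto intro!: gfac_mono tail_mono)
    then have "0 \<le> (g s - g t) * l t" "0 \<le> g s * (l s - l t)" using g[of s] l[of t] by auto
    then show ?thesis by linarith
  next
    case False
    then have "g s \<le> g t" "l s \<le> l t"
      unfolding g_def l_def using q01 by (auto intro!: gfac_mono tail_mono)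
    then have "(g s - g t) * l t \<le> 0" "g s * (l s - l t) \<le> 0"
      using g[of s] l[of t] by (auto simp: mult_le_0_iff)
    then show ?thesis by linarith
  qed
  then have "C * (\<bar>g s - g t\<bar> * l t) \<le> C * \<bar>(g s - g t) * l t + g s * (l s - l t)\<bar>"
    using C l[of t] by (simp add: abs_mult)
  also have "\<dots> = \<bar>phi s - phi t\<bar>" unfolding eq using C by (simp add: abs_mult)
  finally show ?thesis by (simp add: g_def l_def C_def mult_ac)
qed

lemma phi_eq_imp:
  assumes "phi s = phi t"
  shows "(\<exists>n::int. s - t = of_int n * w) \<or> (\<exists>n::int. s + t = of_int n * w)"
proof -
  have "exp (- pi * w / 4) * tail (2 * pi * t / w) *
     \<bar>gfac q (cos (2 * pi * s / w)) - gfac q (cos (2 * pi * t / w))\<bar> \<le> 0"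
    using phi_lower[of t s] assms by simp
  then have "gfac q (cos (2 * pi * s / w)) = gfac q (cos (2 * pi * t / w))"
    using tail_pos[of "2 * pi * t / w"] by (simp add: mult_le_0_iff)
  then have "cos (2 * pi * s / w) = cos (2 * pi * t / w)"
    using gfac_strict_mono[OF q01, of "cos (2 * pi * s / w)" "cos (2 * pi * t / w)"]
      gfac_strict_mono[OF q01, of "cos (2 * pi * t / w)" "cos (2 * pi * s / w)"]
    by (cases "cos (2 * pi * s / w)" "cos (2 * pi * t / w)" rule: linorder_cases) auto
  then obtain n where n: "2 * pi * s / w = 2 * pi * t / w + 2 * of_int n * pi \<or> 2 * pi * s / w = - (2 * pi * t / w) + 2 * of_int n * pi"
    unfolding cos_eq by (auto elim!: Ints_cases)
  then show ?thesis
  proof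
    assume "2 * pi * s / w = 2 * pi * t / w + 2 * of_int n * pi"
    then have "(2 * pi) * (s - t) = (2 * pi) * (of_int n * w)" using w_pos by (simp add: field_simps)
    then have "s - t = of_int n * w" by (subst (asm) mult_cancel_left) simp
    then show ?thesis by blast
  next
    assume "2 * pi * s / w = - (2 * pi * t / w) + 2 * of_int n * pi"
    then have "(2 * pi) * (s + t) = (2 * pi) * (of_int n * w)" using w_pos by (simp add: field_simps)
    then have "s + t = of_int n * w" by (subst (asm) mult_cancel_left) simp
    then show ?thesis by blast
  qed
qed

text \<open>Through \<open>phi_lower\<close> a vanishing derivative would pass to the explicit first
  factor \<open>g\<close>, whose derivative vanishes only where \<open>sin (2 * pi * t / w)\<close>
  does.\<close>

lemma phi_deriv_nonzero:
  assumes d: "(phi has_real_derivative D) (at t)" and t: "\<nexists>n::int. t = of_int n * w / 2"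
  shows "D \<noteq> 0"
proof
  assume "D = 0"
  define g where "g x = gfac q (cos (2 * pi * x / w))" for x
  define C where "C = exp (- pi * w / 4) * tail (2 * pi * t / w)"
  have C: "C > 0" using tail_pos by (simp add: C_def)
  have low: "\<bar>g s - g t\<bar> \<le> \<bar>phi s - phi t\<bar> / C" for s
    using phi_lower[of t s] C unfolding g_def C_def[symmetric] by (simp add: field_simps)
  have "((\<lambda>s. (g s - g t) / (s - t)) \<longlongrightarrow> 0) (at t)"
  proof (rule Lim_null_comparison)
    have "((\<lambda>s. (phi s - phi t) / (s - t)) \<longlongrightarrow> 0) (at t)"
      using d \<open>D = 0\<close> by (simp add: has_field_derivative_iff)
    then have "((\<lambda>s. \<bar>(phi s - phi t) / (s - t)\<bar> / C) \<longlongrightarrow> \<bar>0\<bar> / C) (at t)"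
      using C by (intro tendsto_intros) auto
    then show "((\<lambda>s. \<bar>(phi s - phi t) / (s - t)\<bar> / C) \<longlongrightarrow> 0) (at t)" by simp
    have "norm ((g s - g t) / (s - t)) \<le> \<bar>(phi s - phi t) / (s - t)\<bar> / C" for s
      using divide_right_mono[OF low[of s], of "\<bar>s - t\<bar>"] by (simp add: mult.commute)
    then show "\<forall>\<^sub>F s in at t. norm ((g s - g t) / (s - t)) \<le> \<bar>(phi s - phi t) / (s - t)\<bar> / C" by simp
  qed
  then have "(g has_real_derivative 0) (at t)" by (simp add: has_field_derivative_iff)
  moreover have "(g has_real_derivative
      ((2 * q * (1 + q\<^sup>2 - 2 * q * cos (2 * pi * t / w)) + (1 + q\<^sup>2 + 2 * q * cos (2 * pi * t / w)) * (2 * q))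
        / (1 + q\<^sup>2 - 2 * q * cos (2 * pi * t / w))\<^sup>2) * (- sin (2 * pi * t / w) * (2 * pi / w))) (at t)"
  proof -
    have nz: "1 + q\<^sup>2 - 2 * q * cos (2 * pi * t / w) \<noteq> 0"
      using gfac_bounds(2)[OF q01, of "cos (2 * pi * t / w)"] by simp
    have 1: "((\<lambda>x. cos (2 * pi * x / w)) has_real_derivative (- sin (2 * pi * t / w) * (2 * pi / w))) (at t)"
      using w_pos by (auto intro!: derivative_eq_intros)
    have 2: "(gfac q has_real_derivative ((2 * q * (1 + q\<^sup>2 - 2 * q * cos (2 * pi * t / w)) + (1 + q\<^sup>2 + 2 * q * cos (2 * pi * t / w)) * (2 * q))
        / (1 + q\<^sup>2 - 2 * q * cos (2 * pi * t / w))\<^sup>2)) (at (cos (2 * pi * t / w)))"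
      unfolding gfac_def[abs_def] using nz by (auto intro!: derivative_eq_intros simp: power2_eq_square)
    show ?thesis unfolding g_def by (rule DERIV_chain2[OF 2 1])
  qed
  ultimately have "((2 * q * (1 + q\<^sup>2 - 2 * q * cos (2 * pi * t / w)) + (1 + q\<^sup>2 + 2 * q * cos (2 * pi * t / w)) * (2 * q))
        / (1 + q\<^sup>2 - 2 * q * cos (2 * pi * t / w))\<^sup>2) * (- sin (2 * pi * t / w) * (2 * pi / w)) = 0"
    using DERIV_unique by blast
  moreover have "(2 * q * (1 + q\<^sup>2 - 2 * q * cos (2 * pi * t / w)) + (1 + q\<^sup>2 + 2 * q * cos (2 * pi * t / w)) * (2 * q))
        / (1 + q\<^sup>2 - 2 * q * cos (2 * pi * t / w))\<^sup>2 > 0"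
  proof -
    have pos: "(2 * q * a + b * (2 * q)) / a\<^sup>2 > 0" if "a > 0" "b > 0" for a b
      using that q01 by (intro divide_pos_pos add_pos_pos mult_pos_pos zero_less_power) auto
    show ?thesis by (intro pos) (use gfac_bounds[OF q01] in auto)
  qed
  ultimately have "sin (2 * pi * t / w) = 0" using w_pos by auto
  then obtain n :: int where "2 * pi * t / w = of_int n * pi" unfolding sin_zero_iff_int2 by blast
  then have "pi * t = pi * (of_int n * w / 2)" using w_pos by (simp add: field_simps)
  then have "t = of_int n * w / 2" by (subst (asm) mult_cancel_left) simp
  then show False using t by blast
qed

lemma phi_has_deriv: "\<exists>D. (phi has_real_derivative D) (at t)"
proof -
  define f where "f k = Yo k / Y k" for k
  have "f holomorphic_on {k. Y k \<noteq> 0}"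
    unfolding f_def Yo_def by (intro holomorphic_intros) auto
  moreover have "open {k. Y k \<noteq> 0}"
    by (intro open_Collect_neq holomorphic_on_imp_continuous_on[OF holomorphic_Y] continuous_intros)
  ultimately have "(f has_field_derivative deriv f (of_real t)) (at (of_real t))"
    using Y_of_real_nonzero by (auto intro: holomorphic_derivI)
  then have "((\<lambda>x. f (of_real x)) has_vector_derivative deriv f (of_real t)) (at t)"
    by (rule has_vector_derivative_real_field)
  then have "((\<lambda>x. Re (f (of_real x))) has_real_derivative Re (deriv f (of_real t))) (at t)"
    by (rule has_field_derivative_Re)
  moreover have "Re (f (of_real x)) = phi x" for x
    using Y_of_real_nonzero[of x] by (simp add: f_def Yo_of_real)
  ultimately show ?thesis by auto
qed

end

section \<open>The determinant of a periodic Hankel operator\<close>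

lemma has_sum_minus_has_sum:
  fixes f g :: "'a \<Rightarrow> complex"
  assumes "(f has_sum a) A" "(g has_sum b) A"
  shows "((\<lambda>x. f x - g x) has_sum (a - b)) A"
  using has_sum_add[OF assms(1) has_sum_uminusI[OF assms(2)]] by simp

lemma summable_on_exp_abs_int:
  assumes "b > 0"
  shows "(\<lambda>n::int. exp (- b * \<bar>real_of_int n\<bar>)) summable_on UNIV"
proof -
  have s: "summable (\<lambda>n. norm (exp (- b * real n)))"
  proof -
    have "summable (\<lambda>n. exp (- b) ^ n)" using assms by (intro summable_geometric) auto
    then show ?thesis by (simp add: exp_of_nat_mult[symmetric] mult.commute)
  qed
  have nat: "(\<lambda>n::nat. exp (- b * real n)) summable_on UNIV"
    by (rule norm_summable_imp_summable_on[OF s])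
  have 1: "(\<lambda>n::int. exp (- b * \<bar>real_of_int n\<bar>)) summable_on range int"
    using nat by (subst summable_on_reindex) (auto simp: o_def)
  have 2: "(\<lambda>n::int. exp (- b * \<bar>real_of_int n\<bar>)) summable_on range (\<lambda>n. - int n)"
    using nat by (subst summable_on_reindex) (auto simp: o_def inj_on_def)
  have "x \<in> range int \<union> range (\<lambda>n. - int n)" for x
    using int_cases2[of x] by blast
  then have "UNIV = range int \<union> range (\<lambda>n. - int n)" by blast
  moreover have "(\<lambda>n::int. exp (- b * \<bar>real_of_int n\<bar>)) summable_on (range int \<union> range (\<lambda>n. - int n))"
    by (rule summable_on_union[OF 1 2])
  ultimately show ?thesis by simp
qed

lemma fdet_identity:
  assumes "finite S"
  shows "fdet S (\<lambda>i j. if i = j then 1 else 0) = 1"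
  using assms
proof (induction S)
  case empty
  then show ?case by (simp add: fdet_def)
next
  case (insert s S)
  have "(\<lambda>i j. if i = j then 1 else 0) = set_col (\<lambda>i j. if i = j then 1 else 0) s (\<lambda>i. if i = s then 1 else 0)"
    by (auto simp: set_col_def fun_eq_iff)
  then show ?case using fdet_insert_unit_column[OF insert.hyps, of "\<lambda>i j. if i = j then 1 else 0"] insert.IH by simp
qed

locale hankel = theta +
  fixes c :: "int \<Rightarrow> complex"
  assumes c_summable:
    "(\<lambda>(n, m). norm (c (n - m)) * exp (- pi * w * (\<bar>real_of_int n\<bar> + \<bar>real_of_int m\<bar>) / 2)) summable_on UNIV \<times> UNIV"
begin

text \<open>The sign of the exponent depends on \<open>n\<close> so that \<open>th n k \<longlonglongrightarrow> 1\<close> and \<open>sg n k \<longlonglongrightarrow> 0\<close> as \<open>\<bar>n\<bar>\<close> grows;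
  in either case \<open>2 * sg n k / th n k = sech(\<pi>(k + \<omega>n))\<close>.\<close>

definition sexp :: "int \<Rightarrow> complex \<Rightarrow> complex" where
  "sexp n u = (if n \<ge> 0 then exp (- u) else exp u)"

definition th :: "int \<Rightarrow> complex \<Rightarrow> complex" where
  "th n k = 1 + sexp n (2 * cpi * (k + cw * of_int n))"

definition sg :: "int \<Rightarrow> complex \<Rightarrow> complex" where
  "sg n k = sexp n (cpi * (k + cw * of_int n))"

text \<open>Conjugation by these weights moves half of the row decay exp(-pi w |n|) to the columns,
  which leads to the symmetric exponential in \<open>amp\<close>.\<close>

definition wt :: "int \<Rightarrow> real" where
  "wt n = exp (pi * w * \<bar>real_of_int n\<bar> / 2)"

definition K :: "complex \<Rightarrow> int \<Rightarrow> int \<Rightarrow> complex" where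
  "K k n m = 2 * cpi * sg n k * c (n - m) * of_real (wt n / wt m)"

text \<open>With A denoting \<open>K\<close> after division of row \<open>n\<close> by
  \<open>th n k\<close>, this is I - zA with row \<open>n\<close> multiplied by
  \<open>th n k\<close>, so that the poles in \<open>k\<close> are gone.\<close>

definition M :: "complex \<Rightarrow> complex \<Rightarrow> int \<Rightarrow> int \<Rightarrow> complex" where
  "M k z n m = (if n = m then th n k else 0) - z * K k n m"

definition G :: "complex \<Rightarrow> complex \<Rightarrow> complex" where
  "G k z = vkdet (M k z)"

definition amp :: "int \<Rightarrow> int \<Rightarrow> real" where
  "amp n m = norm (c (n - m)) * exp (- pi * w * (\<bar>real_of_int n\<bar> + \<bar>real_of_int m\<bar>) / 2)"

lemma amp_nonneg: "amp n m \<ge> 0" by (simp add: amp_def)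

lemma amp_summable: "(\<lambda>(n, m). amp n m) summable_on UNIV \<times> UNIV"
  using c_summable by (simp add: amp_def)

lemma amp_summable': "(\<lambda>(m, n). amp n m) summable_on UNIV \<times> UNIV"
proof -
  have "(\<lambda>(n, m). amp n m) summable_on prod.swap ` (UNIV \<times> UNIV)"
    using amp_summable by simp
  then have "((\<lambda>(n, m). amp n m) \<circ> prod.swap) summable_on UNIV \<times> UNIV"
    by (subst (asm) summable_on_reindex) auto
  then show ?thesis by (simp add: o_def case_prod_unfold)
qed

lemma amp_row: "(\<lambda>m. amp n m) summable_on UNIV" "(\<lambda>n. \<Sum>\<^sub>\<infinity>m. amp n m) summable_on UNIV"
  using summable_on_SigmaD1[OF amp_summable, of n] summable_on_Sigma_banach[OF amp_summable] by simp_all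

lemma amp_col: "(\<lambda>n. amp n m) summable_on UNIV" "(\<lambda>m. \<Sum>\<^sub>\<infinity>n. amp n m) summable_on UNIV"
  using summable_on_SigmaD1[OF amp_summable', of m] summable_on_Sigma_banach[OF amp_summable'] by simp_all

lemma norm_sexp_le:
  assumes "norm k \<le> R" "s \<ge> 0"
  shows "norm (sexp n (of_real s * (k + cw * of_int n))) \<le> exp (s * R) * exp (- s * w * \<bar>real_of_int n\<bar>)"
proof -
  have R: "\<bar>Re k\<bar> \<le> R" using abs_Re_le_cmod[of k] assms by linarith
  then have "s * Re k \<le> s * R" "s * (- Re k) \<le> s * R"
    using assms by (intro mult_left_mono; linarith)+
  then show ?thesis
    using w_pos by (auto simp: sexp_def exp_add[symmetric] algebra_simps)
qed

lemma norm_K_le: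
  assumes "norm k \<le> R"
  shows "norm (K k n m) \<le> 2 * pi * exp (pi * R) * amp n m"
proof -
  have "norm (K k n m) = 2 * pi * norm (sg n k) * norm (c (n - m)) * (wt n / wt m)"
    by (simp add: K_def norm_mult norm_divide wt_def)
  also have "\<dots> \<le> 2 * pi * (exp (pi * R) * exp (- pi * w * \<bar>real_of_int n\<bar>)) * norm (c (n - m)) * (wt n / wt m)"
    unfolding sg_def using norm_sexp_le[OF assms, of pi n]
    by (intro mult_right_mono mult_left_mono) (auto simp: wt_def)
  also have "\<dots> = 2 * pi * exp (pi * R) * amp n m"
  proof -
    have "exp (- pi * w * \<bar>real_of_int n\<bar>) * (wt n / wt m) = exp (- pi * w * (\<bar>real_of_int n\<bar> + \<bar>real_of_int m\<bar>) / 2)"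
      unfolding wt_def exp_diff[symmetric] exp_add[symmetric] by (simp add: field_simps)
    then show ?thesis unfolding amp_def by (simp add: mult_ac)
  qed
  finally show ?thesis .
qed

definition colb :: "real \<Rightarrow> real \<Rightarrow> int \<Rightarrow> real" where
  "colb R B m = exp (2 * pi * R) * exp (- (2 * pi * w) * \<bar>real_of_int m\<bar>) + B * (2 * pi * exp (pi * R)) * (\<Sum>\<^sub>\<infinity>n. amp n m)"

text \<open>The first summand of \<open>colb\<close> measures how far \<open>th\<close> is from 1,
  the second bounds \<open>z * K\<close>. Both are uniform on balls, as needed for holomorphy in
  \<open>k\<close> and in \<open>z\<close>.\<close>

lemma col_bound_M:
  assumes k: "norm k \<le> R" and z: "norm z \<le> B"
  shows "col_bound (colb R B) (M k z)"
  unfolding col_bound_def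
proof (intro conjI allI impI)
  show "colb R B summable_on UNIV"
    unfolding colb_def[abs_def] using w_pos
    by (intro summable_on_add summable_on_cmult_right summable_on_exp_abs_int amp_col) auto
  have B: "B \<ge> 0" by (rule order_trans[OF norm_ge_zero z])
  fix S :: "int set" and m assume S: "finite S"
  have "(\<Sum>n\<in>S. norm (M k z n m - (if n = m then 1 else 0)))
      \<le> (\<Sum>n\<in>S. (if n = m then exp (2 * pi * R) * exp (- (2 * pi * w) * \<bar>real_of_int m\<bar>) else 0)
          + B * (2 * pi * exp (pi * R)) * amp n m)"
  proof (rule sum_mono)
    fix n
    have K: "norm (z * K k n m) \<le> B * (2 * pi * exp (pi * R)) * amp n m"
      using mult_mono[OF z norm_K_le[OF k, of n m] B norm_ge_zero] by (simp add: norm_mult mult.assoc)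
    have "norm (sexp m (2 * cpi * (k + cw * of_int m))) \<le> exp (2 * pi * R) * exp (- (2 * pi * w) * \<bar>real_of_int m\<bar>)"
      using norm_sexp_le[OF k, of "2 * pi" m] by (simp add: mult.assoc)
    with K show "norm (M k z n m - (if n = m then 1 else 0))
       \<le> (if n = m then exp (2 * pi * R) * exp (- (2 * pi * w) * \<bar>real_of_int m\<bar>) else 0)
          + B * (2 * pi * exp (pi * R)) * amp n m"
      using norm_triangle_ineq4[of "sexp m (2 * cpi * (k + cw * of_int m))" "z * K k m m"]
      by (auto simp: M_def th_def)
  qed
  also have "\<dots> \<le> exp (2 * pi * R) * exp (- (2 * pi * w) * \<bar>real_of_int m\<bar>) + B * (2 * pi * exp (pi * R)) * (\<Sum>n\<in>S. amp n m)"
    using S by (simp add: sum.distrib sum_distrib_left)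
  also have "\<dots> \<le> colb R B m"
  proof -
    have "(\<Sum>n\<in>S. amp n m) \<le> (\<Sum>\<^sub>\<infinity>n. amp n m)"
      by (rule finite_sum_le_infsum[OF amp_col(1) S]) (auto simp: amp_nonneg)
    then show ?thesis unfolding colb_def using B by (intro add_left_mono mult_left_mono) auto
  qed
  finally show "(\<Sum>n\<in>S. norm (M k z n m - (if n = m then 1 else 0))) \<le> colb R B m" .
qed

lemmas col_bound_M' = col_bound_M[OF order_refl order_refl]

section \<open>Analyticity, quasi-periods and splitting of \<open>G\<close>\<close>

lemma holomorphic_on_UNIV_if_balls:
  assumes "\<And>R. R > 0 \<Longrightarrow> f holomorphic_on ball 0 R"
  shows "f holomorphic_on UNIV"
proof -
  have "f field_differentiable at x" for x
  proof -
    have "norm x + 1 > 0" using norm_ge_zero[of x] by linarith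
    then show ?thesis
      using holomorphic_on_imp_differentiable_at[OF assms[of "norm x + 1"], of x] by simp
  qed
  then show ?thesis by (simp add: holomorphic_on_def field_differentiable_at_within)
qed

lemma holomorphic_sexp [holomorphic_intros]: "f holomorphic_on A \<Longrightarrow> (\<lambda>k. sexp n (f k)) holomorphic_on A"
  unfolding sexp_def by (cases "n \<ge> 0") (auto intro!: holomorphic_intros)

lemma holomorphic_G_k: "(\<lambda>k. G k z) holomorphic_on UNIV"
proof (rule holomorphic_on_UNIV_if_balls)
  fix R :: real assume "R > 0"
  show "(\<lambda>k. G k z) holomorphic_on ball 0 R"
    unfolding G_def
  proof (rule holomorphic_on_vkdet)
    show "col_bound (colb R (norm z)) (M k z)" if "k \<in> ball 0 R" for k
      using that by (intro col_bound_M) auto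
    show "(\<lambda>k. M k z i j) holomorphic_on ball 0 R" for i j
      unfolding M_def th_def sg_def K_def by (cases "i = j") (auto intro!: holomorphic_intros)
  qed simp
qed

lemma holomorphic_G_z: "(\<lambda>z. G k z) holomorphic_on UNIV"
proof (rule holomorphic_on_UNIV_if_balls)
  fix R :: real assume "R > 0"
  show "(\<lambda>z. G k z) holomorphic_on ball 0 R"
    unfolding G_def
  proof (rule holomorphic_on_vkdet)
    show "col_bound (colb (norm k) R) (M k z)" if "z \<in> ball 0 R" for z
      using that by (intro col_bound_M) auto
    show "(\<lambda>z. M k z i j) holomorphic_on ball 0 R" for i j
      unfolding M_def by (intro holomorphic_intros)
  qed simp
qed

lemma G_plus_i: "G (k + \<i>) z = G k (- z)"
proof -
  have 1: "th n (k + \<i>) = th n k" for n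
  proof -
    have a: "2 * cpi * (k + \<i> + cw * of_int n) = 2 * cpi * (k + cw * of_int n) + of_real (real_of_int (2 * 1) * pi) * \<i>"
      by (simp add: algebra_simps)
    have b: "- (2 * cpi * (k + \<i> + cw * of_int n)) = - (2 * cpi * (k + cw * of_int n)) + of_real (real_of_int (2 * (-1)) * pi) * \<i>"
      by (simp add: algebra_simps)
    have "exp (2 * cpi * (k + \<i> + cw * of_int n)) = exp (2 * cpi * (k + cw * of_int n))"
      "exp (- (2 * cpi * (k + \<i> + cw * of_int n))) = exp (- (2 * cpi * (k + cw * of_int n)))"
      unfolding exp_eq using a b by blast+
    then show ?thesis by (simp only: th_def sexp_def)
  qed
  have 2: "sg n (k + \<i>) = - sg n k" for n
  proof -
    have "cpi * (k + \<i> + cw * of_int n) = cpi * (k + cw * of_int n) + cpi * \<i>" by (simp add: algebra_simps)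
    then show ?thesis by (simp add: sg_def sexp_def exp_add exp_diff exp_minus divide_inverse)
  qed
  have "M (k + \<i>) z = M k (- z)" by (intro ext) (simp add: M_def K_def 1 2)
  then show ?thesis by (simp add: G_def)
qed

text \<open>Translating \<open>k\<close> by \<open>w\<close> shifts the index by one. Only in row -1
  does \<open>sexp\<close> change its branch, and the factor \<open>f\<close> arising there is the
  multiplier; the factors \<open>g\<close>, due to the weights, form a diagonal conjugation and
  cancel.\<close>

lemma G_plus_w: "G (k + cw) z = exp (2 * cpi * k) * G k z"
proof -
  define f where "f n = (if n = -1 then exp (2 * cpi * k) else 1)" for n :: int
  define g where "g n = complex_of_real (wt n / wt (n + 1))" for n
  have g0: "g n \<noteq> 0" for n by (simp add: g_def wt_def)
  have arg: "k + cw + cw * of_int n = k + cw * of_int (n + 1)" for n by (simp add: algebra_simps)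
  have e0: "k + cw * of_int (- 1 + 1) = k" by simp
  have 1: "th n (k + cw) = f n * th (n + 1) k" for n
  proof (cases "n = -1")
    case True
    then show ?thesis unfolding th_def arg sexp_def f_def e0 by (simp add: algebra_simps flip: exp_add)
  next
    case False
    then have "(n \<ge> 0) = (n + 1 \<ge> 0)" by auto
    with False show ?thesis unfolding th_def arg sexp_def f_def by simp
  qed
  have 2: "sg n (k + cw) = f n * sg (n + 1) k" for n
  proof (cases "n = -1")
    case True
    then show ?thesis unfolding sg_def arg sexp_def f_def e0 by (simp add: algebra_simps flip: exp_add)
  next
    case False
    then have "(n \<ge> 0) = (n + 1 \<ge> 0)" by auto
    with False show ?thesis unfolding sg_def arg sexp_def f_def by simp
  qed
  have 3: "M (k + cw) z n m = (f n * g n) * M k z (n + 1) (m + 1) * (1 / g m)" for n m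
  proof -
    have "K (k + cw) n m = (f n * g n) * K k (n + 1) (m + 1) * (1 / g m)"
      unfolding K_def 2 g_def by (simp add: wt_def)
    then show ?thesis using g0 unfolding M_def 1 by (simp add: algebra_simps)
  qed
  have fd: "fdet (win N) (M (k + cw) z) = exp (2 * cpi * k) * fdet ((\<lambda>n. n + 1) ` win N) (M k z)" if "N \<ge> 1" for N
  proof -
    have "fdet (win N) (M (k + cw) z) = fdet (win N) (\<lambda>n m. (f n * g n) * M k z (n + 1) (m + 1) * (1 / g m))"
      by (intro fdet_cong) (simp only: 3)
    also have "\<dots> = prod (\<lambda>n. f n * g n) (win N) * prod (\<lambda>m. 1 / g m) (win N) * fdet (win N) (\<lambda>n m. M k z (n + 1) (m + 1))"
      by (rule fdet_scale) simp
    also have "prod (\<lambda>n. f n * g n) (win N) * prod (\<lambda>m. 1 / g m) (win N) = prod f (win N)"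
      unfolding prod.distrib[symmetric] using g0 by (intro prod.cong) auto
    also have "\<dots> = exp (2 * cpi * k)"
    proof -
      have "-1 \<in> win N" using that by (simp add: win_def)
      then have "prod f (win N) = f (-1) * prod f (win N - {-1})" by (intro prod.remove) auto
      also have "prod f (win N - {-1}) = 1" by (intro prod.neutral) (auto simp: f_def)
      finally show ?thesis by (simp add: f_def)
    qed
    also have "fdet (win N) (\<lambda>n m. M k z (n + 1) (m + 1)) = fdet ((\<lambda>n. n + 1) ` win N) (M k z)"
      by (subst fdet_reindex) (auto simp: inj_on_def)
    finally show ?thesis .
  qed
  have "(\<lambda>N. fdet (win (Suc N)) (M (k + cw) z)) \<longlonglongrightarrow> G (k + cw) z"
    unfolding G_def by (rule LIMSEQ_Suc[OF vkdet_LIMSEQ[OF col_bound_M']])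
  moreover have "(\<lambda>N. exp (2 * cpi * k) * fdet ((\<lambda>n. n + 1) ` win (Suc N)) (M k z)) \<longlonglongrightarrow> exp (2 * cpi * k) * G k z"
    unfolding G_def
  proof (intro tendsto_intros vkdet_LIMSEQ_supersets[OF col_bound_M'])
    \<comment> \<open>The extra index on each side of \<open>win (Suc N)\<close> makes the shifted
      window contain \<open>win N\<close>.\<close>
    show "win N \<subseteq> (\<lambda>n. n + 1) ` win (Suc N)" for N
    proof
      fix x assume "x \<in> win N"
      then have "x = (x - 1) + 1" "x - 1 \<in> win (Suc N)" by (auto simp: win_def)
      then show "x \<in> (\<lambda>n. n + 1) ` win (Suc N)" by blast
    qed
  qed simp
  ultimately show ?thesis using fd by (simp add: LIMSEQ_unique)
qed

text \<open>At \<open>z = 0\<close> the matrix is diagonal with entries of modulus at least 1, so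
  its truncated determinants stay away from zero. This is what later gives
  \<open>a 0 \<noteq> 0\<close>.\<close>

lemma G_0_0: "G 0 0 \<noteq> 0"
proof -
  have th: "norm (th n 0) \<ge> 1" for n
  proof -
    have "th n 0 = of_real (1 + (if n \<ge> 0 then exp (- (2 * pi * (w * of_int n))) else exp (2 * pi * (w * of_int n))))"
      by (simp add: th_def sexp_def flip: exp_of_real)
    then show ?thesis by (simp only: norm_of_real) auto
  qed
  have "norm (fdet (win N) (M 0 0)) \<ge> 1" for N
  proof -
    have "M 0 0 = (\<lambda>n m. th n 0 * (if n = m then 1 else 0) * 1)" by (auto simp: M_def fun_eq_iff)
    then have "fdet (win N) (M 0 0) = (\<Prod>n\<in>win N. th n 0)"
      using fdet_scale[of "win N" "\<lambda>n. th n 0" "\<lambda>n m. if n = m then 1 else 0" "\<lambda>_. 1"] by (simp add: fdet_identity)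
    then show ?thesis using th by (simp add: prod_norm[symmetric] prod_ge_1)
  qed
  moreover have "(\<lambda>N. norm (fdet (win N) (M 0 0))) \<longlonglongrightarrow> norm (G 0 0)"
    unfolding G_def by (intro tendsto_intros vkdet_LIMSEQ[OF col_bound_M'])
  ultimately have "norm (G 0 0) \<ge> 1" by (intro LIMSEQ_le_const) auto
  then show ?thesis by auto
qed

text \<open>Since \<open>G_plus_i\<close> exchanges \<open>z\<close> and \<open>- z\<close>, parity
  in \<open>z\<close> is the same as the sign under \<open>\<i>\<close>. The coefficients are read
  off at \<open>k = 0\<close>, which makes their holomorphy in \<open>z\<close> immediate.\<close>

lemma G_decomposition:
  obtains a b where "a holomorphic_on UNIV" "b holomorphic_on UNIV"
    "\<And>z. a (- z) = a z" "\<And>z. b (- z) = - b z" "a 0 \<noteq> 0"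
    "\<And>k z. G k z = a z * Y k + b z * Yo k"
proof -
  have Y0: "Y 0 \<noteq> 0" using Y_of_real_nonzero[of 0] by simp
  have Yo0: "Yo 0 \<noteq> 0" using Yo_of_real[of 0] phi_pos[of 0] Y0 by simp
  define a where "a z = (G 0 z + G 0 (- z)) / 2 / Y 0" for z
  define b where "b z = (G 0 z - G 0 (- z)) / 2 / Yo 0" for z
  have hm: "(\<lambda>z. G 0 (- z)) holomorphic_on UNIV"
    using holomorphic_on_compose_gen[OF holomorphic_on_minus[OF holomorphic_on_ident] holomorphic_G_z, of UNIV 0]
    by (simp add: o_def)
  have "a holomorphic_on UNIV" "b holomorphic_on UNIV"
    unfolding a_def[abs_def] b_def[abs_def] using Y0 Yo0 by (auto intro!: holomorphic_intros hm holomorphic_G_z)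
  moreover have "a (- z) = a z" "b (- z) = - b z" for z
    by (simp_all add: a_def b_def minus_divide_left add.commute)
  moreover have "a 0 \<noteq> 0" using G_0_0 Y0 by (simp add: a_def)
  moreover have "G k z = a z * Y k + b z * Yo k" for k z
  proof -
    have "\<exists>d. \<forall>k. (G k z + G k (- z)) / 2 = d * Y k"
    proof (rule even_quasi_periodic)
      show "(\<lambda>k. (G k z + G k (- z)) / 2) holomorphic_on UNIV"
        by (intro holomorphic_intros holomorphic_G_k) auto
    qed (simp_all only: G_plus_i G_plus_w minus_minus add.commute distrib_left[symmetric] times_divide_eq_right)
    then obtain d where d: "\<And>k. (G k z + G k (- z)) / 2 = d * Y k" by blast
    have "\<exists>d. \<forall>k. (G k z - G k (- z)) / 2 = d * Yo k"
    proof (rule odd_quasi_periodic)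
      show "(\<lambda>k. (G k z - G k (- z)) / 2) holomorphic_on UNIV"
        by (intro holomorphic_intros holomorphic_G_k) auto
    qed (simp_all only: G_plus_i G_plus_w minus_minus minus_diff_eq minus_divide_left right_diff_distrib[symmetric] times_divide_eq_right)
    then obtain d' where d': "\<And>k. (G k z - G k (- z)) / 2 = d' * Yo k" by blast
    have "a z = d" "b z = d'" using d[of 0] d'[of 0] Y0 Yo0 by (simp_all add: a_def b_def)
    moreover have "G k z = (G k z + G k (- z)) / 2 + (G k z - G k (- z)) / 2" by (simp add: field_simps)
    ultimately show ?thesis unfolding d d' by simp
  qed
  ultimately show thesis by (rule that)
qed

section \<open>From solutions of the transformed eigenvalue equation to zeros of
  \<open>G\<close>\<close>

definition sol :: "complex \<Rightarrow> complex \<Rightarrow> (int \<Rightarrow> complex) \<Rightarrow> bool" where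
  "sol k lam y \<longleftrightarrow> (\<exists>B. \<forall>n. norm (y n) \<le> B) \<and> (\<forall>n. ((\<lambda>m. K k n m * y m) has_sum (lam * th n k * y n)) UNIV)"

lemma sol_cmult:
  assumes "sol k lam y"
  shows "sol k lam (\<lambda>n. r * y n)"
proof -
  obtain B where B: "\<And>n. norm (y n) \<le> B" using assms by (auto simp: sol_def)
  have "norm (r * y n) \<le> norm r * B" for n using B[of n] by (simp add: norm_mult mult_left_mono)
  moreover have "((\<lambda>m. K k n m * (r * y m)) has_sum (lam * th n k * (r * y n))) UNIV" for n
    using has_sum_cmult_right[of "\<lambda>m. K k n m * y m" UNIV "lam * th n k * y n" r] assms
    by (simp add: sol_def mult_ac)
  ultimately show ?thesis unfolding sol_def by blast
qed

lemma sol_diff: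
  assumes "sol k lam y" "sol k lam y'"
  shows "sol k lam (\<lambda>n. y n - y' n)"
proof -
  obtain B B' where B: "\<And>n. norm (y n) \<le> B" "\<And>n. norm (y' n) \<le> B'" using assms by (auto simp: sol_def)
  have "norm (y n - y' n) \<le> B + B'" for n
    using norm_triangle_ineq4[of "y n" "y' n"] B[of n] by linarith
  moreover have "((\<lambda>m. K k n m * (y m - y' m)) has_sum (lam * th n k * (y n - y' n))) UNIV" for n
    using has_sum_minus_has_sum[of "\<lambda>m. K k n m * y m" UNIV _ "\<lambda>m. K k n m * y' m"] assms
    by (simp add: sol_def right_diff_distrib)
  ultimately show ?thesis unfolding sol_def by blast
qed

text \<open>Boundedness of \<open>y\<close> suffices because the entries of \<open>K\<close> are
  absolutely summable: \<open>K y\<close>, and therefore \<open>th * y\<close>, is then an l1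
  sequence. The image under \<open>M k z\<close> is \<open>1 - z * lam\<close> times this sequence,
  which depends on neither \<open>z\<close> nor the truncation.\<close>

lemma sol_image:
  assumes "sol k lam y" "lam \<noteq> 0"
  obtains B C where "\<And>m. norm (y m) \<le> B" "C \<ge> 0"
    "\<And>z n. ((\<lambda>m. M k z n m * y m) has_sum ((1 - z * lam) * (th n k * y n))) UNIV"
    "\<And>z S. finite S \<Longrightarrow> (\<Sum>n\<in>S. norm ((1 - z * lam) * (th n k * y n))) \<le> norm (1 - z * lam) * C"
proof -
  obtain B where B: "\<And>m. norm (y m) \<le> B" using assms by (auto simp: sol_def)
  have B0: "B \<ge> 0" by (rule order_trans[OF norm_ge_zero B[of 0]])
  have y: "((\<lambda>m. K k n m * y m) has_sum (lam * th n k * y n)) UNIV" for n using assms by (simp add: sol_def)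
  define L where "L = 2 * pi * exp (pi * norm k) * B"
  have L0: "L \<ge> 0" using B0 by (simp add: L_def)
  define C where "C = L * (\<Sum>\<^sub>\<infinity>n. \<Sum>\<^sub>\<infinity>m. amp n m) / norm lam"
  have C0: "C \<ge> 0" unfolding C_def using L0 by (intro divide_nonneg_nonneg mult_nonneg_nonneg infsum_nonneg) (auto simp: amp_nonneg)
  have Kb: "norm (K k n m * y m) \<le> L * amp n m" for n m
    using mult_mono[OF norm_K_le[OF order_refl, of k n m] B[of m]] by (simp add: norm_mult L_def amp_nonneg mult_ac)
  have row: "norm (lam * th n k * y n) \<le> L * (\<Sum>\<^sub>\<infinity>m. amp n m)" for n
  proof -
    have "norm (\<Sum>\<^sub>\<infinity>m. K k n m * y m) \<le> (\<Sum>\<^sub>\<infinity>m. L * amp n m)"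
      using y[of n] summable_on_cmult_right[OF amp_row(1)[of n], of L]
      by (intro norm_infsum_le[OF has_sum_infsum has_sum_infsum Kb]) (auto simp: summable_on_def)
    then show ?thesis using infsumI[OF y[of n]] by (simp add: infsum_cmult_right')
  qed
  have C: "(\<Sum>n\<in>S. norm (th n k * y n)) \<le> C" if S: "finite S" for S
  proof -
    have "norm lam * (\<Sum>n\<in>S. norm (th n k * y n)) = (\<Sum>n\<in>S. norm (lam * th n k * y n))"
      by (simp add: sum_distrib_left norm_mult mult.assoc)
    also have "\<dots> \<le> (\<Sum>n\<in>S. L * (\<Sum>\<^sub>\<infinity>m. amp n m))" by (intro sum_mono row)
    also have "\<dots> = L * (\<Sum>n\<in>S. \<Sum>\<^sub>\<infinity>m. amp n m)" by (simp add: sum_distrib_left)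
    also have "\<dots> \<le> L * (\<Sum>\<^sub>\<infinity>n. \<Sum>\<^sub>\<infinity>m. amp n m)"
      by (intro mult_left_mono L0 finite_sum_le_infsum amp_row S) (auto simp: amp_nonneg infsum_nonneg)
    finally show ?thesis using assms(2) by (simp add: C_def field_simps)
  qed
  have 1: "((\<lambda>m. M k z n m * y m) has_sum ((1 - z * lam) * (th n k * y n))) UNIV" for z n
  proof -
    have "((\<lambda>m. (if n = m then th n k else 0) * y m) has_sum (th n k * y n)) UNIV"
      by (rule has_sum_finite_neutralI[of "{n}"]) auto
    from has_sum_minus_has_sum[OF this has_sum_cmult_right[OF y[of n], of z]]
    show ?thesis by (simp add: M_def algebra_simps)
  qed
  have 2: "(\<Sum>n\<in>S. norm ((1 - z * lam) * (th n k * y n))) \<le> norm (1 - z * lam) * C" if "finite S" for z S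
  proof -
    have "(\<Sum>n\<in>S. norm ((1 - z * lam) * (th n k * y n))) = norm (1 - z * lam) * (\<Sum>n\<in>S. norm (th n k * y n))"
      by (simp add: norm_mult sum_distrib_left)
    then show ?thesis using C[OF that] by (simp add: mult_left_mono)
  qed
  show thesis by (rule that[OF B C0 1 2])
qed

lemma G_eq_0_if_sol:
  assumes s: "sol k lam y" and lam: "lam \<noteq> 0" and y: "y n0 \<noteq> 0"
  shows "G k (1 / lam) = 0"
proof -
  define x where "x n = (1 / y n0) * y n" for n
  have "sol k lam x" unfolding x_def by (rule sol_cmult[OF s])
  then obtain B C where BC: "\<And>m. norm (x m) \<le> B" "C \<ge> 0"
    "\<And>z n. ((\<lambda>m. M k z n m * x m) has_sum ((1 - z * lam) * (th n k * x n))) UNIV"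
    "\<And>z S. finite S \<Longrightarrow> (\<Sum>n\<in>S. norm ((1 - z * lam) * (th n k * x n))) \<le> norm (1 - z * lam) * C"
    using sol_image[OF _ lam] by blast
  have x0: "x n0 = 1" using y by (simp add: x_def)
  have "norm (G k (1 / lam)) \<le> (norm (1 - (1 / lam) * lam) * C) * exp (infsum (colb (norm k) (norm (1 / lam))) UNIV)"
    unfolding G_def by (rule norm_vkdet_le_one_column[OF col_bound_M' BC(1) x0 BC(3,4)])
  then show ?thesis using lam by simp
qed

text \<open>The solutions are brought to echelon form, \<open>x n0 = 1\<close> against
  \<open>x' n0 = 0\<close> and \<open>x' n1 = 1\<close>, so that two columns can be replaced at
  once; each replacement contributes one factor \<open>1 - z * lam\<close>.\<close>

lemma G_double_zero_if_sols:
  assumes s: "sol k lam y" "sol k lam y'" and lam: "lam \<noteq> 0"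
    and ind: "\<And>r r'. \<forall>n. r * y n + r' * y' n = 0 \<Longrightarrow> r = 0 \<and> r' = 0"
  obtains C where "\<And>z. norm z \<le> R \<Longrightarrow> norm (G k z) \<le> C * (norm (1 - z * lam))\<^sup>2"
proof -
  obtain n0 where n0: "y n0 \<noteq> 0"
  proof -
    have False if "\<forall>n. y n = 0"
    proof -
      have "\<forall>n. 1 * y n + 0 * y' n = 0" using that by simp
      then have "(1::complex) = 0 \<and> (0::complex) = 0" by (rule ind)
      then show False by simp
    qed
    then show thesis using that by blast
  qed
  define x where "x n = (1 / y n0) * y n" for n
  have sx: "sol k lam x" unfolding x_def by (rule sol_cmult[OF s(1)])
  define v where "v n = y' n - y' n0 * x n" for n
  have sv: "sol k lam v" unfolding v_def by (rule sol_diff[OF s(2) sol_cmult[OF sx]])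
  obtain n1 where n1: "v n1 \<noteq> 0"
  proof -
    have False if "\<forall>n. v n = 0"
    proof -
      have "\<forall>n. (- y' n0 / y n0) * y n + 1 * y' n = 0"
      proof
        fix n
        have "(- y' n0 / y n0) * y n + 1 * y' n = v n" by (simp add: v_def x_def)
        then show "(- y' n0 / y n0) * y n + 1 * y' n = 0" using that by simp
      qed
      then have "- y' n0 / y n0 = 0 \<and> (1::complex) = 0" by (rule ind)
      then show False by simp
    qed
    then show thesis using that by blast
  qed
  define x' where "x' n = (1 / v n1) * v n" for n
  have sx': "sol k lam x'" unfolding x'_def by (rule sol_cmult[OF sv])
  have x: "x n0 = 1" "x' n0 = 0" "x' n1 = 1" using n0 n1 by (simp_all add: x_def x'_def v_def)
  obtain B C where BC: "\<And>m. norm (x m) \<le> B" "C \<ge> 0"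
    "\<And>z n. ((\<lambda>m. M k z n m * x m) has_sum ((1 - z * lam) * (th n k * x n))) UNIV"
    "\<And>z S. finite S \<Longrightarrow> (\<Sum>n\<in>S. norm ((1 - z * lam) * (th n k * x n))) \<le> norm (1 - z * lam) * C"
    using sol_image[OF sx lam] by blast
  obtain B' C' where BC': "\<And>m. norm (x' m) \<le> B'" "C' \<ge> 0"
    "\<And>z n. ((\<lambda>m. M k z n m * x' m) has_sum ((1 - z * lam) * (th n k * x' n))) UNIV"
    "\<And>z S. finite S \<Longrightarrow> (\<Sum>n\<in>S. norm ((1 - z * lam) * (th n k * x' n))) \<le> norm (1 - z * lam) * C'"
    using sol_image[OF sx' lam] by blast
  have "norm (G k z) \<le> (C * C' * exp (infsum (colb (norm k) R) UNIV)) * (norm (1 - z * lam))\<^sup>2"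
    if z: "norm z \<le> R" for z
  proof -
    have "norm (G k z) \<le> (norm (1 - z * lam) * C) * (norm (1 - z * lam) * C') * exp (infsum (colb (norm k) R) UNIV)"
      unfolding G_def
      by (rule norm_vkdet_le_two_columns[OF col_bound_M[OF order_refl z] BC(1) x(1) BC(3,4) BC'(1) x(2,3) BC'(3,4)])
    then show ?thesis by (simp add: power2_eq_square mult_ac)
  qed
  then show thesis by (rule that)
qed

end

section \<open>From eigenvectors to zeros of the determinant\<close>

text \<open>The reflection formula gives |1/Gamma(1 - iy)|^2 = sinh(pi y) / (pi y). Writing
  \<open>1 + pi * \<bar>y\<bar>\<close> in the denominator keeps the bound finite at 0.\<close>

lemma norm_rGamma_le:
  fixes y :: real
  shows "norm (rGamma (1 - \<i> * of_real y)) \<le> sqrt 2 * exp (pi * \<bar>y\<bar> / 2) / sqrt (1 + pi * \<bar>y\<bar>)"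
proof (cases "y = 0")
  case True
  then show ?thesis by simp
next
  case False
  define N where "N = norm (rGamma (1 - \<i> * of_real y))"
  have cn: "rGamma (1 + \<i> * of_real y) = cnj (rGamma (1 - \<i> * of_real y))"
    by (simp add: cnj_rGamma)
  have r1: "rGamma (\<i> * of_real y) = \<i> * of_real y * rGamma (1 + \<i> * of_real y)"
    using rGamma_plus1[of "\<i> * of_real y"] by (simp add: add.commute)
  have r2: "rGamma (- (\<i> * of_real y)) = - (\<i> * of_real y) * rGamma (1 - \<i> * of_real y)"
    using rGamma_plus1[of "- (\<i> * of_real y)"] by (simp add: add.commute)
  have sn: "sin (of_real pi * (\<i> * of_real y)) = \<i> * of_real (sinh (pi * y))"
  proof -
    have "sin (of_real pi * (\<i> * of_real y)) = (exp (- of_real (pi * y)) - exp (of_real (pi * y))) / (2 * \<i>)"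
      unfolding sin_exp_eq by (simp flip: mult.assoc) (simp add: mult.commute)
    also have "\<dots> = \<i> * ((exp (of_real (pi * y)) - exp (- of_real (pi * y))) / 2)"
      by (simp add: field_simps del: of_real_mult)
    also have "\<dots> = \<i> * of_real (sinh (pi * y))"
      by (simp add: sinh_field_def flip: exp_of_real)
    finally show ?thesis .
  qed
  have "rGamma (\<i> * of_real y) * rGamma (- (\<i> * of_real y)) = - (\<i> * of_real y) * (\<i> * of_real (sinh (pi * y))) / of_real pi"
    unfolding rGamma_reflection_complex' sn ..
  moreover have "rGamma (\<i> * of_real y) * rGamma (- (\<i> * of_real y)) = of_real (y\<^sup>2 * N\<^sup>2)"
    unfolding r1 r2 cn N_def of_real_mult complex_norm_square
    by (simp add: power2_eq_square algebra_simps)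
  ultimately have "complex_of_real (y\<^sup>2 * N\<^sup>2) = of_real (y * sinh (pi * y) / pi)"
    by (simp add: algebra_simps)
  then have "y\<^sup>2 * N\<^sup>2 = y * sinh (pi * y) / pi" using of_real_eq_iff by blast
  then have N: "N\<^sup>2 * (pi * \<bar>y\<bar>) = sinh (pi * \<bar>y\<bar>)"
    using False by (cases "y > 0") (auto simp: power2_eq_square field_simps abs_if)
  define x where "x = pi * \<bar>y\<bar>"
  have x: "x > 0" using False by (simp add: x_def)
  \<comment> \<open>In the target \<open>sinh x * (1 + x) \<le> 2 * exp x * x\<close>,
    \<open>s1\<close> takes care of the summand 1 of \<open>1 + x\<close> and \<open>s2\<close> of
    the summand \<open>x\<close>.\<close>
  have s1: "sinh x \<le> x * exp x"
  proof -
    have "1 - 2 * x \<le> exp (- (2 * x))" using exp_ge_add_one_self[of "- (2 * x)"] by simp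
    then have "exp x * (1 - exp (- (2 * x))) \<le> exp x * (2 * x)" by (intro mult_left_mono) auto
    moreover have "exp x * exp (- (2 * x)) = exp (- x)" by (simp flip: exp_add)
    ultimately show ?thesis by (simp add: sinh_field_def algebra_simps)
  qed
  have s2: "2 * sinh x \<le> exp x" by (simp add: sinh_field_def)
  have "sinh x * (1 + x) \<le> 2 * exp x * x"
  proof -
    have "x * sinh x * 2 \<le> x * exp x" using mult_left_mono[OF s2, of x] x by (simp add: mult_ac)
    moreover have "0 \<le> x * exp x" using x by simp
    ultimately have "sinh x + x * sinh x \<le> 2 * (x * exp x)" using s1 by linarith
    then show ?thesis by (simp add: algebra_simps)
  qed
  then have "N\<^sup>2 * x * (1 + x) \<le> 2 * exp x * x" using N by (simp add: x_def)
  then have "N\<^sup>2 * (1 + x) \<le> 2 * exp x" using x by (simp add: mult_ac)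
  then have "N\<^sup>2 \<le> 2 * exp x / (1 + x)" using x by (simp add: field_simps)
  also have "\<dots> = (sqrt 2 * exp (x / 2) / sqrt (1 + x))\<^sup>2"
    using x by (simp add: power_mult_distrib power_divide exp_double[symmetric])
  finally have "N \<le> sqrt 2 * exp (x / 2) / sqrt (1 + x)"
    by (rule power2_le_imp_le) (use x in auto)
  then show ?thesis by (simp add: N_def x_def)
qed

text \<open>For fixed \<open>l\<close>, \<open>\<bar>n\<bar> + \<bar>n - l\<bar> - \<bar>l\<bar>\<close> is twice the distance of \<open>n\<close> from the interval between \<open>0\<close> and \<open>l\<close>.\<close>

lemma exp_two_point_sum:
  fixes b :: real and l :: int
  assumes b: "b > 0"
  defines "S \<equiv> \<Sum>\<^sub>\<infinity>n::int. exp (- (2 * b) * \<bar>real_of_int n\<bar>)"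
  shows "(\<lambda>n::int. exp (- b * (\<bar>real_of_int n\<bar> + \<bar>real_of_int (n - l)\<bar>))) summable_on UNIV"
    and "(\<Sum>\<^sub>\<infinity>n::int. exp (- b * (\<bar>real_of_int n\<bar> + \<bar>real_of_int (n - l)\<bar>)))
       \<le> exp (- b * \<bar>real_of_int l\<bar>) * (1 + \<bar>real_of_int l\<bar> + 2 * S)"
proof -
  define J where "J = {min 0 l..max 0 l}"
  define e where "e n = exp (- (2 * b) * \<bar>real_of_int n\<bar>)" for n :: int
  define g where "g n = (if n \<in> J then 1 else 0) + e n + e (n - l)" for n
  have cJ: "real (card J) = 1 + \<bar>real_of_int l\<bar>" by (auto simp: J_def min_def max_def)
  have h1: "((\<lambda>n. if n \<in> J then 1 else 0 :: real) has_sum (1 + \<bar>real_of_int l\<bar>)) UNIV"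
    by (rule has_sum_finite_neutralI[of J]) (auto simp: cJ[symmetric], simp add: J_def)
  have h2: "(e has_sum S) UNIV"
    unfolding S_def e_def using b by (intro has_sum_infsum summable_on_exp_abs_int) auto
  have h3: "((\<lambda>n. e (n - l)) has_sum S) UNIV"
    using has_sum_reindex_bij_betw[of "\<lambda>n. n - l" UNIV UNIV e S] h2
    by (simp add: bij_betw_def inj_on_def)
  have g: "(g has_sum (1 + \<bar>real_of_int l\<bar> + 2 * S)) UNIV"
    unfolding g_def mult_2 add.assoc[symmetric] by (intro has_sum_add h1 h2 h3)
  have le: "exp (- b * (\<bar>real_of_int n\<bar> + \<bar>real_of_int (n - l)\<bar>)) \<le> exp (- b * \<bar>real_of_int l\<bar>) * g n" for n
  proof -
    have "exp (- b * (\<bar>real_of_int n\<bar> + \<bar>real_of_int (n - l)\<bar> - \<bar>real_of_int l\<bar>)) \<le> g n"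
    proof (cases "n \<in> J")
      case True
      have "- b * (\<bar>real_of_int n\<bar> + \<bar>real_of_int (n - l)\<bar> - \<bar>real_of_int l\<bar>) \<le> 0"
        using b by (auto simp: mult_le_0_iff)
      then have "exp (- b * (\<bar>real_of_int n\<bar> + \<bar>real_of_int (n - l)\<bar> - \<bar>real_of_int l\<bar>)) \<le> 1"
        by simp
      then show ?thesis using True by (simp add: g_def e_def add_increasing2)
    next
      case False
      then consider "\<bar>real_of_int n\<bar> + \<bar>real_of_int (n - l)\<bar> - \<bar>real_of_int l\<bar> = 2 * \<bar>real_of_int n\<bar>"
        | "\<bar>real_of_int n\<bar> + \<bar>real_of_int (n - l)\<bar> - \<bar>real_of_int l\<bar> = 2 * \<bar>real_of_int (n - l)\<bar>"
        by (cases "l \<ge> 0"; cases "n < 0") (auto simp: J_def)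
      then show ?thesis
      proof cases
        case 1
        then have "exp (- b * (\<bar>real_of_int n\<bar> + \<bar>real_of_int (n - l)\<bar> - \<bar>real_of_int l\<bar>)) = e n"
          unfolding 1 e_def by (simp add: mult_ac)
        also have "e n \<le> g n" by (simp add: g_def e_def)
        finally show ?thesis .
      next
        case 2
        then have "exp (- b * (\<bar>real_of_int n\<bar> + \<bar>real_of_int (n - l)\<bar> - \<bar>real_of_int l\<bar>)) = e (n - l)"
          unfolding 2 e_def by (simp add: mult_ac)
        also have "e (n - l) \<le> g n" by (simp add: g_def e_def)
        finally show ?thesis .
      qed
    qed
    then have "exp (- b * \<bar>real_of_int l\<bar>) * exp (- b * (\<bar>real_of_int n\<bar> + \<bar>real_of_int (n - l)\<bar> - \<bar>real_of_int l\<bar>))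
        \<le> exp (- b * \<bar>real_of_int l\<bar>) * g n" by simp
    moreover have "exp (- b * \<bar>real_of_int l\<bar>) * exp (- b * (\<bar>real_of_int n\<bar> + \<bar>real_of_int (n - l)\<bar> - \<bar>real_of_int l\<bar>))
        = exp (- b * (\<bar>real_of_int n\<bar> + \<bar>real_of_int (n - l)\<bar>))"
      unfolding exp_add[symmetric] by (simp add: algebra_simps)
    ultimately show ?thesis by (simp only:)
  qed
  have gs: "((\<lambda>n. exp (- b * \<bar>real_of_int l\<bar>) * g n) has_sum (exp (- b * \<bar>real_of_int l\<bar>) * (1 + \<bar>real_of_int l\<bar> + 2 * S))) UNIV"
    by (rule has_sum_cmult_right[OF g])
  show sm: "(\<lambda>n::int. exp (- b * (\<bar>real_of_int n\<bar> + \<bar>real_of_int (n - l)\<bar>))) summable_on UNIV"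
    by (rule summable_on_comparison_test[OF has_sum_imp_summable[OF gs] le]) simp
  show "(\<Sum>\<^sub>\<infinity>n::int. exp (- b * (\<bar>real_of_int n\<bar> + \<bar>real_of_int (n - l)\<bar>)))
       \<le> exp (- b * \<bar>real_of_int l\<bar>) * (1 + \<bar>real_of_int l\<bar> + 2 * S)"
    by (rule has_sum_mono[OF has_sum_infsum[OF sm] gs le])
qed

text \<open>Along the diagonal \<open>n - m = l\<close> the exponential weights sum to about (1 +
  |l|) exp(-b |l|). The growth exp(b |l|) / sqrt(1 + |l|) of the reciprocal Gamma function cancels
  the exponential and leaves sqrt(1 + |l|), comparable to the weight in \<open>f\<close>.\<close>

lemma hankel_rGamma:
  fixes f :: "int \<Rightarrow> complex"
  assumes w: "w > 0" and f: "(\<lambda>l::int. norm (f l) * (1 + (real_of_int l)\<^sup>2) powr (1/4)) summable_on UNIV"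
  shows "hankel w (\<lambda>l. f l * rGamma (1 - \<i> * of_real (w * of_int l)))"
proof
  show "w > 0" by (rule w)
  define c where "c l = f l * rGamma (1 - \<i> * of_real (w * of_int l))" for l
  define b where "b = pi * w / 2"
  have b: "b > 0" using w by (simp add: b_def)
  define S where "S = (\<Sum>\<^sub>\<infinity>n::int. exp (- (2 * b) * \<bar>real_of_int n\<bar>))"
  have S: "S \<ge> 0" unfolding S_def by (rule infsum_nonneg) simp
  define F where "F = (\<lambda>(l, n). norm (c l) * exp (- b * (\<bar>real_of_int n\<bar> + \<bar>real_of_int (n - l)\<bar>)))"
  \<comment> \<open>Allows \<open>1 + pi * w * t\<close> to be replaced by
    \<open>\<mu> * (1 + t)\<close>, so that the square root cancels against a power of
    \<open>1 + t\<close>.\<close>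
  define \<mu> where "\<mu> = min 1 (pi * w)"
  have \<mu>: "\<mu> > 0" using w by (simp add: \<mu>_def)
  define C where "C = sqrt 2 * (1 + 2 * S) / sqrt \<mu> * 2 powr (1/4)"
  have cb: "norm (c l) * (exp (- b * \<bar>real_of_int l\<bar>) * (1 + \<bar>real_of_int l\<bar> + 2 * S))
      \<le> C * (norm (f l) * (1 + (real_of_int l)\<^sup>2) powr (1/4))" for l
  proof -
    define t where "t = \<bar>real_of_int l\<bar>"
    have t: "t \<ge> 0" by (simp add: t_def)
    have "norm (c l) \<le> norm (f l) * (sqrt 2 * exp (b * t) / sqrt (1 + pi * w * t))"
      using mult_left_mono[OF norm_rGamma_le[of "w * of_int l"], of "norm (f l)"] w
      by (simp add: c_def norm_mult abs_mult t_def b_def mult_ac)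
    also have "\<dots> \<le> norm (f l) * (sqrt 2 * exp (b * t) / sqrt (\<mu> * (1 + t)))"
    proof -
      have "\<mu> * 1 \<le> 1" "\<mu> * t \<le> pi * w * t" using t by (auto simp: \<mu>_def intro!: mult_right_mono)
      then have "\<mu> * (1 + t) \<le> 1 + pi * w * t" by (simp add: algebra_simps)
      then have "sqrt (\<mu> * (1 + t)) \<le> sqrt (1 + pi * w * t)" by simp
      then show ?thesis using \<mu> t by (intro mult_left_mono divide_left_mono) (auto intro!: mult_pos_pos add_pos_nonneg mult_nonneg_nonneg simp: w less_imp_le)
    qed
    finally have "norm (c l) * (exp (- b * t) * (1 + t + 2 * S))
        \<le> norm (f l) * (sqrt 2 * exp (b * t) / sqrt (\<mu> * (1 + t))) * (exp (- b * t) * (1 + t + 2 * S))"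
      using S t by (intro mult_right_mono) auto
    also have "\<dots> = norm (f l) * sqrt 2 / sqrt \<mu> * ((1 + t + 2 * S) / sqrt (1 + t))"
    proof -
      have "exp (b * t) * exp (- b * t) = 1" by (simp flip: exp_add)
      moreover have "norm (f l) * (sqrt 2 * exp (b * t) / (sqrt \<mu> * sqrt (1 + t))) * (exp (- b * t) * (1 + t + 2 * S))
          = norm (f l) * sqrt 2 / sqrt \<mu> * ((1 + t + 2 * S) / sqrt (1 + t)) * (exp (b * t) * exp (- b * t))"
        by (simp only: divide_inverse inverse_mult_distrib mult_ac)
      ultimately show ?thesis unfolding real_sqrt_mult by simp
    qed
    also have "\<dots> \<le> norm (f l) * sqrt 2 / sqrt \<mu> * ((1 + 2 * S) * (2 powr (1/4) * (1 + t\<^sup>2) powr (1/4)))"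
    proof (intro mult_left_mono)
      have "1 + t + 2 * S \<le> (1 + 2 * S) * (1 + t)" using S t by (simp add: algebra_simps)
      then have "(1 + t + 2 * S) / sqrt (1 + t) \<le> (1 + 2 * S) * (1 + t) / sqrt (1 + t)"
        using t by (intro divide_right_mono) auto
      also have "\<dots> = (1 + 2 * S) * sqrt (1 + t)"
        using t by (simp add: real_div_sqrt flip: times_divide_eq_right)
      also have "sqrt (1 + t) \<le> (2 * (1 + t\<^sup>2)) powr (1/4)"
      proof -
        have "(1 + t)\<^sup>2 \<le> 2 * (1 + t\<^sup>2)"
          using sum_squares_ge_zero[of "1 - t" 0] by (simp add: power2_eq_square algebra_simps)
        then have "((1 + t)\<^sup>2) powr (1/4) \<le> (2 * (1 + t\<^sup>2)) powr (1/4)"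
          by (intro powr_mono2) auto
        moreover have "((1 + t)\<^sup>2) powr (1/4) = sqrt (1 + t)"
          using t by (simp add: powr_half_sqrt[symmetric] powr_powr flip: powr_numeral)
        ultimately show ?thesis by simp
      qed
      also have "(2 * (1 + t\<^sup>2)) powr (1/4) = 2 powr (1/4) * (1 + t\<^sup>2) powr (1/4)"
        by (rule powr_mult)
      finally show "(1 + t + 2 * S) / sqrt (1 + t) \<le> (1 + 2 * S) * (2 powr (1/4) * (1 + t\<^sup>2) powr (1/4))"
        using S by (simp add: mult_left_mono)
    qed (use \<mu> in auto)
    also have "\<dots> = C * (norm (f l) * (1 + t\<^sup>2) powr (1/4))" by (simp add: C_def field_simps)
    finally show ?thesis by (simp add: t_def)
  qed
  have "F summable_on (UNIV \<times> UNIV)"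
  proof (rule summable_on_SigmaI)
    fix l :: int
    show "((\<lambda>n. F (l, n)) has_sum (norm (c l) * (\<Sum>\<^sub>\<infinity>n. exp (- b * (\<bar>real_of_int n\<bar> + \<bar>real_of_int (n - l)\<bar>))))) UNIV"
      unfolding F_def using has_sum_cmult_right[OF has_sum_infsum[OF exp_two_point_sum(1)[OF b, of l]], of "norm (c l)"] by simp
  next
    show "(\<lambda>l. norm (c l) * (\<Sum>\<^sub>\<infinity>n. exp (- b * (\<bar>real_of_int n\<bar> + \<bar>real_of_int (n - l)\<bar>)))) summable_on UNIV"
    proof (rule summable_on_comparison_test)
      show "(\<lambda>l. C * (norm (f l) * (1 + (real_of_int l)\<^sup>2) powr (1/4))) summable_on UNIV"
        by (rule summable_on_cmult_right[OF f])
      fix l :: int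
      have "norm (c l) * (\<Sum>\<^sub>\<infinity>n. exp (- b * (\<bar>real_of_int n\<bar> + \<bar>real_of_int (n - l)\<bar>)))
          \<le> norm (c l) * (exp (- b * \<bar>real_of_int l\<bar>) * (1 + \<bar>real_of_int l\<bar> + 2 * S))"
        unfolding S_def by (intro mult_left_mono exp_two_point_sum(2)[OF b]) auto
      also note cb
      finally show "norm (c l) * (\<Sum>\<^sub>\<infinity>n. exp (- b * (\<bar>real_of_int n\<bar> + \<bar>real_of_int (n - l)\<bar>)))
          \<le> C * (norm (f l) * (1 + (real_of_int l)\<^sup>2) powr (1/4))" .
    qed (auto intro!: mult_nonneg_nonneg infsum_nonneg)
  qed (auto simp: F_def)
  moreover have "bij (\<lambda>(n, m). (n - m, n :: int))"
    by (rule o_bij[of "\<lambda>(l, n). (n, n - l)"]) (auto simp: fun_eq_iff)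
  ultimately have "(F \<circ> (\<lambda>(n, m). (n - m, n))) summable_on UNIV \<times> UNIV"
    using summable_on_reindex[of "\<lambda>(n, m). (n - m, n :: int)" UNIV F] by (simp add: bij_def)
  moreover have "F \<circ> (\<lambda>(n, m). (n - m, n)) =
      (\<lambda>(n, m). norm (c (n - m)) * exp (- pi * w * (\<bar>real_of_int n\<bar> + \<bar>real_of_int m\<bar>) / 2))"
    by (auto simp: F_def b_def fun_eq_iff)
  ultimately show "(\<lambda>(n, m). norm (f (n - m) * rGamma (1 - \<i> * of_real (w * of_int (n - m)))) *
      exp (- pi * w * (\<bar>real_of_int n\<bar> + \<bar>real_of_int m\<bar>) / 2)) summable_on UNIV \<times> UNIV"
    by (simp add: c_def)
qed

definition hankel_coeff :: "real \<Rightarrow> (real \<Rightarrow> real) \<Rightarrow> int \<Rightarrow> complex" where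
  "hankel_coeff T p l = fourier_coeff T p l * rGamma (1 - \<i> * of_real (omega T * of_int l))"

section \<open>The gauge transformation from \<open>Hmat\<close> to \<open>K\<close>\<close>

locale periodic_hankel =
  fixes T :: real and p :: "real \<Rightarrow> real"
  assumes T_pos: "T > 0"
    and p_smooth: "(\<lambda>l::int. norm (fourier_coeff T p l) * (1 + (real_of_int l)\<^sup>2) powr (1/4)) summable_on UNIV"

sublocale periodic_hankel \<subseteq> hankel "omega T" "hankel_coeff T p"
  unfolding hankel_coeff_def[abs_def]
  by (rule hankel_rGamma[OF _ p_smooth]) (use T_pos in \<open>simp add: omega_def\<close>)

context periodic_hankel
begin

text \<open>This is Gamma(1/2 + iv) Gamma(1/2 - iv) = pi sech(pi v), the reflection formula, with
  the denominator cleared in the normalisation of \<open>th\<close> and \<open>sg\<close>.\<close>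

lemma th_Gamma:
  fixes k :: real
  defines "u n \<equiv> \<i> * of_real (k + omega T * of_int n)"
  shows "th n (of_real k) * (Gamma (1/2 - u n) * Gamma (1/2 + u n)) = 2 * cpi * sg n (of_real k)"
proof -
  define v :: complex where "v = of_real (k + omega T * of_int n)"
  have u: "u n = \<i> * v" by (simp add: u_def v_def)
  have v: "of_real k + of_real (omega T) * of_int n = v" by (simp add: v_def)
  have "Gamma (1/2 + u n) * Gamma (1 - (1/2 + u n)) = cpi / sin (cpi * (1/2 + u n))"
    by (rule Gamma_reflection_complex)
  moreover have "1 - (1/2 + u n) = 1/2 - u n" by simp
  moreover have "sin (cpi * (1/2 + u n)) = (exp (- (cpi * v)) + exp (cpi * v)) / 2"
  proof -
    have "sin (cpi * (1/2 + u n)) = cos (\<i> * (cpi * v))"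
      unfolding u by (subst sin_cos_eq) (simp add: algebra_simps flip: cos_minus[of "\<i> * (cpi * v)"])
    then show ?thesis unfolding cos_exp_eq by (simp flip: mult.assoc)
  qed
  moreover have nz: "exp (- (cpi * v)) + exp (cpi * v) \<noteq> 0"
  proof -
    have "exp (- (cpi * v)) + exp (cpi * v) = of_real (exp (- (pi * (k + omega T * of_int n))) + exp (pi * (k + omega T * of_int n)))"
      unfolding v_def by (simp flip: exp_of_real)
    moreover have "exp (- (pi * (k + omega T * of_int n))) + exp (pi * (k + omega T * of_int n)) > 0"
      by (intro add_pos_pos) auto
    ultimately show ?thesis by (metis less_irrefl of_real_eq_0_iff)
  qed
  ultimately have G: "Gamma (1/2 - u n) * Gamma (1/2 + u n) = 2 * cpi / (exp (- (cpi * v)) + exp (cpi * v))"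
    by (simp add: mult.commute)
  have "th n (of_real k) = sg n (of_real k) * (exp (- (cpi * v)) + exp (cpi * v))"
    unfolding th_def sg_def v sexp_def by (auto simp: algebra_simps simp flip: exp_add)
  then show ?thesis unfolding G using nz by simp
qed

lemma norm_th_ge_1: "norm (th n (complex_of_real k)) \<ge> 1"
proof -
  have "th n (of_real k) = of_real (1 + (if n \<ge> 0 then exp (- (2 * pi * (k + omega T * of_int n))) else exp (2 * pi * (k + omega T * of_int n))))"
    by (simp add: th_def sexp_def flip: exp_of_real)
  then show ?thesis by (simp only: norm_of_real) auto
qed

text \<open>The Gamma factor absorbs the numerator of the Beta function, and \<open>wt\<close>
  balances the decay between rows and columns.\<close>

definition gauge :: "real \<Rightarrow> int \<Rightarrow> complex" where
  "gauge k n = of_real (wt n) * Gamma (1/2 + \<i> * of_real (k + omega T * of_int n))"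

lemma gauge_nonzero: "gauge k n \<noteq> 0"
proof -
  have "1/2 + \<i> * of_real (k + omega T * of_int n) \<notin> \<int>\<^sub>\<le>\<^sub>0"
  proof
    assume "1/2 + \<i> * of_real (k + omega T * of_int n) \<in> \<int>\<^sub>\<le>\<^sub>0"
    then obtain j where "1/2 + \<i> * of_real (k + omega T * of_int n) = complex_of_int j"
      by (elim nonpos_Ints_cases)
    then have "real_of_int (2 * j) = 1" by (drule_tac arg_cong[where f=Re]) simp
    then have "2 * j = 1" by linarith
    then show False by presburger
  qed
  then show ?thesis by (simp add: gauge_def wt_def Gamma_eq_zero_iff)
qed

text \<open>For real \<open>k\<close> the squared Gamma factor is pi sech, with decay exp(-pi omega
  |n|), and \<open>(wt n)\<^sup>2\<close> compensates exactly this. Hence square summable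
  eigenvectors become bounded sequences, as \<open>sol\<close> asks.\<close>

lemma norm_gauge_le: "(norm (gauge k n))\<^sup>2 \<le> 2 * pi * exp (pi * \<bar>k\<bar>)"
proof -
  define u where "u = \<i> * of_real (k + omega T * of_int n)"
  have "Gamma (1/2 - u) = cnj (Gamma (1/2 + u))" by (simp add: cnj_Gamma u_def)
  then have "of_real ((norm (Gamma (1/2 + u)))\<^sup>2) * th n (of_real k) = 2 * cpi * sg n (of_real k)"
    using th_Gamma[where k=k and n=n] unfolding complex_norm_square u_def by (simp add: mult_ac)
  then have "(norm (Gamma (1/2 + u)))\<^sup>2 * norm (th n (of_real k)) = 2 * pi * norm (sg n (of_real k))"
    by (metis norm_mult norm_of_real abs_of_nonneg zero_le_power2 norm_numeral pi_ge_zero)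
  moreover have "(norm (Gamma (1/2 + u)))\<^sup>2 * 1 \<le> (norm (Gamma (1/2 + u)))\<^sup>2 * norm (th n (of_real k))"
    by (intro mult_left_mono norm_th_ge_1) auto
  moreover have "norm (sg n (of_real k)) \<le> exp (pi * \<bar>k\<bar>) * exp (- pi * omega T * \<bar>real_of_int n\<bar>)"
    unfolding sg_def by (rule norm_sexp_le) auto
  ultimately have "(norm (Gamma (1/2 + u)))\<^sup>2 \<le> 2 * pi * (exp (pi * \<bar>k\<bar>) * exp (- pi * omega T * \<bar>real_of_int n\<bar>))"
    by (smt (verit, best) mult_left_mono pi_ge_zero)
  then have "(wt n)\<^sup>2 * (norm (Gamma (1/2 + u)))\<^sup>2 \<le> (wt n)\<^sup>2 * (2 * pi * (exp (pi * \<bar>k\<bar>) * exp (- pi * omega T * \<bar>real_of_int n\<bar>)))"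
    by (intro mult_left_mono) auto
  also have "\<dots> = 2 * pi * exp (pi * \<bar>k\<bar>)"
  proof -
    have "(wt n)\<^sup>2 * exp (- pi * omega T * \<bar>real_of_int n\<bar>) = 1"
      unfolding wt_def power2_eq_square exp_add[symmetric] by simp
    then show ?thesis by (simp add: mult_ac)
  qed
  finally show ?thesis by (simp add: gauge_def norm_mult power_mult_distrib u_def)
qed

text \<open>Of the Beta function, \<open>Gamma (1/2 - u n)\<close> is completed by the left gauge
  factor to a reflection product, \<open>Gamma (1/2 + u m)\<close> becomes part of the right gauge
  factor, and the denominator depends only on \<open>n - m\<close> and goes into
  \<open>hankel_coeff\<close>.\<close>

lemma Hmat_gauge:
  "th n (of_real k) * gauge k n * Hmat T p k n m = K (of_real k) n m * gauge k m"
proof -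
  define u where "u n = \<i> * of_real (k + omega T * of_int n)" for n
  have a: "1/2 - \<i> * of_real (omega T) * of_int n - \<i> * of_real k = 1/2 - u n"
    "1/2 + \<i> * of_real (omega T) * of_int m + \<i> * of_real k = 1/2 + u m"
    by (simp_all add: u_def algebra_simps)
  have s: "(1/2 - u n) + (1/2 + u m) = 1 - \<i> * of_real (omega T * of_int (n - m))"
    by (simp add: u_def algebra_simps)
  have w0: "of_real (wt m) \<noteq> (0 :: complex)" by (simp add: wt_def)
  have "th n (of_real k) * gauge k n * Hmat T p k n m
      = (th n (of_real k) * (Gamma (1/2 - u n) * Gamma (1/2 + u n))) * of_real (wt n) * Gamma (1/2 + u m)
         * (fourier_coeff T p (n - m) * rGamma (1 - \<i> * of_real (omega T * of_int (n - m))))"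
    unfolding Hmat_def a Beta_altdef s gauge_def u_def[symmetric] by (simp only: mult_ac)
  also have "\<dots> = K (of_real k) n m * gauge k m"
    unfolding u_def th_Gamma unfolding K_def gauge_def hankel_coeff_def using w0 by (simp add: mult_ac)
  finally show ?thesis .
qed

lemma eigenvector_sol:
  assumes "in_eigenspace T p k lam x"
  shows "sol (of_real k) lam (\<lambda>n. gauge k n * x n)"
  unfolding sol_def
proof (intro conjI allI)
  have x2: "(\<lambda>n. (norm (x n))\<^sup>2) summable_on UNIV" using assms by (simp add: in_eigenspace_def)
  define A where "A = (\<Sum>\<^sub>\<infinity>n. (norm (x n))\<^sup>2)"
  have xb: "(norm (x n))\<^sup>2 \<le> A" for n
    using finite_sum_le_infsum[OF x2, of "{n}"] by (simp add: A_def)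
  have "norm (gauge k n * x n) \<le> sqrt (2 * pi * exp (pi * \<bar>k\<bar>) * A)" for n
  proof (rule real_le_rsqrt)
    show "(norm (gauge k n * x n))\<^sup>2 \<le> 2 * pi * exp (pi * \<bar>k\<bar>) * A"
      unfolding norm_mult power_mult_distrib by (intro mult_mono norm_gauge_le xb) auto
  qed
  then show "\<exists>B. \<forall>n. norm (gauge k n * x n) \<le> B" by blast
  fix n
  have "((\<lambda>m. Hmat T p k n m * x m) has_sum (lam * x n)) UNIV" using assms by (simp add: in_eigenspace_def)
  from has_sum_cmult_right[OF this, of "th n (of_real k) * gauge k n"]
  have "((\<lambda>m. th n (of_real k) * gauge k n * Hmat T p k n m * x m) has_sum
      (th n (of_real k) * gauge k n * (lam * x n))) UNIV"
    by (simp only: mult.assoc)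
  then show "((\<lambda>m. K (of_real k) n m * (gauge k m * x m)) has_sum (lam * th n (of_real k) * (gauge k n * x n))) UNIV"
    unfolding Hmat_gauge by (simp only: mult_ac)
qed

lemma band_zero:
  assumes "band_functions T p I E" "i \<in> I"
  shows "G (of_real k) (of_real (1 / E i k)) = 0"
proof -
  define lam where "lam = complex_of_real (E i k)"
  have lam: "lam \<noteq> 0" using assms by (auto simp: band_functions_def lam_def)
  have fin: "finite {i\<in>I. complex_of_real (E i k) = lam}"
    and ml: "mult_at_least T p k lam d \<longleftrightarrow> d \<le> card {i\<in>I. complex_of_real (E i k) = lam}" for d
    using assms lam unfolding band_functions_def by blast+
  have "i \<in> {i\<in>I. complex_of_real (E i k) = lam}" using assms by (simp add: lam_def)
  then have "1 \<le> card {i\<in>I. complex_of_real (E i k) = lam}"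
    using fin card_gt_0_iff[of "{i\<in>I. complex_of_real (E i k) = lam}"] by (auto simp: Suc_le_eq)
  then obtain v where v: "\<forall>i<(1::nat). in_eigenspace T p k lam (v i)"
    and ind: "\<forall>c. (\<forall>n. (\<Sum>i<(1::nat). c i * v i n) = 0) \<longrightarrow> (\<forall>i<(1::nat). c i = 0)"
    using ml[of 1] unfolding mult_at_least_def by blast
  have "\<not> (\<forall>n. v 0 n = 0)" using ind[rule_format, of "\<lambda>_. 1" 0] by auto
  then obtain n0 where n0: "v 0 n0 \<noteq> 0" by blast
  have "G (of_real k) (1 / lam) = 0"
  proof (rule G_eq_0_if_sol[OF _ lam])
    show "sol (of_real k) lam (\<lambda>n. gauge k n * v 0 n)" using v by (auto intro: eigenvector_sol)
    show "gauge k n0 * v 0 n0 \<noteq> 0" using n0 gauge_nonzero by simp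
  qed
  then show ?thesis by (simp add: lam_def)
qed

lemma band_double_zero:
  assumes "band_functions T p I E" "i \<in> I" "j \<in> I" "i \<noteq> j" "E i k = E j k"
  obtains C where "\<And>z. norm z \<le> R \<Longrightarrow> norm (G (of_real k) z) \<le> C * (norm (1 - z * of_real (E i k)))\<^sup>2"
proof -
  define lam where "lam = complex_of_real (E i k)"
  have lam: "lam \<noteq> 0" using assms by (auto simp: band_functions_def lam_def)
  have fin: "finite {i\<in>I. complex_of_real (E i k) = lam}"
    and ml: "mult_at_least T p k lam d \<longleftrightarrow> d \<le> card {i\<in>I. complex_of_real (E i k) = lam}" for d
    using assms lam unfolding band_functions_def by blast+
  have "card {i, j} \<le> card {i\<in>I. complex_of_real (E i k) = lam}"
    using assms by (intro card_mono fin) (auto simp: lam_def)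
  then obtain v where v: "\<forall>i<(2::nat). in_eigenspace T p k lam (v i)"
    and ind: "\<forall>c. (\<forall>n. (\<Sum>i<(2::nat). c i * v i n) = 0) \<longrightarrow> (\<forall>i<(2::nat). c i = 0)"
    using ml[of 2] assms(4) unfolding mult_at_least_def by auto
  have s: "sol (of_real k) lam (\<lambda>n. gauge k n * v 0 n)" "sol (of_real k) lam (\<lambda>n. gauge k n * v 1 n)"
    by (rule eigenvector_sol, simp add: v)+
  have "r = 0 \<and> r' = 0" if h: "\<forall>n. r * (gauge k n * v 0 n) + r' * (gauge k n * v 1 n) = 0" for r r'
  proof -
    have "r * v 0 n + r' * v 1 n = 0" for n
    proof -
      have "gauge k n * (r * v 0 n + r' * v 1 n) = 0" using h[rule_format, of n] by (simp add: algebra_simps)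
      then show ?thesis using gauge_nonzero by simp
    qed
    then have "\<forall>n. (\<Sum>i<(2::nat). (if i = 0 then r else r') * v i n) = 0"
      by (simp add: numeral_2_eq_2)
    then have "\<forall>i<(2::nat). (if i = 0 then r else r') = 0"
      by (rule ind[THEN spec[of _ "\<lambda>i. if i = 0 then r else r'"], THEN mp])
    from this[rule_format, of 0] this[rule_format, of 1] show ?thesis by simp
  qed
  then show thesis using G_double_zero_if_sols[OF s lam, of R] that unfolding lam_def by blast
qed

end

section \<open>Band functions\<close>

lemma real_analytic_has_derivative:
  assumes "real_analytic f"
  shows "\<exists>D. (f has_real_derivative D) (at x)"
proof -
  obtain r a where r: "r > 0" and a: "\<And>y. \<bar>y - x\<bar> < r \<Longrightarrow> (\<lambda>n. a n * (y - x) ^ n) sums f y"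
    using assms unfolding real_analytic_def by blast
  define g where "g = (\<lambda>h. \<Sum>n. a n * h ^ n)"
  have "summable (\<lambda>n. a n * (r / 2) ^ n)"
    using a[of "x + r / 2"] r by (auto simp: sums_iff)
  then have "DERIV g 0 :> (\<Sum>n. diffs a n * 0 ^ n)"
    unfolding g_def by (rule termdiffs_strong) (use r in auto)
  then have "((\<lambda>y. g (y - x)) has_real_derivative (\<Sum>n. diffs a n * 0 ^ n)) (at x)"
    using DERIV_shift[of "\<lambda>y. g (y - x)" _ 0 x] by simp
  then have "(f has_real_derivative (\<Sum>n. diffs a n * 0 ^ n)) (at x)"
  proof (rule has_field_derivative_transform_within_open[where S = "ball x r"])
    show "g (y - x) = f y" if "y \<in> ball x r" for y
      using a[of y] that by (simp add: g_def sums_iff dist_real_def abs_minus_commute)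
  qed (use r in auto)
  then show ?thesis by blast
qed

lemma real_analytic_isCont:
  assumes "real_analytic f"
  shows "isCont f x"
proof -
  obtain D where "(f has_real_derivative D) (at x)" using real_analytic_has_derivative[OF assms] ..
  then show ?thesis by (rule DERIV_isCont)
qed

lemma real_analytic_dichotomy:
  assumes "real_analytic f"
  shows "(\<forall>\<^sub>F y in at x. f y \<noteq> f x) \<or> (\<forall>\<^sub>F y in nhds x. f y = f x)"
proof -
  obtain r a where r: "r > 0" and a: "\<And>y. \<bar>y - x\<bar> < r \<Longrightarrow> (\<lambda>n. a n * (y - x) ^ n) sums f y"
    using assms unfolding real_analytic_def by blast
  have a0: "a 0 = f x"
  proof -
    have "(\<lambda>n. a n * (x - x) ^ n) sums f x" using a[of x] r by simp
    moreover have "(\<lambda>n. a n * 0 ^ n) sums a 0" by (rule powser_sums_zero)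
    ultimately show ?thesis using sums_unique2 by simp
  qed
  define a' where "a' n = (if n = 0 then 0 else a n)" for n
  have a': "(\<lambda>n. a' n * (y - x) ^ n) sums (f y - f x)" if "norm (y - x) < r" for y
  proof -
    have "(\<lambda>n. a n * (y - x) ^ n - (if n = 0 then f x else 0)) sums (f y - f x)"
      using that by (intro sums_diff a sums_single) auto
    moreover have "a n * (y - x) ^ n - (if n = 0 then f x else 0) = a' n * (y - x) ^ n" for n
      by (simp add: a'_def a0)
    ultimately show ?thesis by simp
  qed
  show ?thesis
  proof (cases "\<exists>m>0. a' m \<noteq> 0")
    case True
    then obtain m where m: "m > 0" "a' m \<noteq> 0" by blast
    obtain s where s: "s > 0" "\<And>y. y \<in> cball x s - {x} \<Longrightarrow> f y - f x \<noteq> 0"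
      using powser_0_nonzero[OF r a' _ m(2,1)] by auto
    have "\<forall>\<^sub>F y in at x. f y \<noteq> f x"
      unfolding eventually_at using s by (intro exI[of _ s]) (auto simp: dist_commute)
    then show ?thesis ..
  next
    case False
    then have "a' n = 0" for n using a'_def[of 0] by (metis gr0I)
    then have fx: "f y = f x" if "norm (y - x) < r" for y
      using a'[OF that] sums_unique2[OF sums_zero] by fastforce
    have "\<forall>\<^sub>F y in nhds x. f y = f x"
      unfolding eventually_nhds_metric
    proof (intro exI[of _ r] conjI allI impI r)
      fix y assume "dist y x < r"
      then show "f y = f x" by (intro fx) (simp add: dist_real_def)
    qed
    then show ?thesis ..
  qed
qed

text \<open>The set where \<open>f\<close> is locally equal to \<open>f x\<close> is open, and it is
  closed because at a limit point the first alternative of \<open>real_analytic_dichotomy\<close>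
  fails. Connectedness of the line then forces flatness.\<close>

lemma real_analytic_isolated:
  assumes f: "real_analytic f" and nf: "\<not> flat f"
  shows "\<forall>\<^sub>F y in at x. f y \<noteq> f x"
proof (rule ccontr)
  assume ne: "\<not> ?thesis"
  define Z where "Z = {y. \<forall>\<^sub>F t in nhds y. f t = f x}"
  have "open Z"
  proof (subst open_subopen, intro ballI)
    fix y assume "y \<in> Z"
    then obtain S where S: "open S" "y \<in> S" "\<forall>t\<in>S. f t = f x" by (auto simp: Z_def eventually_nhds)
    then have "S \<subseteq> Z" by (auto simp: Z_def eventually_nhds)
    then show "\<exists>T. open T \<and> y \<in> T \<and> T \<subseteq> Z" using S by blast
  qed
  moreover have "closed Z"
    unfolding closed_sequential_limits
  proof (intro allI impI, elim conjE)
    fix s l assume s: "\<forall>n. s n \<in> Z" and l: "s \<longlonglongrightarrow> l"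
    have fs: "f (s n) = f x" for n
      by (rule eventually_nhds_x_imp_x[where P = "\<lambda>t. f t = f x"]) (use s in \<open>simp add: Z_def\<close>)
    have "(\<lambda>n. f (s n)) \<longlonglongrightarrow> f l"
      by (rule isCont_tendsto_compose[OF real_analytic_isCont[OF f] l])
    then have fl: "f l = f x" using LIMSEQ_unique[of "\<lambda>n. f (s n)" "f l" "f x"] fs by simp
    show "l \<in> Z"
    proof (cases "\<exists>n. s n = l")
      case True
      then show ?thesis using s by auto
    next
      case False
      have "\<not> (\<forall>\<^sub>F y in at l. f y \<noteq> f l)"
      proof
        assume "\<forall>\<^sub>F y in at l. f y \<noteq> f l"
        moreover have "filterlim s (at l) sequentially"
          using l False by (auto simp: filterlim_at)
        ultimately have "\<forall>\<^sub>F n in sequentially. f (s n) \<noteq> f l" by (rule eventually_compose_filterlim)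
        then show False using fs fl by (simp add: eventually_False)
      qed
      then show ?thesis using real_analytic_dichotomy[OF f, of l] fl by (simp add: Z_def)
    qed
  qed
  moreover have "x \<in> Z" using ne real_analytic_dichotomy[OF f, of x] by (simp add: Z_def)
  ultimately have "Z = UNIV" using clopen[of Z] by auto
  then have "\<forall>\<^sub>F t in nhds y. f t = f x" for y by (auto simp: Z_def)
  then have "\<forall>y. f y = f x" by (intro allI eventually_nhds_x_imp_x[where P = "\<lambda>t. f t = f x"])
  then show False using nf unfolding flat_def by blast
qed

section \<open>Common zeros of two entire functions\<close>

lemma entire_divide_zero:
  assumes "f holomorphic_on UNIV" "f z0 = 0"
  obtains g where "g holomorphic_on UNIV" "\<And>z. f z = (z - z0) * g z"
proof
  show "(\<lambda>z. if z = z0 then deriv f z0 else (f z - f z0) / (z - z0)) holomorphic_on UNIV"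
    by (rule pole_lemma_open[OF assms(1)]) simp
  show "f z = (z - z0) * (if z = z0 then deriv f z0 else (f z - f z0) / (z - z0))" for z
    using assms(2) by simp
qed

text \<open>The order of the zero at \<open>z0\<close> is finite because \<open>f\<close> is not
  identically zero. The form as a bound on exponents is the one needed to pick a maximal common
  power.\<close>

lemma entire_order_bound:
  assumes hol: "f holomorphic_on UNIV" and nz: "f z1 \<noteq> 0"
  obtains N :: nat where
    "\<And>m g. g holomorphic_on UNIV \<Longrightarrow> (\<And>z. f z = (z - z0) ^ m * g z) \<Longrightarrow> m \<le> N"
proof (cases "f z0 = 0")
  case False
  show thesis
  proof (rule that[of 0])
    fix m g assume "\<And>z. f z = (z - z0) ^ m * g z"
    from this[of z0] False show "m \<le> (0::nat)" by (cases m) auto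
  qed
next
  case True
  have nc: "\<not> f constant_on UNIV" using True nz by (force simp: constant_on_def)
  obtain g0 r n where n: "0 < n" "0 < r" "g0 holomorphic_on ball z0 r"
      "\<And>w. w \<in> ball z0 r \<Longrightarrow> f w = (w - z0) ^ n * g0 w" "\<And>w. w \<in> ball z0 r \<Longrightarrow> g0 w \<noteq> 0"
    by (rule holomorphic_factor_zero_nonconstant[OF hol open_UNIV connected_UNIV UNIV_I True nc]) (rule that)
  show thesis
  proof (rule that[of n])
    fix m g assume g: "g holomorphic_on UNIV" "\<And>z. f z = (z - z0) ^ m * g z"
    show "m \<le> n"
    proof (rule ccontr)
      assume "\<not> m \<le> n"
      then have mn: "m = n + (m - n)" "m - n > 0" by auto
      have ev: "\<forall>\<^sub>F w in at z0. (w - z0) ^ (m - n) * g w = g0 w"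
        unfolding eventually_at
      proof (intro exI[of _ r] conjI ballI impI n)
        fix w assume w: "w \<noteq> z0 \<and> dist w z0 < r"
        then have "(w - z0) ^ n * ((w - z0) ^ (m - n) * g w) = (w - z0) ^ n * g0 w"
          using n(4)[of w] g(2)[of w] mn(1) by (metis dist_commute mem_ball mult.assoc power_add)
        then show "(w - z0) ^ (m - n) * g w = g0 w" using w by simp
      qed
      have "isCont g z0"
        using holomorphic_on_imp_continuous_on[OF g(1)] by (simp add: continuous_on_eq_continuous_at)
      then have "((\<lambda>w. (w - z0) ^ (m - n) * g w) \<longlongrightarrow> (z0 - z0) ^ (m - n) * g z0) (at z0)"
        by (intro tendsto_intros) (auto simp: isCont_def)
      then have lim0: "(g0 \<longlongrightarrow> 0) (at z0)" using mn(2) tendsto_cong[OF ev] by (simp add: power_0_left)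
      have "continuous_on (ball z0 r) g0" by (rule holomorphic_on_imp_continuous_on[OF n(3)])
      then have "(g0 \<longlongrightarrow> g0 z0) (at z0)"
        using n(2) by (simp add: continuous_on_eq_continuous_at isCont_def)
      then have "g0 z0 = 0" by (rule tendsto_unique[OF at_neq_bot _ lim0])
      then show False using n by simp
    qed
  qed
qed

text \<open>\<open>m\<close> is maximal among the powers dividing both functions:
  \<open>a z1 \<noteq> 0\<close> bounds these powers, and a common zero of the cofactors would raise
  the maximum. \<open>b\<close> may vanish identically.\<close>

lemma entire_common_factor:
  assumes a: "a holomorphic_on UNIV" "a z1 \<noteq> 0" and b: "b holomorphic_on UNIV"
  obtains m a1 b1 where "a1 holomorphic_on UNIV" "b1 holomorphic_on UNIV"
    "\<And>z. a z = (z - z0) ^ m * a1 z" "\<And>z. b z = (z - z0) ^ m * b1 z" "a1 z0 \<noteq> 0 \<or> b1 z0 \<noteq> 0"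
proof -
  define D where "D m \<longleftrightarrow> (\<exists>a1 b1. a1 holomorphic_on UNIV \<and> b1 holomorphic_on UNIV \<and>
    (\<forall>z. a z = (z - z0) ^ m * a1 z) \<and> (\<forall>z. b z = (z - z0) ^ m * b1 z))" for m :: nat
  obtain N where N: "\<And>m g. g holomorphic_on UNIV \<Longrightarrow> (\<And>z. a z = (z - z0) ^ m * g z) \<Longrightarrow> m \<le> N"
    using entire_order_bound[OF a] by blast
  have "D 0" unfolding D_def using a b by (intro exI[of _ a] exI[of _ b]) auto
  moreover have DN: "m \<le> N" if "D m" for m using that N unfolding D_def by blast
  ultimately obtain m where m: "D m" "\<not> D (Suc m)"
  proof -
    have "\<exists>m. D m \<and> \<not> D (Suc m)"
    proof (rule ccontr)
      assume "\<not> ?thesis"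
      then have "D m" for m using \<open>D 0\<close> by (induction m) auto
      then show False using DN[of "Suc N"] by simp
    qed
    then show thesis using that by blast
  qed
  then obtain a1 b1 where ab: "a1 holomorphic_on UNIV" "b1 holomorphic_on UNIV"
    "\<And>z. a z = (z - z0) ^ m * a1 z" "\<And>z. b z = (z - z0) ^ m * b1 z"
    unfolding D_def by blast
  have "a1 z0 \<noteq> 0 \<or> b1 z0 \<noteq> 0"
  proof (rule ccontr)
    assume "\<not> ?thesis"
    then obtain a2 b2 where "a2 holomorphic_on UNIV" "\<And>z. a1 z = (z - z0) * a2 z"
      "b2 holomorphic_on UNIV" "\<And>z. b1 z = (z - z0) * b2 z"
      using entire_divide_zero[OF ab(1)] entire_divide_zero[OF ab(2)] by metis
    then have "D (Suc m)" unfolding D_def using ab(3,4)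
      by (intro exI[of _ a2] exI[of _ b2]) (auto simp: mult_ac)
    then show False using m by simp
  qed
  then show thesis using that ab by blast
qed

section \<open>Band functions as solutions of \<open>a + b * phi = 0\<close>\<close>

locale band_system = theta +
  fixes a b :: "complex \<Rightarrow> complex" and I :: "nat set" and E :: "nat \<Rightarrow> real \<Rightarrow> real"
  assumes hol_a: "a holomorphic_on UNIV" and hol_b: "b holomorphic_on UNIV"
    and a_even: "\<And>z. a (- z) = a z" and b_odd: "\<And>z. b (- z) = - b z" and a_0: "a 0 \<noteq> 0"
    and analytic: "\<And>i. i \<in> I \<Longrightarrow> real_analytic (E i)"
    and nonzero: "\<And>i k. i \<in> I \<Longrightarrow> E i k \<noteq> 0"
    and zero: "\<And>i k. i \<in> I \<Longrightarrow> a (of_real (1 / E i k)) + b (of_real (1 / E i k)) * of_real (phi k) = 0"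
    and double: "\<And>i j k R. i \<in> I \<Longrightarrow> j \<in> I \<Longrightarrow> i \<noteq> j \<Longrightarrow> E i k = E j k \<Longrightarrow>
       \<exists>C. \<forall>z. norm z \<le> R \<longrightarrow> norm (a z + b z * of_real (phi k)) \<le> C * (norm (1 - z * of_real (E i k)))\<^sup>2"
begin

definition J :: "nat set" where "J = {i\<in>I. \<not> flat (E i)}"

lemma J_I: "i \<in> J \<Longrightarrow> i \<in> I" by (simp add: J_def)

lemma isCont_E: "i \<in> I \<Longrightarrow> isCont (E i) k"
  by (intro real_analytic_isCont analytic)

lemma tendsto_inverse_E:
  assumes "i \<in> I"
  shows "((\<lambda>k. complex_of_real (1 / E i k)) \<longlongrightarrow> of_real (1 / E i k0)) (nhds k0)"
proof -
  have "isCont (\<lambda>k. complex_of_real (1 / E i k)) k0"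
    using isCont_E[OF assms] nonzero[OF assms] by (intro continuous_intros) auto
  then show ?thesis
    using tendsto_at_iff_tendsto_nhds[of "\<lambda>k. complex_of_real (1 / E i k)" k0] unfolding isCont_def by blast
qed

lemma isCont_phi: "isCont phi k"
proof -
  obtain D where "(phi has_real_derivative D) (at k)" using phi_has_deriv ..
  then show ?thesis by (rule DERIV_isCont)
qed

text \<open>After cancelling the common power of \<open>z - z0\<close> from \<open>a\<close> and \<open>b\<close>, which accounts for the flat bands,
  a non-flat band still satisfies the reduced equation. The sign \<open>s\<close> covers bands with value \<open>- 1 / z0\<close>.\<close>

lemma reduced_equation:
  assumes i: "i \<in> J" and s: "s = 1 \<or> s = -1"
    and ab: "a1 holomorphic_on UNIV" "b1 holomorphic_on UNIV"
      "\<And>z. a z = (z - z0) ^ m * a1 z" "\<And>z. b z = (z - z0) ^ m * b1 z"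
    and z0: "z0 = s * of_real (1 / E i k0)"
  shows "\<forall>\<^sub>F k in nhds k0. a1 (s * of_real (1 / E i k)) + s * b1 (s * of_real (1 / E i k)) * of_real (phi k) = 0"
proof -
  have iI: "i \<in> I" using i by (rule J_I)
  define Z where "Z k = s * complex_of_real (1 / E i k)" for k
  define h where "h k = a1 (Z k) + s * b1 (Z k) * of_real (phi k)" for k
  \<comment> \<open>A non-flat band leaves its value at \<open>k0\<close> at once, so near but off
    \<open>k0\<close> the power of \<open>Z k - z0\<close> can be cancelled; continuity then
    supplies \<open>k0\<close> itself.\<close>
  have ev: "\<forall>\<^sub>F k in at k0. h k = 0"
    using real_analytic_isolated[OF analytic[OF iI], of k0] i
  proof (simp add: J_def, elim eventually_mono)
    fix k assume ne: "E i k \<noteq> E i k0"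
    then have "1 / E i k \<noteq> 1 / E i k0" using nonzero[OF iI] by (simp add: field_simps)
    then have Z: "Z k - z0 \<noteq> 0" using s unfolding Z_def z0 by auto
    have "a (Z k) = a (of_real (1 / E i k))" "b (Z k) = s * b (of_real (1 / E i k))"
      using s by (auto simp: Z_def a_even b_odd simp del: of_real_divide)
    then have "a (Z k) + s * b (Z k) * of_real (phi k) = 0"
      using zero[OF iI, of k] s by (auto simp del: of_real_divide)
    then have "(Z k - z0) ^ m * h k = 0"
      unfolding h_def ab(3,4) by (simp add: algebra_simps)
    then show "h k = 0" using Z by simp
  qed
  have cont: "isCont h k0"
  proof -
    have cZ: "isCont Z k0" unfolding Z_def using isCont_E[OF iI] nonzero[OF iI] by (intro continuous_intros) auto
    have "isCont a1 (Z k0)" "isCont b1 (Z k0)"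
      using ab(1,2) by (auto simp: continuous_on_eq_continuous_at dest!: holomorphic_on_imp_continuous_on)
    then have "isCont (\<lambda>k. a1 (Z k)) k0" "isCont (\<lambda>k. b1 (Z k)) k0"
      using isCont_o2[OF cZ] by auto
    then show ?thesis
      unfolding h_def using isCont_phi by (intro continuous_intros)
  qed
  have "(h \<longlongrightarrow> 0) (at k0)" by (rule tendsto_eventually[OF ev])
  then have "h k0 = 0" using cont unfolding isCont_def by (intro tendsto_unique[OF at_neq_bot])
  then have "\<forall>\<^sub>F k in nhds k0. h k = 0" using ev by (auto simp: eventually_at_filter elim: eventually_mono)
  then show ?thesis by (simp add: h_def Z_def)
qed

lemma reduced_pair:
  obtains m a1 b1 where "a1 holomorphic_on UNIV" "b1 holomorphic_on UNIV"
    "\<And>z. a z = (z - z0) ^ m * a1 z" "\<And>z. b z = (z - z0) ^ m * b1 z" "a1 z0 \<noteq> 0 \<or> b1 z0 \<noteq> 0"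
  by (rule entire_common_factor[OF hol_a a_0 hol_b]) (rule that)

text \<open>Both bands satisfy the reduced equation at the same \<open>z0\<close>. There
  \<open>b1\<close> cannot vanish, since \<open>a1\<close> would vanish too, so the equation
  determines \<open>phi\<close> up to the sign \<open>s\<close>, which the parities of
  \<open>a\<close> and \<open>b\<close> bring in.\<close>

lemma phi_eq_if_band_values_eq:
  assumes i: "i \<in> J" and j: "j \<in> J" and s: "s = 1 \<or> s = -1" and eq: "E i k1 = s * E j k2"
  shows "phi k1 = s * phi k2"
proof -
  define z0 where "z0 = complex_of_real (1 / E i k1)"
  have zi: "z0 = 1 * complex_of_real (1 / E i k1)" by (simp add: z0_def)
  have zj: "z0 = of_real s * complex_of_real (1 / E j k2)" using s by (auto simp: z0_def eq)
  obtain m a1 b1 where ab: "a1 holomorphic_on UNIV" "b1 holomorphic_on UNIV"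
    "\<And>z. a z = (z - z0) ^ m * a1 z" "\<And>z. b z = (z - z0) ^ m * b1 z" "a1 z0 \<noteq> 0 \<or> b1 z0 \<noteq> 0"
    by (rule reduced_pair[of z0]) (rule that)
  have s': "complex_of_real s = 1 \<or> complex_of_real s = -1" using s by auto
  have 1: "a1 z0 + b1 z0 * of_real (phi k1) = 0"
    using eventually_nhds_x_imp_x[OF reduced_equation[OF i _ ab(1-4) zi]] unfolding zi[symmetric] by simp
  have 2: "a1 z0 + of_real s * b1 z0 * of_real (phi k2) = 0"
    using eventually_nhds_x_imp_x[OF reduced_equation[OF j s' ab(1-4) zj]] unfolding zj[symmetric] .
  have b1: "b1 z0 \<noteq> 0" using 1 ab(5) by auto
  have "b1 z0 * (of_real (phi k1) - of_real (s * phi k2))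
      = (a1 z0 + b1 z0 * of_real (phi k1)) - (a1 z0 + of_real s * b1 z0 * of_real (phi k2))"
    by (simp add: algebra_simps)
  then have "b1 z0 * (of_real (phi k1) - of_real (s * phi k2)) = 0" unfolding 1 2 by simp
  then have "complex_of_real (phi k1) = of_real (s * phi k2)" using b1 by simp
  then show ?thesis using of_real_eq_iff by blast
qed

lemma bands_eq_imp_cong:
  assumes "i \<in> J" "j \<in> J" "E i k1 = E j k2"
  shows "(\<exists>n::int. k1 - k2 = of_int n * w) \<or> (\<exists>n::int. k1 + k2 = of_int n * w)"
  using phi_eq_if_band_values_eq[OF assms(1,2), of 1 k1 k2] assms(3) by (intro phi_eq_imp) simp

lemma bands_not_opposite:
  assumes "i \<in> J" "j \<in> J"
  shows "E i k1 \<noteq> - E j k2"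
  using phi_eq_if_band_values_eq[OF assms, of "-1" k1 k2] phi_pos[of k1] phi_pos[of k2] by auto

text \<open>Near \<open>k0\<close>, \<open>phi\<close> is the composition of
  \<open>- a1 / b1\<close> with \<open>1 / E i\<close>. Its derivative is non-zero off the multiples
  of \<open>w / 2\<close>, so by the chain rule neither factor can vanish.\<close>

lemma local_structure:
  assumes i: "i \<in> J" and k0: "\<nexists>n::int. k0 = of_int n * w / 2"
    and ab: "a1 holomorphic_on UNIV" "b1 holomorphic_on UNIV"
      "\<And>z. a z = (z - z0) ^ m * a1 z" "\<And>z. b z = (z - z0) ^ m * b1 z" "a1 z0 \<noteq> 0 \<or> b1 z0 \<noteq> 0"
    and z0: "z0 = of_real (1 / E i k0)"
  shows "b1 z0 \<noteq> 0" and "deriv (\<lambda>z. - a1 z / b1 z) z0 \<noteq> 0" and "deriv (E i) k0 \<noteq> 0"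
    and "\<forall>\<^sub>F k in nhds k0. b1 (of_real (1 / E i k)) \<noteq> 0 \<and>
       - a1 (of_real (1 / E i k)) / b1 (of_real (1 / E i k)) = of_real (phi k)"
proof -
  have iI: "i \<in> I" using i by (rule J_I)
  have zi: "z0 = 1 * of_real (1 / E i k0)" using z0 by simp
  have ev: "\<forall>\<^sub>F k in nhds k0. a1 (of_real (1 / E i k)) + b1 (of_real (1 / E i k)) * of_real (phi k) = 0"
    using reduced_equation[OF i _ ab(1-4) zi] by simp
  have "a1 z0 + b1 z0 * of_real (phi k0) = 0" using eventually_nhds_x_imp_x[OF ev] z0 by simp
  then show b1: "b1 z0 \<noteq> 0" using ab(5) by auto
  have opn: "open {z. b1 z \<noteq> 0}"
    by (intro open_Collect_neq holomorphic_on_imp_continuous_on[OF ab(2)] continuous_intros)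
  have Z: "((\<lambda>k. complex_of_real (1 / E i k)) \<longlongrightarrow> z0) (nhds k0)"
    unfolding z0 by (rule tendsto_inverse_E[OF iI])
  have "\<forall>\<^sub>F k in nhds k0. b1 (of_real (1 / E i k)) \<noteq> 0"
    using topological_tendstoD[OF Z opn] b1 by simp
  with ev show ev2: "\<forall>\<^sub>F k in nhds k0. b1 (of_real (1 / E i k)) \<noteq> 0 \<and>
       - a1 (of_real (1 / E i k)) / b1 (of_real (1 / E i k)) = of_real (phi k)"
    by eventually_elim (auto simp: field_simps add_eq_0_iff2 simp del: of_real_divide)
  define \<rho> where "\<rho> z = - a1 z / b1 z" for z
  have "\<rho> holomorphic_on {z. b1 z \<noteq> 0}"
    unfolding \<rho>_def by (intro holomorphic_intros holomorphic_on_subset[OF ab(1)] holomorphic_on_subset[OF ab(2)]) auto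
  then have d\<rho>: "(\<rho> has_field_derivative deriv \<rho> z0) (at z0)"
    using opn b1 by (auto intro: holomorphic_derivI)
  obtain D where D: "(E i has_real_derivative D) (at k0)"
    using real_analytic_has_derivative[OF analytic[OF iI]] ..
  define D' where "D' = - D / (E i k0)\<^sup>2"
  have "((\<lambda>k. 1 / E i k) has_real_derivative D') (at k0)"
    unfolding D'_def using D nonzero[OF iI] by (auto intro!: derivative_eq_intros simp: power2_eq_square)
  then have "((\<lambda>k. complex_of_real (1 / E i k)) has_vector_derivative of_real D') (at k0)"
    by (intro has_vector_derivative_of_real) (simp add: has_real_derivative_iff_has_vector_derivative)
  from field_vector_diff_chain_at[OF this, of \<rho> "deriv \<rho> z0"] d\<rho>
  have "((\<lambda>k. \<rho> (of_real (1 / E i k))) has_vector_derivative (of_real D' * deriv \<rho> z0)) (at k0)"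
    unfolding z0 by (simp add: o_def)
  moreover obtain V where V: "open V" "k0 \<in> V" "\<And>k. k \<in> V \<Longrightarrow> \<rho> (of_real (1 / E i k)) = complex_of_real (phi k)"
    using ev2 unfolding eventually_nhds \<rho>_def by blast
  ultimately have "((\<lambda>k. complex_of_real (phi k)) has_vector_derivative (of_real D' * deriv \<rho> z0)) (at k0)"
    by (rule has_vector_derivative_transform_within_open)
  then have "((\<lambda>k. Re (complex_of_real (phi k))) has_real_derivative Re (of_real D' * deriv \<rho> z0)) (at k0)"
    by (rule has_field_derivative_Re)
  then have "(phi has_real_derivative Re (of_real D' * deriv \<rho> z0)) (at k0)" by simp
  then have "Re (of_real D' * deriv \<rho> z0) \<noteq> 0" using phi_deriv_nonzero k0 by blast
  then have "D' \<noteq> 0" "deriv \<rho> z0 \<noteq> 0" by auto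
  then show "deriv (\<lambda>z. - a1 z / b1 z) z0 \<noteq> 0" "deriv (E i) k0 \<noteq> 0"
    using DERIV_imp_deriv[OF D] unfolding \<rho>_def[abs_def] by (auto simp: D'_def)
qed

lemma deriv_band_nonzero:
  assumes "i \<in> J" "\<nexists>n::int. k = of_int n * w / 2"
  shows "deriv (E i) k \<noteq> 0"
proof -
  obtain m a1 b1 where "a1 holomorphic_on UNIV" "b1 holomorphic_on UNIV"
    "\<And>z. a z = (z - of_real (1 / E i k)) ^ m * a1 z" "\<And>z. b z = (z - of_real (1 / E i k)) ^ m * b1 z"
    "a1 (of_real (1 / E i k)) \<noteq> 0 \<or> b1 (of_real (1 / E i k)) \<noteq> 0"
    by (rule reduced_pair[of "of_real (1 / E i k)"]) (rule that)
  from local_structure(3)[OF assms this refl] show ?thesis .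
qed

text \<open>Otherwise \<open>\<rho>\<close> is injective near \<open>z0\<close> by
  \<open>local_structure\<close>, so bands meeting at \<open>k0\<close> also agree at all nearby
  \<open>k\<close>. For such a \<open>k\<close> the double zero at \<open>z1 = 1 / E i k\<close>
  makes \<open>z1\<close> a critical point of \<open>\<rho>\<close>, against injectivity. At
  \<open>z0\<close> itself the double zero could stem from \<open>(z - z0) ^ m\<close> and would say
  nothing about \<open>\<rho>\<close>.\<close>

lemma bands_cross_at_half_period:
  assumes i: "i \<in> J" and j: "j \<in> J" and ij: "i \<noteq> j" and eq: "E i k0 = E j k0"
  shows "\<exists>n::int. k0 = of_int n * w / 2"
proof (rule ccontr)
  assume k0: "\<not> ?thesis"
  have iI: "i \<in> I" and jI: "j \<in> I" using i j by (simp_all add: J_I)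
  define z0 where "z0 = complex_of_real (1 / E i k0)"
  have z0j: "z0 = complex_of_real (1 / E j k0)" by (simp add: z0_def eq)
  obtain m a1 b1 where ab: "a1 holomorphic_on UNIV" "b1 holomorphic_on UNIV"
    "\<And>z. a z = (z - z0) ^ m * a1 z" "\<And>z. b z = (z - z0) ^ m * b1 z" "a1 z0 \<noteq> 0 \<or> b1 z0 \<noteq> 0"
    by (rule reduced_pair[of z0]) (rule that)
  note Li = local_structure[OF i k0 ab z0_def] and Lj = local_structure[OF j k0 ab z0j]
  define \<rho> where "\<rho> z = - a1 z / b1 z" for z
  define U where "U = {z. b1 z \<noteq> 0}"
  have U: "open U" unfolding U_def
    by (intro open_Collect_neq holomorphic_on_imp_continuous_on[OF ab(2)] continuous_intros)
  have hol: "\<rho> holomorphic_on U"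
    unfolding \<rho>_def U_def by (intro holomorphic_intros holomorphic_on_subset[OF ab(1)] holomorphic_on_subset[OF ab(2)]) auto
  have z0U: "z0 \<in> U" using Li(1) by (simp add: U_def)
  have "deriv \<rho> z0 \<noteq> 0" using Li(2) unfolding \<rho>_def[abs_def] .
  then obtain r where r: "r > 0" "ball z0 r \<subseteq> U" "inj_on \<rho> (ball z0 r)"
    using has_complex_derivative_locally_injective[OF hol z0U U] by blast
  have near: "\<forall>\<^sub>F k in nhds k0. complex_of_real (1 / E l k) \<in> ball z0 r" if "l \<in> I" "E l k0 = E i k0" for l
  proof -
    have "((\<lambda>k. complex_of_real (1 / E l k)) \<longlongrightarrow> complex_of_real (1 / E l k0)) (nhds k0)"
      by (rule tendsto_inverse_E[OF that(1)])
    from topological_tendstoD[OF this open_ball, of z0 r] show ?thesis using that(2) r(1) by (simp add: z0_def)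
  qed
  have "\<forall>\<^sub>F k in at k0. E i k \<noteq> E i k0 \<and>
     complex_of_real (1 / E i k) \<in> ball z0 r \<and> complex_of_real (1 / E j k) \<in> ball z0 r \<and>
     \<rho> (of_real (1 / E i k)) = of_real (phi k) \<and> \<rho> (of_real (1 / E j k)) = of_real (phi k)"
  proof (intro eventually_conj)
    show "\<forall>\<^sub>F k in at k0. E i k \<noteq> E i k0"
      using i by (intro real_analytic_isolated analytic) (auto simp: J_def)
    show "\<forall>\<^sub>F k in at k0. complex_of_real (1 / E i k) \<in> ball z0 r"
      "\<forall>\<^sub>F k in at k0. complex_of_real (1 / E j k) \<in> ball z0 r"
      using near[OF iI refl] near[OF jI eq[symmetric]] by (simp_all only: eventually_nhds_conv_at)
    show "\<forall>\<^sub>F k in at k0. \<rho> (of_real (1 / E i k)) = of_real (phi k)"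
      "\<forall>\<^sub>F k in at k0. \<rho> (of_real (1 / E j k)) = of_real (phi k)"
      using Li(4) Lj(4) unfolding \<rho>_def eventually_nhds_conv_at eventually_conj_iff by blast+
  qed
  \<comment> \<open>The condition \<open>ne\<close> keeps \<open>z1\<close> away from
    \<open>z0\<close>, where the cancelled power vanishes.\<close>
  from eventually_happens'[OF at_neq_bot this] obtain k where ne: "E i k \<noteq> E i k0"
    and zi: "complex_of_real (1 / E i k) \<in> ball z0 r" and zj: "complex_of_real (1 / E j k) \<in> ball z0 r"
    and \<rho>i: "\<rho> (of_real (1 / E i k)) = of_real (phi k)" and \<rho>j: "\<rho> (of_real (1 / E j k)) = of_real (phi k)"
    by blast
  have "complex_of_real (1 / E i k) = of_real (1 / E j k)"
    by (rule inj_onD[OF r(3) _ zi zj]) (simp only: \<rho>i \<rho>j)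
  then have "1 / E i k = 1 / E j k" using of_real_eq_iff by blast
  then have ek: "E i k = E j k" by simp
  define z1 where "z1 = complex_of_real (1 / E i k)"
  have E0: "complex_of_real (E i k) \<noteq> 0" using nonzero[OF iI] by simp
  have z10: "z1 - z0 \<noteq> 0" using ne nonzero[OF iI] by (simp add: z1_def z0_def)
  have z1b: "z1 \<in> ball z0 r" using zi by (simp add: z1_def)
  have b1: "b1 z1 \<noteq> 0" using z1b r(2) by (auto simp: U_def)
  obtain C where C: "\<And>z. norm z \<le> norm z1 + 1 \<Longrightarrow>
      norm (a z + b z * of_real (phi k)) \<le> C * (norm (1 - z * of_real (E i k)))\<^sup>2"
    using double[OF iI jI ij ek, of "norm z1 + 1"] by blast
  define h where "h z = a z + b z * of_real (phi k)" for z
  have h0: "((\<lambda>z. h z / (z - z1)) \<longlongrightarrow> 0) (at z1)"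
  proof (rule Lim_null_comparison)
    have "((\<lambda>z. C * (norm (E i k))\<^sup>2 * norm (z - z1)) \<longlongrightarrow> C * (norm (E i k))\<^sup>2 * norm (z1 - z1)) (at z1)"
      by (intro tendsto_intros)
    then show "((\<lambda>z. C * (norm (E i k))\<^sup>2 * norm (z - z1)) \<longlongrightarrow> 0) (at z1)" by simp
    show "\<forall>\<^sub>F z in at z1. norm (h z / (z - z1)) \<le> C * (norm (E i k))\<^sup>2 * norm (z - z1)"
      unfolding eventually_at
    proof (intro exI[of _ 1] conjI ballI impI)
      fix z assume z: "z \<noteq> z1 \<and> dist z z1 < 1"
      have "norm z \<le> norm z1 + 1" using norm_triangle_ineq2[of z z1] z by (simp add: dist_norm)
      then have "norm (h z) \<le> C * (norm (1 - z * of_real (E i k)))\<^sup>2" unfolding h_def by (rule C)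
      also have "1 - z * of_real (E i k) = - of_real (E i k) * (z - z1)"
        using E0 by (simp add: z1_def algebra_simps)
      also have "C * (norm (- of_real (E i k) * (z - z1)))\<^sup>2 = C * (norm (E i k))\<^sup>2 * norm (z - z1) * norm (z - z1)"
        by (simp add: norm_mult power_mult_distrib power2_eq_square)
      finally show "norm (h z / (z - z1)) \<le> C * (norm (E i k))\<^sup>2 * norm (z - z1)"
        using z by (simp add: norm_divide pos_divide_le_eq)
    qed simp
  qed
  \<comment> \<open>Since \<open>phi k = \<rho> z1\<close>, \<open>h z\<close> equals
    \<open>- ((z - z0) ^ m * b1 z) * (\<rho> z - \<rho> z1)\<close>. Division turns the second-order
    bound on \<open>h\<close> into a zero derivative of \<open>\<rho>\<close> at
    \<open>z1\<close>.\<close>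
  have "((\<lambda>z. - (h z / (z - z1)) / ((z - z0) ^ m * b1 z)) \<longlongrightarrow> - 0 / ((z1 - z0) ^ m * b1 z1)) (at z1)"
    using z10 b1 holomorphic_on_imp_continuous_on[OF ab(2)]
    by (intro tendsto_intros h0) (auto simp: continuous_on_eq_continuous_at isCont_def)
  moreover have "\<forall>\<^sub>F z in at z1. - (h z / (z - z1)) / ((z - z0) ^ m * b1 z) = (\<rho> z - \<rho> z1) / (z - z1)"
  proof -
    have "open (U - {z0})" using U by (simp add: open_delete)
    moreover have "z1 \<in> U - {z0}" using b1 z10 by (auto simp: U_def)
    ultimately have "\<forall>\<^sub>F z in at z1. z \<in> U - {z0} \<and> z \<noteq> z1"
      by (auto simp: eventually_at_filter eventually_nhds)
    then show ?thesis
    proof eventually_elim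
      case (elim z)
      have "h z = (z - z0) ^ m * (a1 z + b1 z * \<rho> z1)"
        unfolding h_def ab(3,4) using \<rho>i by (simp add: z1_def algebra_simps)
      then have "h z = - ((z - z0) ^ m * b1 z) * (\<rho> z - \<rho> z1)"
        using elim by (simp add: \<rho>_def[of z] U_def field_simps)
      then show ?case using elim by (simp add: U_def)
    qed
  qed
  ultimately have "((\<lambda>z. (\<rho> z - \<rho> z1) / (z - z1)) \<longlongrightarrow> 0) (at z1)"
    using tendsto_cong by fastforce
  then have "(\<rho> has_field_derivative 0) (at z1)" by (simp add: has_field_derivative_iff)
  then have "deriv \<rho> z1 = 0" by (rule DERIV_imp_deriv)
  moreover have "deriv \<rho> z1 \<noteq> 0"
    by (rule holomorphic_injective_imp_regular[OF holomorphic_on_subset[OF hol r(2)] open_ball r(3) z1b])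
  ultimately show False by simp
qed

section \<open>Distinctness, counting and monotonicity of bands\<close>

lemma int_mult_w_small:
  assumes "\<bar>of_int n * w\<bar> < w"
  shows "n = 0"
proof -
  have "\<bar>real_of_int n\<bar> * w < 1 * w" using assms w_pos by (simp add: abs_mult)
  then have "\<bar>real_of_int n\<bar> < 1" using w_pos by (subst (asm) mult_less_cancel_right_pos) auto
  then show ?thesis by linarith
qed

lemma bands_distinct:
  assumes "i \<in> J" "j \<in> J" "i \<noteq> j"
  shows "E i \<noteq> E j"
proof
  assume "E i = E j"
  \<comment> \<open>Identical bands would cross everywhere, in particular at \<open>w / 4\<close>,
    which is not a multiple of \<open>w / 2\<close>.\<close>
  then obtain n :: int where "w / 4 = of_int n * w / 2" using bands_cross_at_half_period[OF assms, of "w / 4"] by auto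
  then have "real_of_int (2 * n) = 1" using w_pos by (simp add: field_simps)
  then have "2 * n = 1" by linarith
  then show False by presburger
qed

text \<open>\<open>k'\<close> is congruent to \<open>k\<close> or to \<open>- k\<close> modulo
  \<open>w\<close>. In the first case the difference is too small to be a non-zero period; the
  second is impossible, since \<open>2 * k0\<close> is a period and the distances of
  \<open>k\<close> and \<open>k'\<close> from \<open>k0\<close> add up to something strictly between
  0 and \<open>w\<close>.\<close>

lemma bands_eq_in_half_period_imp_eq:
  assumes i: "i \<in> J" and k0: "k0 = of_int n * w / 2" and k: "k0 < k" "k < k0 + w / 2"
    and j: "j \<in> J" and k': "k0 \<le> k'" "k' \<le> k" and eq: "E i k = E j k'"
  shows "k = k'"
  using bands_eq_imp_cong[OF i j eq]
proof
  assume "\<exists>m::int. k - k' = of_int m * w"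
  then obtain m :: int where m: "k - k' = of_int m * w" ..
  have "m = 0" by (rule int_mult_w_small) (use k k' w_pos in \<open>auto simp: m[symmetric] abs_if\<close>)
  then show ?thesis using m by simp
next
  assume "\<exists>m::int. k + k' = of_int m * w"
  then obtain m :: int where m: "k + k' = of_int m * w" ..
  have "of_int (m - n) * w = (k - k0) + (k' - k0)" using m k0 by (simp add: algebra_simps)
  then have m': "of_int (m - n) * w > 0" "of_int (m - n) * w < w" using k k' by auto
  then have "m - n = 0" by (intro int_mult_w_small) auto
  then show ?thesis using m' by simp
qed

text \<open>If both bands leave the common value in the same direction, the value of
  \<open>i\<close> at \<open>k0 + w / 4\<close>, the less distant one, is attained by
  \<open>j\<close> no later. By \<open>bands_eq_in_half_period_imp_eq\<close> it is attained exactly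
  there, a crossing off the multiples of \<open>w / 2\<close>. The offset \<open>w / 4\<close> is
  merely an interior point of the half period.\<close>

lemma same_side:
  assumes i: "i \<in> J" and j: "j \<in> J" and k0: "k0 = of_int n * w / 2" and eq: "E i k0 = E j k0"
    and le: "E i k0 < E i (k0 + w / 4) \<and> E i (k0 + w / 4) \<le> E j (k0 + w / 4)
        \<or> E i k0 > E i (k0 + w / 4) \<and> E i (k0 + w / 4) \<ge> E j (k0 + w / 4)"
  shows "i = j"
proof (rule ccontr)
  assume ij: "i \<noteq> j"
  have co: "continuous_on {k0..k0 + w / 4} (E j)"
    using isCont_E[OF J_I[OF j]] by (intro continuous_at_imp_continuous_on) auto
  have "\<exists>k'\<ge>k0. k' \<le> k0 + w / 4 \<and> E j k' = E i (k0 + w / 4)"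
    using le
  proof
    assume "E i k0 < E i (k0 + w / 4) \<and> E i (k0 + w / 4) \<le> E j (k0 + w / 4)"
    then show ?thesis using eq w_pos by (intro IVT'[OF _ _ _ co]) auto
  next
    assume "E i k0 > E i (k0 + w / 4) \<and> E i (k0 + w / 4) \<ge> E j (k0 + w / 4)"
    then show ?thesis using eq w_pos by (intro IVT2'[OF _ _ _ co]) auto
  qed
  then obtain k' where k': "k0 \<le> k'" "k' \<le> k0 + w / 4" "E i (k0 + w / 4) = E j k'" by auto
  have "k0 + w / 4 = k'"
    by (rule bands_eq_in_half_period_imp_eq[OF i k0 _ _ j k']) (use w_pos in auto)
  then have "E i (k0 + w / 4) = E j (k0 + w / 4)" using k' by simp
  then obtain m :: int where "k0 + w / 4 = of_int m * w / 2" using bands_cross_at_half_period[OF i j ij] by blast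
  then have "w * (real_of_int (2 * (m - n)) - 1) = 0" unfolding k0 by (simp add: algebra_simps)
  then have "real_of_int (2 * (m - n)) = 1" using w_pos by simp
  then have "2 * (m - n) = 1" by linarith
  then show False by presburger
qed

text \<open>Off the multiples of \<open>w / 2\<close> bands do not meet. At such a multiple, a band
  through \<open>e\<close> is determined by whether it lies above or below \<open>e\<close> at
  \<open>k0 + w / 4\<close>, which leaves two possibilities.\<close>

lemma card_bands_le_2:
  assumes fin: "finite {i\<in>J. E i k0 = e}"
  shows "card {i\<in>J. E i k0 = e} \<le> 2"
proof (cases "\<exists>n::int. k0 = of_int n * w / 2")
  case False
  have "i = j" if "i \<in> {i\<in>J. E i k0 = e}" "j \<in> {i\<in>J. E i k0 = e}" for i j
    using bands_cross_at_half_period[of i j k0] that False by auto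
  then have "card {i\<in>J. E i k0 = e} \<le> Suc 0" using fin by (subst card_le_Suc0_iff_eq) blast+
  then show ?thesis by simp
next
  case True
  then obtain n :: int where k0: "k0 = of_int n * w / 2" ..
  have ne: "E i (k0 + w / 4) \<noteq> e" if "i \<in> J" "E i k0 = e" for i
    using bands_eq_in_half_period_imp_eq[OF that(1) k0 _ _ that(1), of "k0 + w / 4" k0] that(2) w_pos by auto
  have "inj_on (\<lambda>i. E i (k0 + w / 4) > e) {i\<in>J. E i k0 = e}"
  proof (rule inj_onI)
    fix i j assume i: "i \<in> {i\<in>J. E i k0 = e}" and j: "j \<in> {i\<in>J. E i k0 = e}"
      and "(E i (k0 + w / 4) > e) = (E j (k0 + w / 4) > e)"
    then have "E i (k0 + w / 4) > e \<and> E j (k0 + w / 4) > e \<or> E i (k0 + w / 4) < e \<and> E j (k0 + w / 4) < e"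
      using ne[of i] ne[of j] by auto
    then show "i = j"
      using same_side[OF _ _ k0, of i j] same_side[OF _ _ k0, of j i] i j
      by (cases "E i (k0 + w / 4) \<le> E j (k0 + w / 4)") auto
  qed
  then have "card {i\<in>J. E i k0 = e} \<le> card (UNIV :: bool set)"
    by (intro card_inj_on_le) auto
  then show ?thesis by simp
qed

text \<open>A continuous injective function on an interval is strictly monotone, and neither open
  half period contains two different points congruent up to sign modulo \<open>w\<close>.\<close>

lemma band_strict_monotone:
  assumes i: "i \<in> J" and S: "S = {- w / 2<..<0} \<or> S = {0<..<w / 2}"
  shows "strict_mono_on S (E i) \<or> strict_antimono_on S (E i)"
proof -
  have "inj_on (E i) S"
  proof (rule inj_onI)
    fix x y assume x: "x \<in> S" and y: "y \<in> S" and eq: "E i x = E i y"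
    from bands_eq_imp_cong[OF i i eq] show "x = y"
    proof
      assume "\<exists>m::int. x - y = of_int m * w"
      then obtain m :: int where m: "x - y = of_int m * w" ..
      have "m = 0" by (rule int_mult_w_small) (use x y S in \<open>auto simp: m[symmetric] abs_if\<close>)
      then show ?thesis using m by simp
    next
      assume "\<exists>m::int. x + y = of_int m * w"
      then obtain m :: int where m: "x + y = of_int m * w" ..
      have "m = 0" by (rule int_mult_w_small) (use x y S in \<open>auto simp: m[symmetric] abs_if\<close>)
      then show ?thesis using m x y S by auto
    qed
  qed
  moreover have "is_interval S" using S by auto
  moreover have "continuous_on S (E i)"
    using isCont_E[OF J_I[OF i]] by (intro continuous_at_imp_continuous_on) auto
  ultimately show ?thesis by (simp add: injective_eq_monotone_map)
qed

end

theorem theorem6p3: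
  fixes T :: real and p :: "real \<Rightarrow> real"
    and I :: "nat set" and E :: "nat \<Rightarrow> real \<Rightarrow> real"
  assumes T_pos: "T > 0"
    and p_periodic: "\<forall>x. p (x + T) = p x"
    and p_int: "p absolutely_integrable_on {0..T}"
    and p_smooth: "(\<lambda>l::int. norm (fourier_coeff T p l) * (1 + (real_of_int l)\<^sup>2) powr (1/4))
                     summable_on UNIV"
    and bands: "band_functions T p I E"
  defines "Jns \<equiv> {i\<in>I. \<not> flat (E i)}"
  shows
    "(\<forall>i\<in>Jns. \<forall>j\<in>Jns. i \<noteq> j \<longrightarrow> E i \<noteq> E j)
   \<and> (\<forall>k Est. Est \<noteq> 0 \<longrightarrow> finite {i\<in>Jns. E i k = Est} \<and> card {i\<in>Jns. E i k = Est} \<le> 2)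
   \<and> (\<forall>i\<in>Jns. \<forall>j\<in>Jns. \<forall>k. i \<noteq> j \<and> E i k = E j k
        \<longrightarrow> (\<exists>n::int. k = real_of_int n * omega T / 2))
   \<and> (\<forall>i\<in>Jns. (\<forall>k. (\<nexists>n::int. k = real_of_int n * omega T / 2) \<longrightarrow> deriv (E i) k \<noteq> 0)
        \<and> (strict_mono_on {- omega T / 2<..<0} (E i) \<or> strict_antimono_on {- omega T / 2<..<0} (E i))
        \<and> (strict_mono_on {0<..<omega T / 2} (E i) \<or> strict_antimono_on {0<..<omega T / 2} (E i)))
   \<and> (\<forall>i\<in>Jns. \<forall>j\<in>Jns. \<forall>k1 k2. E i k1 = E j k2 \<longrightarrow>
        (\<exists>n::int. k1 - k2 = real_of_int n * omega T) \<or> (\<exists>n::int. k1 + k2 = real_of_int n * omega T))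
   \<and> (\<forall>i\<in>Jns. \<forall>j\<in>Jns. \<forall>k1 k2. E i k1 \<noteq> - E j k2)"
proof -
  interpret periodic_hankel T p
    using T_pos p_smooth by unfold_locales
  obtain a b where ab: "a holomorphic_on UNIV" "b holomorphic_on UNIV"
    "\<And>z. a (- z) = a z" "\<And>z. b (- z) = - b z" "a 0 \<noteq> 0"
    and G: "\<And>k z. G k z = a z * Y k + b z * Yo k"
    using G_decomposition by blast
  \<comment> \<open>\<open>Y\<close> has no real zeros, so for real \<open>k\<close> the zeros of
    \<open>G\<close> in \<open>z\<close> and their orders are those of
    \<open>a z + b z * of_real (phi k)\<close>.\<close>
  have G_real: "G (of_real k) z = Y (of_real k) * (a z + b z * of_real (phi k))" for k z
    unfolding G Yo_of_real by (simp add: algebra_simps)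
  interpret B: band_system "omega T" a b I E
  proof
    show "a (of_real (1 / E i k)) + b (of_real (1 / E i k)) * of_real (phi k) = 0" if "i \<in> I" for i k
      using band_zero[OF bands that, of k] Y_of_real_nonzero[of k] unfolding G_real by (simp only: mult_eq_0_iff simp_thms)
    show "\<exists>C. \<forall>z. norm z \<le> R \<longrightarrow> norm (a z + b z * of_real (phi k)) \<le> C * (norm (1 - z * of_real (E i k)))\<^sup>2"
      if ij: "i \<in> I" "j \<in> I" "i \<noteq> j" "E i k = E j k" for i j k R
    proof -
      obtain C where C: "\<And>z. norm z \<le> R \<Longrightarrow> norm (G (of_real k) z) \<le> C * (norm (1 - z * of_real (E i k)))\<^sup>2"
        by (rule band_double_zero[OF bands ij]) (rule that)
      have "norm (a z + b z * of_real (phi k)) \<le> C / norm (Y (of_real k)) * (norm (1 - z * of_real (E i k)))\<^sup>2"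
        if "norm z \<le> R" for z
        using C[OF that] Y_of_real_nonzero[of k] unfolding G_real norm_mult by (simp add: field_simps)
      then show ?thesis by blast
    qed
  qed (use ab bands in \<open>auto simp: band_functions_def\<close>)
  have J: "Jns = B.J" by (simp add: Jns_def B.J_def)
  have fin: "finite {i\<in>Jns. E i k = e}" if "e \<noteq> 0" for k e
  proof (rule finite_subset)
    show "{i\<in>Jns. E i k = e} \<subseteq> {i\<in>I. complex_of_real (E i k) = of_real e}" by (auto simp: Jns_def)
    show "finite {i\<in>I. complex_of_real (E i k) = of_real e}"
      using bands that unfolding band_functions_def by (metis of_real_eq_0_iff)
  qed
  show ?thesis
  proof (intro conjI ballI allI impI)
    show "finite {i\<in>Jns. E i k = e}" "card {i\<in>Jns. E i k = e} \<le> 2" if "e \<noteq> 0" for k e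
      using fin[OF that] B.card_bands_le_2 unfolding J by blast+
    show "E i \<noteq> E j" if "i \<in> Jns" "j \<in> Jns" "i \<noteq> j" for i j
      using that B.bands_distinct unfolding J by blast
    show "\<exists>n::int. k = real_of_int n * omega T / 2" if "i \<in> Jns" "j \<in> Jns" "i \<noteq> j \<and> E i k = E j k" for i j k
      using that B.bands_cross_at_half_period unfolding J by blast
    show "deriv (E i) k \<noteq> 0" if "i \<in> Jns" "\<nexists>n::int. k = real_of_int n * omega T / 2" for i k
      using that B.deriv_band_nonzero unfolding J by blast
    show "strict_mono_on {- omega T / 2<..<0} (E i) \<or> strict_antimono_on {- omega T / 2<..<0} (E i)" if "i \<in> Jns" for i
      using that B.band_strict_monotone unfolding J by blast
    show "strict_mono_on {0<..<omega T / 2} (E i) \<or> strict_antimono_on {0<..<omega T / 2} (E i)" if "i \<in> Jns" for i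
      using that B.band_strict_monotone unfolding J by blast
    show "(\<exists>n::int. k1 - k2 = real_of_int n * omega T) \<or> (\<exists>n::int. k1 + k2 = real_of_int n * omega T)"
      if "i \<in> Jns" "j \<in> Jns" "E i k1 = E j k2" for i j k1 k2
      using that B.bands_eq_imp_cong unfolding J by blast
    show "E i k1 \<noteq> - E j k2" if "i \<in> Jns" "j \<in> Jns" for i j k1 k2
      using that B.bands_not_opposite unfolding J by blast
  qed
qed

end
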